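(* Let $\mathcal{M}=(S,Act,\bar s,\mathbf{P})$ be an MDP, $\varphi_1,\dots,\varphi_k$ Rabin properties with pair sets $P_1,\dots,P_k$, $\lambda_i\in[0,1]$, $\triangleright\in\{\geq,>\}$, and $\Psi=\exists\mathfrak{S}.\bigwedge_{i=1}^k\mathbb{P}_{\triangleright\lambda_i}(\varphi_i)$. Let $\widehat{\mathcal{M}}=\mathcal{M}_{/\mathcal{D}_{\mathsf{MEC}}}^{\mathcal{I}^*}$ and $\widehat\Psi=\exists\mathfrak{S}.\bigwedge_{i=1}^k\mathbb{P}_{\triangleright\lambda_i}(\lozenge G_i)$ with $G_i=\{\bot_I\mid I\subseteq[k],\ i\in I\}$. Let $\Lambda:S\to2^L$ be a labeling that is MEC-equivalent w.r.t. $\mathcal{M}$ (all states in the same MEC have the same label set), and $\widehat\Lambda$ its lifting. If $\widehat{\mathcal{M}}'$ is a witnessing subsystem of $\widehat{\mathcal{M}}$ for $\widehat\Psi$ that is minimal with respect to $\widehat\Lambda$, and $X$ is the set of states of $\widehat{\mathcal{M}}'$ lying in $\mathcal{D}_{\mathsf{MEC}}$, then the subsystem $\mathcal{M}_{S'}$ with $S'=\bigcup_{D\in X}D$ is a witnessing subsystem for $\Psi$ and minimal with respect to $\Lambda$.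
   Context: An MDP $(S,Act,\bar s,\mathbf{P})$ has finite $S,Act$, initial $\bar s$, partial $\mathbf{P}:S\times Act\to\mathrm{Dist}(S)$, enabled pairs $\mathsf{En}$; actions of distinct states are pairwise disjoint. An EC is a nonempty $\mathcal{E}\subseteq\mathsf{En}$ closed under successors (within $S(\mathcal{E})$, the states occurring in $\mathcal{E}$) with strongly connected graph; MECs are inclusion-maximal ECs; $\mathcal{D}_{\mathsf{MEC}}$ partitions $S$ into MEC state sets and singletons of states in no MEC. A Rabin property with pairs $P\subseteq2^S\times2^S$ is the path set $\bigvee_{(F,E)\in P}(\square\lozenge F\wedge\lozenge\square E)$; $\mathcal{E}\models_{\mathsf{Rabin}}P$ iff some $(F,E)\in P$ has $S(\mathcal{E})\cap F\ne\emptyset$, $S(\mathcal{E})\subseteq E$. $\mathcal{I}^*=\{(S(\mathcal{E}),I)\mid\mathcal{E}\text{ MEC},I\subseteq[k],\exists\text{ EC }\mathcal{E}'\subseteq\mathcal{E}\ \forall i\in I:\mathcal{E}'\models_{\mathsf{Rabin}}P_i\}$. For a partition $\mathcal{D}$ and $\mathcal{I}\subseteq\mathcal{D}\times2^{[k]}$, $\mathcal{M}_{/\mathcal{D}}^{\mathcal{I}}$ has states $\mathcal{D}\cup\{\bot_I\}_{I\subseteq[k]}$, initial $[\bar s]_{\mathcal{D}}$, transitions $\mathbf{P}'([s],a,[s'])=\mathbf{P}(s,a,[s'])$ for $(s,a)$ with $\mathbf{P}(s,a,[s])<1$, $\mathbf{P}'(D,\tau_I,\bot_I)=1$ for $(D,I)\in\mathcal{I}$,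 absorbing $\bot_I$. $\mathcal{M}\models\exists\mathfrak{S}.\bigwedge_i\mathbb{P}_{\triangleright\lambda_i}(\psi_i)$ iff some scheduler $\mathfrak{S}$ has $\Pr^{\mathfrak{S}}_{\mathcal{M},\bar s}(\psi_i)\triangleright\lambda_i$ for all $i$. Subsystem $\mathcal{M}_{S'}$ for $\bar s\in S'\subseteq S$: sub-stochastic MDP $(S',Act,\bar s,\mathbf{P}')$ keeping enabled pairs of states in $S'$, with $\mathbf{P}'(s,a,s')=\mathbf{P}(s,a,s')$ for $s,s'\in S'$ (mass leaving $S'$ is lost and such paths satisfy no property). Witnessing subsystem: one satisfying the query. Labeling $\Lambda:S\to2^L$, $\Lambda(S')=\bigcup_{s\in S'}\Lambda(s)$; a witnessing subsystem with states $S'$ is minimal w.r.t. $\Lambda$ if no witnessing subsystem has states $S''$ with $|\Lambda(S'')|<|\Lambda(S')|$. Lifting: $\widehat\Lambda(D)=\bigcup_{s\in D}\Lambda(s)$ for $D\in\mathcal{D}_{\mathsf{MEC}}$, $\widehat\Lambda(\bot_I)=\emptyset$. *)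

theory Defs
  imports "HOL-Probability.Probability" "HOL-Library.Equipollence"
begin

text \<open>
  Transitions are sub-distributions (\<open>spmf\<close>), so that one record type covers MDPs (all of whose
  transitions are \<open>lossless_spmf\<close>) and their sub-stochastic subsystems. The value \<open>None\<close> of the
  kernel means that the action is not enabled; this is different from \<open>Some (return_pmf None)\<close>,
  an enabled action that loses all of its mass.
\<close>

record ('s, 'a) smdp =
  states :: "'s set"
  actions :: "'a set"
  initial :: 's
  kernel :: "'s \<Rightarrow> 'a \<Rightarrow> 's spmf option"

definition enabled_pairs :: "('s, 'a) smdp \<Rightarrow> ('s \<times> 'a) set" where
  "enabled_pairs M = {(s, a). kernel M s a \<noteq> None}"

definition enabled :: "('s, 'a) smdp \<Rightarrow> 's \<Rightarrow> 'a set" where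
  "enabled M s = {a. (s, a) \<in> enabled_pairs M}"

definition succ_spmf :: "('s, 'a) smdp \<Rightarrow> 's \<Rightarrow> 'a \<Rightarrow> 's spmf" where
  "succ_spmf M s a = (case kernel M s a of None \<Rightarrow> return_pmf None | Some p \<Rightarrow> p)"

definition substochastic_mdp :: "('s, 'a) smdp \<Rightarrow> bool" where
  "substochastic_mdp M \<longleftrightarrow>
     finite (states M) \<and> finite (actions M) \<and> initial M \<in> states M \<and>
     enabled_pairs M \<subseteq> states M \<times> actions M \<and>
     (\<forall>(s, a) \<in> enabled_pairs M. set_spmf (succ_spmf M s a) \<subseteq> states M)"

definition mdp :: "('s, 'a) smdp \<Rightarrow> bool" where
  "mdp M \<longleftrightarrow> substochastic_mdp M \<and> (\<forall>(s, a) \<in> enabled_pairs M. lossless_spmf (succ_spmf M s a))"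

definition disjoint_actions :: "('s, 'a) smdp \<Rightarrow> bool" where
  "disjoint_actions M \<longleftrightarrow>
     (\<forall>s \<in> states M. \<forall>t \<in> states M. s \<noteq> t \<longrightarrow> enabled M s \<inter> enabled M t = {})"

text \<open>
  A scheduler is randomized and history dependent: it sees the state-action pairs of the path so
  far and the current state. A state may have no enabled action; a run ends there, and
  the value of the scheduler is then irrelevant.
\<close>

type_synonym ('s, 'a) sched = "('s \<times> 'a) list \<Rightarrow> 's \<Rightarrow> 'a pmf"

definition scheduler :: "('s, 'a) smdp \<Rightarrow> ('s, 'a) sched \<Rightarrow> bool" where
  "scheduler M \<sigma> \<longleftrightarrow>
     (\<forall>h. \<forall>s \<in> states M. enabled M s \<noteq> {} \<longrightarrow> set_pmf (\<sigma> h s) \<subseteq> enabled M s)"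

text \<open>
  A run is a function \<open>\<omega> :: nat \<Rightarrow> ('s \<times> 'a) option\<close>, where \<open>\<omega> n = Some (s, a)\<close> records the \<open>n\<close>-th
  state and the action chosen in it, and \<open>None\<close> says that the run has ended before: mass was lost,
  or a state without enabled actions was reached. The infinite paths are the runs without \<open>None\<close>.
  The path measure is the Ionescu-Tulcea limit of the one-step kernels \<open>step_measure\<close>.
\<close>

definition next_state :: "('s, 'a) smdp \<Rightarrow> nat \<Rightarrow> (nat \<Rightarrow> ('s \<times> 'a) option) \<Rightarrow> 's spmf" where
  "next_state M n \<omega> =
     (if n = 0 then return_spmf (initial M)
      else case \<omega> (n - 1) of None \<Rightarrow> return_pmf None | Some (s, a) \<Rightarrow> succ_spmf M s a)"

definition step_spmf ::
  "('s, 'a) smdp \<Rightarrow> ('s, 'a) sched \<Rightarrow> nat \<Rightarrow> (nat \<Rightarrow> ('s \<times> 'a) option) \<Rightarrow> ('s \<times> 'a) spmf" where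
  "step_spmf M \<sigma> n \<omega> =
     bind_spmf (next_state M n \<omega>) (\<lambda>s.
       if enabled M s = {} then return_pmf None
       else map_spmf (Pair s) (spmf_of_pmf (\<sigma> (map (the \<circ> \<omega>) [0..<n]) s)))"

definition step_space :: "('s, 'a) smdp \<Rightarrow> ('s \<times> 'a) option measure" where
  "step_space M = count_space (insert None (Some ` enabled_pairs M))"

definition step_measure ::
  "('s, 'a) smdp \<Rightarrow> ('s, 'a) sched \<Rightarrow> nat \<Rightarrow> (nat \<Rightarrow> ('s \<times> 'a) option) \<Rightarrow> ('s \<times> 'a) option measure"
  where
  "step_measure M \<sigma> n \<omega> =
     restrict_space (measure_pmf (step_spmf M \<sigma> n \<omega>)) (space (step_space M))"

definition path_measure ::
  "('s, 'a) smdp \<Rightarrow> ('s, 'a) sched \<Rightarrow> (nat \<Rightarrow> ('s \<times> 'a) option) measure" where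
  "path_measure M \<sigma> =
     projective_family.lim UNIV
       (Ionescu_Tulcea.CI (step_measure M \<sigma>) (\<lambda>_. step_space M)) (\<lambda>_. step_space M)"

definition path_prob :: "('s, 'a) smdp \<Rightarrow> ('s, 'a) sched \<Rightarrow> (nat \<Rightarrow> 's) set \<Rightarrow> real" where
  "path_prob M \<sigma> \<psi> =
     measure (path_measure M \<sigma>)
       {\<omega> \<in> space (path_measure M \<sigma>). (\<forall>n. \<omega> n \<noteq> None) \<and> (\<lambda>n. fst (the (\<omega> n))) \<in> \<psi>}"

text \<open>The side conditions of the Ionescu-Tulcea construction hold for every scheduler.\<close>

lemma set_step_spmf:
  assumes M: "substochastic_mdp M" and \<sigma>: "scheduler M \<sigma>"
    and \<omega>: "\<And>i. i < n \<Longrightarrow> \<omega> i \<in> insert None (Some ` enabled_pairs M)"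
  shows "set_pmf (step_spmf M \<sigma> n \<omega>) \<subseteq> insert None (Some ` enabled_pairs M)"
proof
  fix x assume x: "x \<in> set_pmf (step_spmf M \<sigma> n \<omega>)"
  show "x \<in> insert None (Some ` enabled_pairs M)"
  proof (cases x)
    case (Some y)
    with x have "y \<in> set_spmf (step_spmf M \<sigma> n \<omega>)"
      by (simp add: in_set_spmf)
    then obtain s where s: "s \<in> set_spmf (next_state M n \<omega>)" and ne: "enabled M s \<noteq> {}"
      and y: "y \<in> Pair s ` set_pmf (\<sigma> (map (the \<circ> \<omega>) [0..<n]) s)"
      by (auto simp: step_spmf_def set_bind_spmf split: if_splits)
    have "s \<in> states M"
    proof (cases n)
      case 0
      with s M show ?thesis by (simp add: next_state_def substochastic_mdp_def)
    next
      case (Suc m)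
      with s obtain t a where "\<omega> m = Some (t, a)" and st: "s \<in> set_spmf (succ_spmf M t a)"
        by (auto simp: next_state_def split: option.splits)
      with \<omega>[of m] Suc have "(t, a) \<in> enabled_pairs M" by auto
      with st M show ?thesis by (auto simp: substochastic_mdp_def)
    qed
    with ne \<sigma> y have "y \<in> enabled_pairs M"
      unfolding scheduler_def enabled_def by blast
    with Some show ?thesis by simp
  qed simp
qed

lemma Ionescu_Tulcea_step:
  assumes M: "substochastic_mdp M" and \<sigma>: "scheduler M \<sigma>"
  shows "Ionescu_Tulcea (step_measure M \<sigma>) (\<lambda>_. step_space M)"
proof (rule Ionescu_Tulcea.intro)
  let ?A = "insert None (Some ` enabled_pairs M)"
  have "finite (enabled_pairs M)"
    using M by (auto simp: substochastic_mdp_def intro: finite_subset)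
  then have count: "countable ?A" by (simp add: countable_finite)
  have space: "PiM {0..<i} (\<lambda>_. step_space M) = count_space (PiE {0..<i} (\<lambda>_. ?A))" for i :: nat
    unfolding step_space_def using count by (intro count_space_PiM_finite) auto
  have sets: "sets (step_measure M \<sigma> i x) = sets (step_space M)" for i x
    by (auto simp: step_measure_def step_space_def sets_restrict_space)
  have ps: "prob_space (step_measure M \<sigma> i x)" if "x \<in> PiE {0..<i} (\<lambda>_. ?A)" for i x
  proof (rule prob_spaceI)
    have "set_pmf (step_spmf M \<sigma> i x) \<subseteq> ?A"
      using that by (intro set_step_spmf[OF M \<sigma>]) (auto simp: PiE_iff)
    then have "emeasure (measure_pmf (step_spmf M \<sigma> i x)) ?A = 1"
      by (intro measure_pmf.emeasure_eq_1_AE) (auto simp: AE_measure_pmf_iff)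
    then show "emeasure (step_measure M \<sigma> i x) (space (step_measure M \<sigma> i x)) = 1"
      by (simp add: step_measure_def step_space_def space_restrict_space emeasure_restrict_space)
  qed
  show "prob_space (step_measure M \<sigma> i x)"
    if "x \<in> space (PiM {0..<i} (\<lambda>_. step_space M))" for i x
    using that ps by (simp add: space)
  show "step_measure M \<sigma> i
      \<in> measurable (PiM {0..<i} (\<lambda>_. step_space M)) (subprob_algebra (step_space M))" for i
    unfolding space
    using ps by (auto simp: space_subprob_algebra sets intro!: prob_space_imp_subprob_space)
qed

definition reach :: "'s set \<Rightarrow> (nat \<Rightarrow> 's) set" where
  "reach G = {\<pi>. \<exists>n. \<pi> n \<in> G}"

definition rabin :: "('s set \<times> 's set) set \<Rightarrow> (nat \<Rightarrow> 's) set" where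
  "rabin P = {\<pi>. \<exists>(F, E) \<in> P. (\<exists>\<^sub>\<infinity>n. \<pi> n \<in> F) \<and> (\<forall>\<^sub>\<infinity>n. \<pi> n \<in> E)}"

definition satisfies ::
  "('s, 'a) smdp \<Rightarrow> nat \<Rightarrow> (real \<Rightarrow> real \<Rightarrow> bool) \<Rightarrow> (nat \<Rightarrow> real) \<Rightarrow> (nat \<Rightarrow> (nat \<Rightarrow> 's) set) \<Rightarrow> bool"
  where
  "satisfies M k cmp lam \<psi> \<longleftrightarrow>
     (\<exists>\<sigma>. scheduler M \<sigma> \<and> (\<forall>i \<in> {1..k}. cmp (path_prob M \<sigma> (\<psi> i)) (lam i)))"

definition subsystem :: "('s, 'a) smdp \<Rightarrow> 's set \<Rightarrow> ('s, 'a) smdp" where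
  "subsystem M T =
     \<lparr>states = T, actions = actions M, initial = initial M,
      kernel = (\<lambda>s a. if s \<in> T then map_option (\<lambda>p. restrict_spmf p T) (kernel M s a) else None)\<rparr>"

definition witnessing ::
  "('s, 'a) smdp \<Rightarrow> nat \<Rightarrow> (real \<Rightarrow> real \<Rightarrow> bool) \<Rightarrow> (nat \<Rightarrow> real) \<Rightarrow> (nat \<Rightarrow> (nat \<Rightarrow> 's) set) \<Rightarrow>
    's set \<Rightarrow> bool" where
  "witnessing M k cmp lam \<psi> T \<longleftrightarrow>
     initial M \<in> T \<and> T \<subseteq> states M \<and> satisfies (subsystem M T) k cmp lam \<psi>"

definition labels :: "('s \<Rightarrow> 'l set) \<Rightarrow> 's set \<Rightarrow> 'l set" where
  "labels \<Lambda> T = (\<Union>s \<in> T. \<Lambda> s)"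

text \<open>
  Label sets are compared by strict equipollence \<open>\<prec>\<close>; for finite label sets this is comparison of
  \<open>card\<close>, but it needs no finiteness assumption on the labels.
\<close>

definition minimal_witnessing ::
  "('s, 'a) smdp \<Rightarrow> nat \<Rightarrow> (real \<Rightarrow> real \<Rightarrow> bool) \<Rightarrow> (nat \<Rightarrow> real) \<Rightarrow> (nat \<Rightarrow> (nat \<Rightarrow> 's) set) \<Rightarrow>
    ('s \<Rightarrow> 'l set) \<Rightarrow> 's set \<Rightarrow> bool" where
  "minimal_witnessing M k cmp lam \<psi> \<Lambda> T \<longleftrightarrow>
     witnessing M k cmp lam \<psi> T \<and>
     \<not> (\<exists>T'. witnessing M k cmp lam \<psi> T' \<and> labels \<Lambda> T' \<prec> labels \<Lambda> T)"

abbreviation ec_states :: "('s \<times> 'a) set \<Rightarrow> 's set" where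
  "ec_states E \<equiv> fst ` E"

definition ec_edges :: "('s, 'a) smdp \<Rightarrow> ('s \<times> 'a) set \<Rightarrow> ('s \<times> 's) set" where
  "ec_edges M E = {(s, t). \<exists>a. (s, a) \<in> E \<and> t \<in> set_spmf (succ_spmf M s a)}"

definition end_component :: "('s, 'a) smdp \<Rightarrow> ('s \<times> 'a) set \<Rightarrow> bool" where
  "end_component M E \<longleftrightarrow>
     E \<noteq> {} \<and> E \<subseteq> enabled_pairs M \<and>
     (\<forall>(s, a) \<in> E. set_spmf (succ_spmf M s a) \<subseteq> ec_states E) \<and>
     (\<forall>s \<in> ec_states E. \<forall>t \<in> ec_states E. (s, t) \<in> (ec_edges M E)\<^sup>*)"

definition mec :: "('s, 'a) smdp \<Rightarrow> ('s \<times> 'a) set \<Rightarrow> bool" where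
  "mec M E \<longleftrightarrow> end_component M E \<and> (\<forall>E'. end_component M E' \<and> E \<subseteq> E' \<longrightarrow> E' = E)"

definition mec_partition :: "('s, 'a) smdp \<Rightarrow> 's set set" where
  "mec_partition M =
     {ec_states E | E. mec M E} \<union>
     {{s} | s. s \<in> states M \<and> (\<forall>E. mec M E \<longrightarrow> s \<notin> ec_states E)}"

definition mec_equivalent :: "('s, 'a) smdp \<Rightarrow> ('s \<Rightarrow> 'l set) \<Rightarrow> bool" where
  "mec_equivalent M \<Lambda> \<longleftrightarrow>
     (\<forall>E. mec M E \<longrightarrow> (\<forall>s \<in> ec_states E. \<forall>t \<in> ec_states E. \<Lambda> s = \<Lambda> t))"

definition ec_rabin :: "('s \<times> 'a) set \<Rightarrow> ('s set \<times> 's set) set \<Rightarrow> bool" where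
  "ec_rabin \<E> P \<longleftrightarrow> (\<exists>(F, E) \<in> P. ec_states \<E> \<inter> F \<noteq> {} \<and> ec_states \<E> \<subseteq> E)"

definition rabin_choices ::
  "('s, 'a) smdp \<Rightarrow> nat \<Rightarrow> (nat \<Rightarrow> ('s set \<times> 's set) set) \<Rightarrow> ('s set \<times> nat set) set" where
  "rabin_choices M k P =
     {(ec_states E, I) | E I. mec M E \<and> I \<subseteq> {1..k} \<and>
        (\<exists>E' \<subseteq> E. end_component M E' \<and> (\<forall>i \<in> I. ec_rabin E' (P i)))}"

datatype 's qstate = Block "'s set" | Bot "nat set"
datatype 'a qaction = Orig 'a | Tau "nat set"

definition block_of :: "'s set set \<Rightarrow> 's \<Rightarrow> 's set" where
  "block_of \<D> s = (THE D. D \<in> \<D> \<and> s \<in> D)"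

definition leaves :: "('s, 'a) smdp \<Rightarrow> 's set \<Rightarrow> 's \<Rightarrow> 'a \<Rightarrow> bool" where
  "leaves M D s a \<longleftrightarrow>
     s \<in> D \<and> (s, a) \<in> enabled_pairs M \<and> measure (measure_spmf (succ_spmf M s a)) D < 1"

text \<open>
  An action enabled in a block determines the state of the block it comes from because actions of
  distinct states are disjoint, hence the \<open>THE\<close>. The absorbing loop of \<open>Bot I\<close> is labelled \<open>Tau I\<close>.
\<close>

fun quotient_kernel ::
  "('s, 'a) smdp \<Rightarrow> nat \<Rightarrow> 's set set \<Rightarrow> ('s set \<times> nat set) set \<Rightarrow>
    's qstate \<Rightarrow> 'a qaction \<Rightarrow> 's qstate spmf option" where
  "quotient_kernel M k \<D> \<I> (Block D) (Orig a) =
     (if D \<in> \<D> \<and> (\<exists>s. leaves M D s a)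
      then Some (map_spmf (\<lambda>t. Block (block_of \<D> t)) (succ_spmf M (THE s. leaves M D s a) a))
      else None)"
| "quotient_kernel M k \<D> \<I> (Block D) (Tau I) =
     (if (D, I) \<in> \<I> then Some (return_spmf (Bot I)) else None)"
| "quotient_kernel M k \<D> \<I> (Bot I) (Orig a) = None"
| "quotient_kernel M k \<D> \<I> (Bot I) (Tau J) =
     (if I \<subseteq> {1..k} \<and> J = I then Some (return_spmf (Bot I)) else None)"

definition mdp_quotient ::
  "('s, 'a) smdp \<Rightarrow> nat \<Rightarrow> 's set set \<Rightarrow> ('s set \<times> nat set) set \<Rightarrow> ('s qstate, 'a qaction) smdp"
  where
  "mdp_quotient M k \<D> \<I> =
     \<lparr>states = Block ` \<D> \<union> Bot ` Pow {1..k},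
      actions = Orig ` actions M \<union> Tau ` Pow {1..k},
      initial = Block (block_of \<D> (initial M)),
      kernel = quotient_kernel M k \<D> \<I>\<rparr>"

definition goal :: "nat \<Rightarrow> nat \<Rightarrow> 's qstate set" where
  "goal k i = {Bot I | I. I \<subseteq> {1..k} \<and> i \<in> I}"

fun lift_labels :: "('s \<Rightarrow> 'l set) \<Rightarrow> 's qstate \<Rightarrow> 'l set" where
  "lift_labels \<Lambda> (Block D) = labels \<Lambda> D"
| "lift_labels \<Lambda> (Bot I) = {}"

end

(* Both directions pass through flows on the quotient: x n D c is the probability that the n-th
   decision is taken in block D and is c, where a decision is either an action that may leave the
   block or the choice Tau I to stay forever.

   A scheduler of a subsystem of M yields a flow because almost surely the state-action pairs
   occurring infinitely often form an end component, whose MEC gives the final block and whose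
   satisfied Rabin conditions give I. A flow on the quotient is realised there by a scheduler that
   only looks at the step number. In M it is realised by walking inside the MEC to the owner of the
   decided action, or into an end component witnessing I and visiting all of it forever; the walk
   has to remember the decision, and Kuhn's argument (play the conditional distribution of the next
   action given the visible history) removes the memory without changing the path measure.

   So witnesses can be carried over in both directions, and MEC-equivalence makes the label sets
   agree, which transfers minimality. *)

theory Submission
  imports Defs
begin

text \<open>Every comparison between the two systems is an inequality: thresholds are lower bounds,
  so a scheduler may be replaced by any other whose probabilities are at least as large. Flows
  therefore satisfy balance inequalities only, which absorb mass lost in a subsystem, runs that end
  and decisions that are never made. The limit set of an infinite run of a subsystem is an end
  component of \<open>M\<close> itself: a recurring pair with a successor outside the subsystem
  would almost surely end the run. Conversely, a union of blocks contains each chosen MEC entirely,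
  so a walk inside it loses nothing, and uniform choice among the allowed actions makes every
  allowed continuation recur almost surely. Disjointness of the action sets turns an action of a
  block back into the state that owns it. On the side of measure theory everything rests on one-step
  bounds for events determined by a prefix, which extend to stopping times and, by a geometric bound
  on failures, to infinitely many trials.\<close>

section \<open>The path measure\<close>

text \<open>Takes the place of measurability with respect to the n-th member of the natural
  filtration. A single step has finitely many outcomes, so prefix-determined events are measurable
  without further proof (\<open>pred_prefix_det\<close>).\<close>

definition prefix_det :: "nat \<Rightarrow> ((nat \<Rightarrow> 'x) \<Rightarrow> 'b) \<Rightarrow> bool" where
  "prefix_det n f \<longleftrightarrow> (\<forall>\<omega> \<omega>'. (\<forall>i<n. \<omega> i = \<omega>' i) \<longrightarrow> f \<omega> = f \<omega>')"

lemma prefix_detI: "(\<And>\<omega> \<omega>'. (\<And>i. i < n \<Longrightarrow> \<omega> i = \<omega>' i) \<Longrightarrow> f \<omega> = f \<omega>') \<Longrightarrow> prefix_det n f"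
  unfolding prefix_det_def by blast

lemma prefix_detD: "prefix_det n f \<Longrightarrow> (\<And>i. i < n \<Longrightarrow> \<omega> i = \<omega>' i) \<Longrightarrow> f \<omega> = f \<omega>'"
  unfolding prefix_det_def by blast

lemma prefix_det_mono: "prefix_det n B \<Longrightarrow> n \<le> m \<Longrightarrow> prefix_det m B"
  unfolding prefix_det_def by (meson order_less_le_trans)

lemma prefix_det_upd: "prefix_det n f \<Longrightarrow> f (fun_upd \<omega> n x) = f \<omega>"
  by (rule prefix_detD) auto

lemma step_spmf_cong:
  assumes "\<And>i. i < n \<Longrightarrow> \<omega> i = \<omega>' i"
  shows "step_spmf M \<sigma> n \<omega> = step_spmf M \<sigma> n \<omega>'"
proof -
  have "map (the \<circ> \<omega>) [0..<n] = map (the \<circ> \<omega>') [0..<n]"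
    using assms by simp
  moreover have "next_state M n \<omega> = next_state M n \<omega>'"
    using assms by (auto simp: next_state_def)
  ultimately show ?thesis by (simp only: step_spmf_def)
qed

locale mdp_run =
  fixes M :: "('s, 'a) smdp" and \<sigma> :: "('s, 'a) sched"
  assumes sub: "substochastic_mdp M" and sched: "scheduler M \<sigma>"
begin

sublocale IT: Ionescu_Tulcea "step_measure M \<sigma>" "\<lambda>_. step_space M"
  by (rule Ionescu_Tulcea_step[OF sub sched])

abbreviation outcomes :: "('s \<times> 'a) option set" where
  "outcomes \<equiv> insert None (Some ` enabled_pairs M)"

abbreviation "K \<equiv> step_spmf M \<sigma>"

abbreviation "PM \<equiv> path_measure M \<sigma>"

lemma finite_enabled_pairs: "finite (enabled_pairs M)"
  using sub by (auto simp: substochastic_mdp_def intro: finite_subset)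

lemma path_measure_eq: "PM = IT.PF.lim"
  by (simp add: path_measure_def)

sublocale prob_space PM
proof -
  have "emeasure PM (space PM) = emeasure IT.PF.lim (IT.PF.emb UNIV {} (space (PiM {} (\<lambda>_. step_space M))))"
    by (auto simp: path_measure_eq prod_emb_def space_PiM intro!: arg_cong[where f="emeasure IT.PF.lim"])
  also have "\<dots> = 1"
    using prob_space.emeasure_space_1[OF IT.PF.prob_space_P[of "{}"]]
    by (subst IT.lim) (simp_all add: IT.PF.space_P)
  finally show "prob_space PM" by (rule prob_spaceI)
qed

lemma space_step_space: "space (step_space M) = outcomes"
  by (simp add: step_space_def)

lemma space_PM: "space PM = {\<omega>. \<forall>n. \<omega> n \<in> outcomes}"
  by (auto simp: path_measure_eq space_PiM space_step_space PiE_iff)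

lemma sets_PM: "sets PM = sets (PiM UNIV (\<lambda>_. step_space M))"
  by (simp add: path_measure_eq)

lemma PiM_step_space:
  "PiM {0..<n :: nat} (\<lambda>_. step_space M) = count_space (PiE {0..<n} (\<lambda>_. outcomes))"
  unfolding step_space_def
  using finite_enabled_pairs by (intro count_space_PiM_finite) (auto intro: countable_finite)

lemma measurable_component[measurable]: "(\<lambda>\<omega>. \<omega> n) \<in> PM \<rightarrow>\<^sub>M count_space UNIV"
proof -
  have "(\<lambda>\<omega>. \<omega> n) \<in> PM \<rightarrow>\<^sub>M step_space M"
    using measurable_component_singleton[of n UNIV "\<lambda>_. step_space M"]
    by (simp add: measurable_cong_sets[OF sets_PM refl])
  moreover have "(\<lambda>x. x) \<in> step_space M \<rightarrow>\<^sub>M count_space UNIV"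
    by (simp add: step_space_def)
  ultimately show ?thesis by (rule measurable_compose)
qed

lemma pred_component: "Measurable.pred PM (\<lambda>\<omega>. Q (\<omega> t))"
  by (rule measurable_compose[OF measurable_component]) simp

lemma prefix_event_emb:
  assumes "prefix_det n B"
  shows "{\<omega> \<in> space PM. B \<omega>} =
    IT.PF.emb UNIV {0..<n} {\<omega> \<in> PiE {0..<n} (\<lambda>_. outcomes). B \<omega>}"
proof -
  have "B (restrict \<omega> {0..<n}) = B \<omega>" for \<omega>
    using assms by (rule prefix_detD) auto
  then show ?thesis
    by (auto simp: prod_emb_def space_PM PiE_iff space_step_space)
qed

lemma pred_prefix_det: "prefix_det n B \<Longrightarrow> Measurable.pred PM B"
  unfolding pred_def prefix_event_emb sets_PM
  by (intro sets_PiM_I_finite measurable_prod_emb) (auto simp: PiM_step_space)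

text \<open>The law of the first \<open>n\<close> outcomes. The start
  \<open>\<lambda>_. undefined\<close> is the only element of the empty product.\<close>

abbreviation "C0 n \<equiv> IT.C 0 n (\<lambda>_. undefined)"

lemma space_C0: "space (C0 n) = PiE {0..<n} (\<lambda>_. outcomes)"
  by (subst IT.space_C) (auto simp: space_PiM space_step_space)

lemma sets_C0: "sets (C0 n) = Pow (PiE {0..<n} (\<lambda>_. outcomes))"
  by (subst IT.sets_C) (auto simp: space_PiM PiM_step_space)

lemma emeasure_prefix:
  assumes "prefix_det n B"
  shows "emeasure PM {\<omega> \<in> space PM. B \<omega>} = emeasure (C0 n) {\<omega> \<in> PiE {0..<n} (\<lambda>_. outcomes). B \<omega>}"
proof -
  let ?X = "{\<omega> \<in> PiE {0..<n} (\<lambda>_. outcomes). B \<omega>}"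
  have X: "?X \<in> sets (PiM {0..<n} (\<lambda>_. step_space M))" by (auto simp: PiM_step_space)
  have "emeasure PM {\<omega> \<in> space PM. B \<omega>} = emeasure (IT.CI {0..<n}) ?X"
    unfolding prefix_event_emb[OF assms] by (simp add: path_measure_eq IT.lim[OF _ X])
  also have "\<dots> = emeasure (C0 n) (IT.PF.emb {0..<n} {0..<n} ?X)"
    by (rule IT.emeasure_CI[OF _ X]) simp
  also have "IT.PF.emb {0..<n} {0..<n} ?X = ?X"
    using sets.sets_into_space[OF X] by (intro prod_emb_id) (auto simp: space_PiM)
  finally show ?thesis .
qed

lemma set_pmf_K: "\<forall>i<n. \<omega> i \<in> outcomes \<Longrightarrow> set_pmf (K n \<omega>) \<subseteq> outcomes"
  by (rule set_step_spmf[OF sub sched]) auto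

text \<open>One unfolding of the Ionescu-Tulcea construction: integrate the step kernel over the law
  of the prefix. Later statements about a single step of a run reduce to this one.\<close>

lemma emeasure_Suc:
  assumes "prefix_det (Suc n) R"
  shows "emeasure PM {\<omega> \<in> space PM. R \<omega>} =
    (\<integral>\<^sup>+\<omega>. emeasure (measure_pmf (K n \<omega>)) {x. R (fun_upd \<omega> n x)} \<partial>C0 n)"
proof -
  let ?X = "{\<omega> \<in> PiE {0..<Suc n} (\<lambda>_. outcomes). R \<omega>}"
  have X: "?X \<in> sets (PiM {0..<Suc n} (\<lambda>_. step_space M))" by (auto simp: PiM_step_space)
  have "emeasure PM {\<omega> \<in> space PM. R \<omega>} = emeasure (C0 (Suc n)) ?X"
    by (rule emeasure_prefix[OF assms])
  also have "\<dots> = (\<integral>\<^sup>+\<omega>. emeasure (IT.eP n \<omega>) ?X \<partial>C0 n)"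
    using X IT.measurable_eP[of n]
    by (simp, subst emeasure_bind[where N="PiM {0..<Suc n} (\<lambda>_. step_space M)"])
      (auto simp: space_C0 PiE_eq_empty_iff measurable_cong_sets[OF IT.sets_C refl] space_PiM)
  also have "\<dots> = (\<integral>\<^sup>+\<omega>. emeasure (measure_pmf (K n \<omega>)) {x. R (fun_upd \<omega> n x)} \<partial>C0 n)"
  proof (rule nn_integral_cong)
    fix \<omega> assume "\<omega> \<in> space (C0 n)"
    then have \<omega>: "\<omega> \<in> PiE {0..<n} (\<lambda>_. outcomes)" by (simp add: space_C0)
    let ?Y = "(\<lambda>x. fun_upd \<omega> n x) -` ?X \<inter> outcomes"
    have "emeasure (IT.eP n \<omega>) ?X = emeasure (step_measure M \<sigma> n \<omega>) ?Y"
      using \<omega> X by (subst IT.emeasure_eP) (auto simp: space_PiM space_step_space)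
    also have "\<dots> = emeasure (measure_pmf (K n \<omega>)) ?Y"
      by (simp add: step_measure_def space_step_space emeasure_restrict_space)
    also have "?Y = {x. R (fun_upd \<omega> n x)} \<inter> outcomes"
      using \<omega> by (auto simp: PiE_iff extensional_def)
    also have "emeasure (measure_pmf (K n \<omega>)) \<dots> = emeasure (measure_pmf (K n \<omega>)) {x. R (fun_upd \<omega> n x)}"
      using set_pmf_K[of n \<omega>] \<omega> by (intro emeasure_eq_AE) (auto simp: AE_measure_pmf_iff PiE_iff)
    finally show "emeasure (IT.eP n \<omega>) ?X = emeasure (measure_pmf (K n \<omega>)) {x. R (fun_upd \<omega> n x)}" .
  qed
  finally show ?thesis .
qed

lemma emeasure_step:
  assumes B: "prefix_det n B"
  shows "emeasure PM {\<omega> \<in> space PM. B \<omega> \<and> \<omega> n \<in> C} =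
    (\<integral>\<^sup>+\<omega>. indicator {\<omega>. B \<omega>} \<omega> * emeasure (measure_pmf (K n \<omega>)) C \<partial>C0 n)"
proof -
  have "prefix_det (Suc n) (\<lambda>\<omega>. B \<omega> \<and> \<omega> n \<in> C)"
    using prefix_det_mono[OF B, of "Suc n"] unfolding prefix_det_def by (metis lessI le_SucI order_refl)
  then have "emeasure PM {\<omega> \<in> space PM. B \<omega> \<and> \<omega> n \<in> C} =
     (\<integral>\<^sup>+\<omega>. emeasure (measure_pmf (K n \<omega>)) {x. B (fun_upd \<omega> n x) \<and> (fun_upd \<omega> n x) n \<in> C} \<partial>C0 n)"
    by (rule emeasure_Suc)
  also have "\<dots> = (\<integral>\<^sup>+\<omega>. indicator {\<omega>. B \<omega>} \<omega> * emeasure (measure_pmf (K n \<omega>)) C \<partial>C0 n)"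
    by (intro nn_integral_cong) (auto simp: prefix_det_upd[OF B] split: split_indicator)
  finally show ?thesis .
qed

text \<open>A pointwise bound on well-formed prefixes does the work of a bound on a conditional
  probability.\<close>

lemma emeasure_step_le:
  assumes B: "prefix_det n B"
    and q: "\<And>\<omega>. \<forall>i<n. \<omega> i \<in> outcomes \<Longrightarrow> B \<omega> \<Longrightarrow> measure_pmf.prob (K n \<omega>) C \<le> q"
  shows "emeasure PM {\<omega> \<in> space PM. B \<omega> \<and> \<omega> n \<in> C} \<le> ennreal q * emeasure PM {\<omega> \<in> space PM. B \<omega>}"
proof -
  have "emeasure PM {\<omega> \<in> space PM. B \<omega> \<and> \<omega> n \<in> C} \<le>
      (\<integral>\<^sup>+\<omega>. ennreal q * indicator {\<omega> \<in> PiE {0..<n} (\<lambda>_. outcomes). B \<omega>} \<omega> \<partial>C0 n)"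
    unfolding emeasure_step[OF B]
    by (intro nn_integral_mono)
      (auto split: split_indicator simp: space_C0 measure_pmf.emeasure_eq_measure PiE_iff intro!: ennreal_leI q)
  also have "\<dots> = ennreal q * emeasure PM {\<omega> \<in> space PM. B \<omega>}"
    by (subst nn_integral_cmult_indicator) (auto simp: sets_C0 emeasure_prefix[OF B])
  finally show ?thesis .
qed

lemma emeasure_step_ge:
  assumes B: "prefix_det n B"
    and q: "\<And>\<omega>. \<forall>i<n. \<omega> i \<in> outcomes \<Longrightarrow> B \<omega> \<Longrightarrow> q \<le> measure_pmf.prob (K n \<omega>) C"
  shows "ennreal q * emeasure PM {\<omega> \<in> space PM. B \<omega>} \<le> emeasure PM {\<omega> \<in> space PM. B \<omega> \<and> \<omega> n \<in> C}"
proof -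
  have "ennreal q * emeasure PM {\<omega> \<in> space PM. B \<omega>} =
      (\<integral>\<^sup>+\<omega>. ennreal q * indicator {\<omega> \<in> PiE {0..<n} (\<lambda>_. outcomes). B \<omega>} \<omega> \<partial>C0 n)"
    by (subst nn_integral_cmult_indicator) (auto simp: sets_C0 emeasure_prefix[OF B])
  also have "\<dots> \<le> emeasure PM {\<omega> \<in> space PM. B \<omega> \<and> \<omega> n \<in> C}"
    unfolding emeasure_step[OF B]
    by (intro nn_integral_mono)
      (auto split: split_indicator simp: space_C0 measure_pmf.emeasure_eq_measure PiE_iff intro!: ennreal_leI q)
  finally show ?thesis .
qed

lemma pred_ex_prefix_det:
  "(\<And>t. prefix_det t (B t)) \<Longrightarrow> Measurable.pred PM (\<lambda>\<omega>. \<exists>t. B t \<omega>)"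
  using pred_prefix_det by measurable

lemma prefix_det_step: "prefix_det n B \<Longrightarrow> prefix_det (Suc n) (\<lambda>\<omega>. B \<omega> \<and> \<omega> n \<in> C)"
  unfolding prefix_det_def by (metis less_Suc_eq)

lemma emeasure_ex_disjoint:
  assumes pd: "\<And>t. Measurable.pred PM (B t)"
    and disj: "\<And>\<omega> t t'. B t \<omega> \<Longrightarrow> B t' \<omega> \<Longrightarrow> t = (t' :: nat)"
  shows "emeasure PM {\<omega> \<in> space PM. \<exists>t. B t \<omega>} = (\<Sum>t. emeasure PM {\<omega> \<in> space PM. B t \<omega>})"
proof -
  have "{\<omega> \<in> space PM. \<exists>t. B t \<omega>} = (\<Union>t. {\<omega> \<in> space PM. B t \<omega>})" by auto
  moreover have "(\<Sum>t. emeasure PM {\<omega> \<in> space PM. B t \<omega>}) = emeasure PM (\<Union>t. {\<omega> \<in> space PM. B t \<omega>})"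
    using pd disj by (intro suminf_emeasure) (auto simp: disjoint_family_on_def pred_def)
  ultimately show ?thesis by simp
qed

text \<open>The family \<open>B\<close> is a stopping time, \<open>B t\<close> saying that it has
  the value \<open>t\<close>; it may also have no value. The events are disjoint, so the one-step
  bound carries over by summation over \<open>t\<close>.\<close>

lemma emeasure_stopped_le:
  assumes pd: "\<And>t. prefix_det t (B t)" and disj: "\<And>\<omega> t t'. B t \<omega> \<Longrightarrow> B t' \<omega> \<Longrightarrow> t = t'"
    and q: "\<And>\<omega> t. \<forall>i<t. \<omega> i \<in> outcomes \<Longrightarrow> B t \<omega> \<Longrightarrow> measure_pmf.prob (K t \<omega>) C \<le> q"
  shows "emeasure PM {\<omega> \<in> space PM. \<exists>t. B t \<omega> \<and> \<omega> t \<in> C} \<le> ennreal q * emeasure PM {\<omega> \<in> space PM. \<exists>t. B t \<omega>}"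
proof -
  have "emeasure PM {\<omega> \<in> space PM. \<exists>t. B t \<omega> \<and> \<omega> t \<in> C} =
      (\<Sum>t. emeasure PM {\<omega> \<in> space PM. B t \<omega> \<and> \<omega> t \<in> C})"
    by (rule emeasure_ex_disjoint) (auto intro!: pred_prefix_det[OF prefix_det_step] pd intro: disj)
  also have "\<dots> \<le> (\<Sum>t. ennreal q * emeasure PM {\<omega> \<in> space PM. B t \<omega>})"
    by (intro suminf_le emeasure_step_le pd q) auto
  also have "\<dots> = ennreal q * emeasure PM {\<omega> \<in> space PM. \<exists>t. B t \<omega>}"
    by (subst emeasure_ex_disjoint) (auto intro!: pred_prefix_det pd intro: disj)
  finally show ?thesis .
qed

lemma emeasure_stopped_ge:
  assumes pd: "\<And>t. prefix_det t (B t)" and disj: "\<And>\<omega> t t'. B t \<omega> \<Longrightarrow> B t' \<omega> \<Longrightarrow> t = t'"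
    and q: "\<And>\<omega> t. \<forall>i<t. \<omega> i \<in> outcomes \<Longrightarrow> B t \<omega> \<Longrightarrow> q \<le> measure_pmf.prob (K t \<omega>) C"
  shows "ennreal q * emeasure PM {\<omega> \<in> space PM. \<exists>t. B t \<omega>} \<le> emeasure PM {\<omega> \<in> space PM. \<exists>t. B t \<omega> \<and> \<omega> t \<in> C}"
proof -
  have "ennreal q * emeasure PM {\<omega> \<in> space PM. \<exists>t. B t \<omega>} = (\<Sum>t. ennreal q * emeasure PM {\<omega> \<in> space PM. B t \<omega>})"
    by (subst emeasure_ex_disjoint) (auto intro!: pred_prefix_det pd intro: disj)
  also have "\<dots> \<le> (\<Sum>t. emeasure PM {\<omega> \<in> space PM. B t \<omega> \<and> \<omega> t \<in> C})"
    by (intro suminf_le emeasure_step_ge pd q) auto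
  also have "\<dots> = emeasure PM {\<omega> \<in> space PM. \<exists>t. B t \<omega> \<and> \<omega> t \<in> C}"
    by (rule emeasure_ex_disjoint[symmetric]) (auto intro!: pred_prefix_det[OF prefix_det_step] pd intro: disj)
  finally show ?thesis .
qed

text \<open>Puts almost every run inside the supports of its kernels. Structural facts can then be
  proved run by run, by induction on time, without any measure theory.\<close>

lemma AE_in_set_pmf: "AE \<omega> in PM. \<forall>n. \<omega> n \<in> set_pmf (K n \<omega>)"
  unfolding AE_all_countable
proof
  fix n
  let ?R = "\<lambda>\<omega>. \<omega> n \<notin> set_pmf (K n \<omega>)"
  have pd: "prefix_det (Suc n) ?R"
    by (rule prefix_detI) (metis less_Suc_eq step_spmf_cong)
  have "emeasure PM {\<omega> \<in> space PM. ?R \<omega>} =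
      (\<integral>\<^sup>+\<omega>. emeasure (measure_pmf (K n \<omega>)) {x. (fun_upd \<omega> n x) n \<notin> set_pmf (K n (fun_upd \<omega> n x))} \<partial>C0 n)"
    by (rule emeasure_Suc[OF pd])
  also have "\<dots> = (\<integral>\<^sup>+\<omega>. 0 \<partial>C0 n)"
  proof (rule nn_integral_cong)
    fix \<omega>
    have "K n (fun_upd \<omega> n x) = K n \<omega>" for x by (rule step_spmf_cong) auto
    then have "{x. (fun_upd \<omega> n x) n \<notin> set_pmf (K n (fun_upd \<omega> n x))} = - set_pmf (K n \<omega>)" by auto
    then show "emeasure (measure_pmf (K n \<omega>)) {x. (fun_upd \<omega> n x) n \<notin> set_pmf (K n (fun_upd \<omega> n x))} = 0"
      by (auto simp: measure_pmf.emeasure_eq_measure measure_pmf_zero_iff)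
  qed
  finally show "AE \<omega> in PM. \<omega> n \<in> set_pmf (K n \<omega>)"
    using pred_prefix_det[OF pd] by (intro AE_I[of _ _ "{\<omega> \<in> space PM. ?R \<omega>}"]) (auto simp: pred_def)
qed

text \<open>A conditional Borel--Cantelli lemma: the number of consecutive failures is dominated by a
  geometric distribution.\<close>

lemma AE_frequently_hit:
  assumes pd: "\<And>t. prefix_det t (T t)" and \<epsilon>: "\<epsilon> > 0"
    and q: "\<And>\<omega> t. \<forall>i<t. \<omega> i \<in> outcomes \<Longrightarrow> T t \<omega> \<Longrightarrow> \<epsilon> \<le> measure_pmf.prob (K t \<omega>) C"
  shows "AE \<omega> in PM. (\<exists>\<^sub>\<infinity>t. T t \<omega>) \<longrightarrow> (\<exists>\<^sub>\<infinity>t. T t \<omega> \<and> \<omega> t \<in> C)"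
proof -
  have "AE \<omega> in PM. \<forall>N. \<not> ((\<exists>\<^sub>\<infinity>t. T t \<omega>) \<and> (\<forall>t\<ge>N. T t \<omega> \<longrightarrow> \<omega> t \<notin> C))"
    unfolding AE_all_countable
  proof
    fix N
    define c where "c \<omega> t = card {j \<in> {N..<t}. T j \<omega>}" for \<omega> t
    \<comment> \<open>\<open>B m t\<close> marks \<open>t\<close> as trial number \<open>m\<close>
      (counted from 0) at or after \<open>N\<close>, all earlier ones having failed. At most one
      \<open>t\<close> qualifies for each \<open>m\<close>, so the bound for stopping times costs a
      factor \<open>1 - \<epsilon>\<close> from \<open>m\<close> to \<open>Suc m\<close>.\<close>
    define B where "B m t \<omega> \<longleftrightarrow> N \<le> t \<and> T t \<omega> \<and> c \<omega> t = m \<and> (\<forall>j\<in>{N..<t}. T j \<omega> \<longrightarrow> \<omega> j \<notin> C)" for m t \<omega>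
    have pdB: "prefix_det t (B m t)" for m t
    proof (rule prefix_detI)
      fix \<omega> \<omega>' :: "nat \<Rightarrow> ('s \<times> 'a) option"
      assume eq: "\<And>i. i < t \<Longrightarrow> \<omega> i = \<omega>' i"
      have T: "T j \<omega> = T j \<omega>'" if "j \<le> t" for j
        using that eq by (intro prefix_detD[OF pd]) auto
      then have "{j \<in> {N..<t}. T j \<omega>} = {j \<in> {N..<t}. T j \<omega>'}" by auto
      with T eq show "B m t \<omega> = B m t \<omega>'" unfolding B_def c_def by auto
    qed
    have c_Suc: "c \<omega> (Suc t) = (if N \<le> t \<and> T t \<omega> then Suc (c \<omega> t) else c \<omega> t)" for \<omega> t
    proof -
      have "{j \<in> {N..<Suc t}. T j \<omega>} =
          (if N \<le> t \<and> T t \<omega> then insert t {j \<in> {N..<t}. T j \<omega>} else {j \<in> {N..<t}. T j \<omega>})"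
        by (auto simp: less_Suc_eq)
      then show ?thesis unfolding c_def by auto
    qed
    have c_mono: "c \<omega> t \<le> c \<omega> t'" if "t \<le> t'" for \<omega> t t'
      unfolding c_def using that by (intro card_mono) auto
    have disj: "t = t'" if "B m t \<omega>" "B m t' \<omega>" for m t t' \<omega>
    proof -
      have "\<not> t < t'" if "B m t \<omega>" "B m t' \<omega>" for t t'
        using that c_mono[of "Suc t" t' \<omega>] by (auto simp: B_def c_Suc)
      from this[of t t'] this[of t' t] that show ?thesis by auto
    qed
    have ex: "\<exists>t'. B m t' \<omega> \<and> \<omega> t' \<in> - C" if "B (Suc m) t \<omega>" for m t \<omega>
    proof -
      have "\<exists>t'<t. N \<le> t' \<and> T t' \<omega> \<and> c \<omega> t' = m" if "c \<omega> t = Suc m" for t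
        using that
      proof (induction t)
        case 0 then show ?case by (simp add: c_def)
      next
        case (Suc t) then show ?case by (auto simp: c_Suc less_Suc_eq split: if_splits)
      qed
      with that obtain t' where "t' < t" "N \<le> t'" "T t' \<omega>" "c \<omega> t' = m" by (auto simp: B_def)
      with that show ?thesis by (auto simp: B_def)
    qed
    define p where "p m = emeasure PM {\<omega> \<in> space PM. \<exists>t. B m t \<omega>}" for m
    have "p (Suc m) \<le> ennreal (1 - \<epsilon>) * p m" for m
    proof -
      have "p (Suc m) \<le> emeasure PM {\<omega> \<in> space PM. \<exists>t. B m t \<omega> \<and> \<omega> t \<in> - C}"
        unfolding p_def using pred_prefix_det[OF prefix_det_step[OF pdB], measurable] ex
        by (intro emeasure_mono) (blast, measurable)
      also have "\<dots> \<le> ennreal (1 - \<epsilon>) * p m"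
        unfolding p_def
      proof (rule emeasure_stopped_le[OF pdB disj])
        fix \<omega> t assume "\<forall>i<t. \<omega> i \<in> outcomes" "B m t \<omega>"
        then have "\<epsilon> \<le> measure_pmf.prob (K t \<omega>) C" by (intro q) (auto simp: B_def)
        then show "measure_pmf.prob (K t \<omega>) (- C) \<le> 1 - \<epsilon>"
          using measure_pmf.prob_compl[of C "K t \<omega>"] by (simp add: Compl_eq_Diff_UNIV)
      qed
      finally show ?thesis .
    qed
    then have p_le: "p m \<le> ennreal (1 - \<epsilon>) ^ m" for m
    proof (induction m)
      case 0 show ?case by (simp add: p_def emeasure_le_1)
    next
      case (Suc m)
      have "p (Suc m) \<le> ennreal (1 - \<epsilon>) * p m" by fact
      also have "\<dots> \<le> ennreal (1 - \<epsilon>) * ennreal (1 - \<epsilon>) ^ m" using Suc by (intro mult_left_mono) auto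
      finally show ?case by simp
    qed
    let ?bad = "{\<omega> \<in> space PM. (\<exists>\<^sub>\<infinity>t. T t \<omega>) \<and> (\<forall>t\<ge>N. T t \<omega> \<longrightarrow> \<omega> t \<notin> C)}"
    have [measurable]: "Measurable.pred PM (T t)" for t
      by (rule pred_prefix_det[OF pd])
    have [measurable]: "Measurable.pred PM (\<lambda>\<omega>. \<omega> t \<in> C)" for t
      by (rule pred_component)
    have bad: "?bad \<in> sets PM" unfolding INFM_nat_le by measurable
    have bad_le: "emeasure PM ?bad \<le> p m" for m
      unfolding p_def
    proof (intro emeasure_mono subsetI CollectI conjI)
      show "{\<omega> \<in> space PM. \<exists>t. B m t \<omega>} \<in> sets PM"
        using pred_ex_prefix_det[OF pdB] by (simp add: pred_def)
      fix \<omega> assume \<omega>: "\<omega> \<in> ?bad"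
      then show "\<omega> \<in> space PM" by simp
      have "\<exists>t\<ge>N. T t \<omega> \<and> c \<omega> t = m"
      proof (induction m)
        case 0
        have "\<exists>t\<ge>N. T t \<omega>" using \<omega> by (auto simp: INFM_nat_le)
        then obtain t where t: "t \<ge> N" "T t \<omega>" "\<And>t'. t' \<ge> N \<Longrightarrow> T t' \<omega> \<Longrightarrow> t \<le> t'"
          using exists_least_iff[of "\<lambda>t. t \<ge> N \<and> T t \<omega>"] by (metis not_le)
        then have "{j \<in> {N..<t}. T j \<omega>} = {}" by force
        with t show ?case by (auto simp: c_def)
      next
        case (Suc m)
        then obtain s where s: "s \<ge> N" "T s \<omega>" "c \<omega> s = m" by auto
        have "\<exists>t\<ge>Suc s. T t \<omega>" using \<omega> by (auto simp: INFM_nat_le)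
        then obtain t where t: "t \<ge> Suc s" "T t \<omega>" "\<And>t'. t' \<ge> Suc s \<Longrightarrow> T t' \<omega> \<Longrightarrow> t \<le> t'"
          using exists_least_iff[of "\<lambda>t. t \<ge> Suc s \<and> T t \<omega>"] by (metis not_le)
        have "j < Suc s" if "j < t" "T j \<omega>" for j
          using t(3)[of j] that by (meson not_le)
        then have "{j \<in> {N..<t}. T j \<omega>} = {j \<in> {N..<Suc s}. T j \<omega>}"
          using t(1) by auto
        then have "c \<omega> t = c \<omega> (Suc s)" by (simp add: c_def)
        also have "\<dots> = Suc m" using s by (simp add: c_Suc)
        finally show ?case using t s by (intro exI[of _ t]) auto
      qed
      then obtain t where "t \<ge> N" "T t \<omega>" "c \<omega> t = m" by auto
      with \<omega> show "\<exists>t. B m t \<omega>" by (auto simp: B_def)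
    qed
    \<comment> \<open>If no trial is possible at all, \<epsilon> may exceed 1;
      \<open>ennreal\<close> then cuts the base off at 0.\<close>
    have pow: "ennreal (1 - \<epsilon>) ^ m = ennreal ((max 0 (1 - \<epsilon>)) ^ m)" for m
    proof -
      have eq: "ennreal (1 - \<epsilon>) = ennreal (max 0 (1 - \<epsilon>))" by (auto simp: max_def ennreal_neg)
      show ?thesis unfolding eq by (rule ennreal_power) simp
    qed
    have le: "emeasure PM ?bad \<le> ennreal ((max 0 (1 - \<epsilon>)) ^ m)" for m
      using order_trans[OF bad_le p_le] unfolding pow .
    have "(\<lambda>m. ennreal ((max 0 (1 - \<epsilon>)) ^ m)) \<longlonglongrightarrow> ennreal 0"
      using \<epsilon> by (intro tendsto_ennrealI LIMSEQ_power_zero) auto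
    from LIMSEQ_le_const[OF this, of "emeasure PM ?bad"] le have "emeasure PM ?bad = 0" by auto
    with bad show "AE \<omega> in PM. \<not> ((\<exists>\<^sub>\<infinity>t. T t \<omega>) \<and> (\<forall>t\<ge>N. T t \<omega> \<longrightarrow> \<omega> t \<notin> C))"
      by (intro AE_I[of _ _ ?bad]) auto
  qed
  then show ?thesis by eventually_elim (auto simp: INFM_nat_le)
qed

text \<open>A trial at time \<open>t\<close> is a visit to \<open>p\<close> at time
  \<open>t - 1\<close>. The shift makes the trial depend on the first \<open>t\<close> outcomes
  only, as \<open>AE_frequently_hit\<close> requires.\<close>

lemma AE_frequently_next:
  assumes \<epsilon>: "0 < \<epsilon>" and q: "\<And>\<omega> t. \<omega> t = Some p \<Longrightarrow> \<epsilon> \<le> measure_pmf.prob (K (Suc t) \<omega>) C"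
  shows "AE \<omega> in PM. (\<exists>\<^sub>\<infinity>t. \<omega> t = Some p) \<longrightarrow> (\<exists>\<^sub>\<infinity>t. \<omega> t \<in> C)"
proof -
  let ?T = "\<lambda>(t :: nat) \<omega>. 0 < t \<and> \<omega> (t - 1) = Some p"
  have "AE \<omega> in PM. (\<exists>\<^sub>\<infinity>t. ?T t \<omega>) \<longrightarrow> (\<exists>\<^sub>\<infinity>t. ?T t \<omega> \<and> \<omega> t \<in> C)"
  proof (rule AE_frequently_hit[OF _ \<epsilon>])
    show "prefix_det t (?T t)" for t by (auto simp: prefix_det_def)
    fix \<omega> t assume "?T t \<omega>"
    then show "\<epsilon> \<le> measure_pmf.prob (K t \<omega>) C" using q[of \<omega> "t - 1"] by simp
  qed
  then show ?thesis
  proof eventually_elim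
    case (elim \<omega>)
    show ?case
    proof
      assume inf: "\<exists>\<^sub>\<infinity>t. \<omega> t = Some p"
      have "\<exists>\<^sub>\<infinity>t. ?T t \<omega>"
        unfolding INFM_nat
      proof
        fix m
        from inf obtain n where "n > m" "\<omega> n = Some p" by (auto simp: INFM_nat)
        then show "\<exists>n>m. ?T n \<omega>" by (intro exI[of _ "Suc n"]) auto
      qed
      with elim have "\<exists>\<^sub>\<infinity>t. ?T t \<omega> \<and> \<omega> t \<in> C" by blast
      then show "\<exists>\<^sub>\<infinity>t. \<omega> t \<in> C" by (rule INFM_mono) blast
    qed
  qed
qed

end

section \<open>End components\<close>

lemma mdp_succ_states:
  assumes "substochastic_mdp M" "(s, a) \<in> enabled_pairs M" "t \<in> set_spmf (succ_spmf M s a)"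
  shows "t \<in> states M"
  using assms by (auto simp: substochastic_mdp_def)

lemma enabled_pairs_states:
  "substochastic_mdp M \<Longrightarrow> (s, a) \<in> enabled_pairs M \<Longrightarrow> s \<in> states M"
  "substochastic_mdp M \<Longrightarrow> (s, a) \<in> enabled_pairs M \<Longrightarrow> a \<in> actions M"
  by (auto simp: substochastic_mdp_def)

lemma finite_enabled_pairs: "substochastic_mdp M \<Longrightarrow> finite (enabled_pairs M)"
  by (auto simp: substochastic_mdp_def intro: finite_subset)

lemma mdp_sub: "mdp M \<Longrightarrow> substochastic_mdp M"
  by (simp add: mdp_def)

lemma ec_edges_mono: "E \<subseteq> E' \<Longrightarrow> ec_edges M E \<subseteq> ec_edges M E'"
  by (auto simp: ec_edges_def)

text \<open>Any two states are connected through \<open>x\<close>: each of the two components joins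
  its own states to \<open>x\<close> in both directions.\<close>

lemma end_component_Un:
  assumes E: "end_component M E" and E': "end_component M E'"
    and x: "x \<in> ec_states E" "x \<in> ec_states E'"
  shows "end_component M (E \<union> E')"
  unfolding end_component_def
proof (intro conjI ballI)
  have to: "(s, x) \<in> (ec_edges M (E \<union> E'))\<^sup>*" and from_x: "(x, s) \<in> (ec_edges M (E \<union> E'))\<^sup>*"
    if "s \<in> ec_states (E \<union> E')" for s
  proof -
    have *: "(s, x) \<in> (ec_edges M E)\<^sup>* \<and> (x, s) \<in> (ec_edges M E)\<^sup>* \<or>
      (s, x) \<in> (ec_edges M E')\<^sup>* \<and> (x, s) \<in> (ec_edges M E')\<^sup>*"
      using that E E' x unfolding end_component_def image_Un by blast
    with rtrancl_mono[OF ec_edges_mono[of E "E \<union> E'" M]] rtrancl_mono[OF ec_edges_mono[of E' "E \<union> E'" M]]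
    show "(s, x) \<in> (ec_edges M (E \<union> E'))\<^sup>*" "(x, s) \<in> (ec_edges M (E \<union> E'))\<^sup>*" by blast+
  qed
  fix s t assume "s \<in> ec_states (E \<union> E')" "t \<in> ec_states (E \<union> E')"
  then show "(s, t) \<in> (ec_edges M (E \<union> E'))\<^sup>*" using to[of s] from_x[of t] by simp
next
  show "E \<union> E' \<noteq> {}" "E \<union> E' \<subseteq> enabled_pairs M" using E E' by (auto simp: end_component_def)
next
  fix p assume "p \<in> E \<union> E'"
  then show "case p of (s, a) \<Rightarrow> set_spmf (succ_spmf M s a) \<subseteq> ec_states (E \<union> E')"
    using E E' unfolding end_component_def image_Un by blast
qed

lemma ex_mec:
  assumes M: "substochastic_mdp M" and E: "end_component M E"
  shows "\<exists>E'. mec M E' \<and> E \<subseteq> E'"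
proof -
  let ?S = "{E'. end_component M E' \<and> E \<subseteq> E'}"
  have "?S \<subseteq> Pow (enabled_pairs M)" by (auto simp: end_component_def)
  then have "finite ?S" using finite_enabled_pairs[OF M] by (auto intro: finite_subset)
  moreover have "E \<in> ?S" using E by simp
  ultimately obtain E' where E': "E' \<in> ?S" "\<forall>F\<in>?S. E' \<subseteq> F \<longrightarrow> E' = F"
    using finite_has_maximal2[of ?S E] by metis
  then have "mec M E'" unfolding mec_def by (metis (lifting) mem_Collect_eq order_trans)
  with E' show ?thesis by auto
qed

text \<open>The union would be an end component above both, so maximality makes it equal to each of
  them.\<close>

lemma mec_unique:
  assumes "mec M E" "mec M E'" "x \<in> ec_states E" "x \<in> ec_states E'"
  shows "E = E'"
  using end_component_Un[of M E E' x] assms unfolding mec_def by (metis Un_upper1 Un_upper2)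

lemma end_component_states:
  assumes "substochastic_mdp M" "end_component M E"
  shows "ec_states E \<subseteq> states M"
  using assms enabled_pairs_states(1)[OF assms(1)] by (fastforce simp: end_component_def)

lemma mec_partition_unique:
  assumes "D \<in> mec_partition M" "D' \<in> mec_partition M" "x \<in> D" "x \<in> D'"
  shows "D = D'"
proof -
  have *: "(\<exists>E. mec M E \<and> D = ec_states E) \<or> D = {x} \<and> (\<forall>E. mec M E \<longrightarrow> x \<notin> ec_states E)"
    if "D \<in> mec_partition M" "x \<in> D" for D
    using that unfolding mec_partition_def by auto
  from *[OF assms(1,3)] *[OF assms(2,4)] show ?thesis
    using mec_unique assms(3,4) by metis
qed

lemma mec_partition_subset:
  "substochastic_mdp M \<Longrightarrow> D \<in> mec_partition M \<Longrightarrow> D \<subseteq> states M"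
  unfolding mec_partition_def by (auto simp: mec_def dest: end_component_states)

lemma mec_partition_mec: "mec M E \<Longrightarrow> ec_states E \<in> mec_partition M"
  unfolding mec_partition_def by (rule UnI1) auto

lemma mec_partition_singleton:
  "s \<in> states M \<Longrightarrow> (\<And>E. mec M E \<Longrightarrow> s \<notin> ec_states E) \<Longrightarrow> {s} \<in> mec_partition M"
  unfolding mec_partition_def by (rule UnI2) simp

lemma mec_partition_cover: "s \<in> states M \<Longrightarrow> \<exists>D\<in>mec_partition M. s \<in> D"
  using mec_partition_mec mec_partition_singleton by (metis singletonI)

lemma finite_mec_partition:
  assumes "substochastic_mdp M" shows "finite (mec_partition M)"
proof -
  have "mec_partition M \<subseteq> Pow (states M)" using mec_partition_subset[OF assms] by blast
  moreover have "finite (states M)" using assms by (simp add: substochastic_mdp_def)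
  ultimately show ?thesis by (meson finite_Pow_iff finite_subset)
qed

lemma block_of_eq:
  "D \<in> mec_partition M \<Longrightarrow> s \<in> D \<Longrightarrow> block_of (mec_partition M) s = D"
  unfolding block_of_def by (rule the_equality) (auto dest: mec_partition_unique)

lemma block_of_in:
  assumes "s \<in> states M"
  shows "block_of (mec_partition M) s \<in> mec_partition M" "s \<in> block_of (mec_partition M) s"
  using mec_partition_cover[OF assms] block_of_eq by fastforce+

section \<open>One step of a run\<close>

lemma enabled_iff: "a \<in> enabled M s \<longleftrightarrow> (s, a) \<in> enabled_pairs M"
  by (simp add: enabled_def)

lemma pmf_mult_prob_le_prob_bind:
  "pmf p x * measure_pmf.prob (f x) C \<le> measure_pmf.prob (bind_pmf p f) C"
proof -
  have "ennreal (pmf p x * measure_pmf.prob (f x) C) =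
      (\<integral>\<^sup>+y. emeasure (measure_pmf (f x)) C * indicator {x} y \<partial>measure_pmf p)"
    by (subst nn_integral_cmult_indicator)
      (simp_all add: measure_pmf_single measure_pmf.emeasure_eq_measure ennreal_mult' mult.commute)
  also have "\<dots> \<le> (\<integral>\<^sup>+y. emeasure (measure_pmf (f y)) C \<partial>measure_pmf p)"
    by (intro nn_integral_mono) (auto split: split_indicator)
  also have "\<dots> = ennreal (measure_pmf.prob (bind_pmf p f) C)"
    by (simp only: emeasure_bind_pmf measure_pmf.emeasure_eq_measure[symmetric])
  finally show ?thesis by (simp add: ennreal_le_iff)
qed

lemma prob_bind_le_prob:
  assumes "\<And>x. x \<in> set_pmf p \<Longrightarrow> x \<notin> D \<Longrightarrow> set_pmf (f x) \<inter> C = {}"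
  shows "measure_pmf.prob (bind_pmf p f) C \<le> measure_pmf.prob p D"
proof -
  have "ennreal (measure_pmf.prob (bind_pmf p f) C) = (\<integral>\<^sup>+y. emeasure (measure_pmf (f y)) C \<partial>measure_pmf p)"
    by (simp only: emeasure_bind_pmf measure_pmf.emeasure_eq_measure[symmetric])
  also have "\<dots> \<le> (\<integral>\<^sup>+y. indicator D y \<partial>measure_pmf p)"
  proof (intro nn_integral_mono_AE AE_pmfI)
    fix x assume "x \<in> set_pmf p"
    then show "emeasure (measure_pmf (f x)) C \<le> indicator D x"
      using assms[of x]
      by (cases "x \<in> D") (auto simp: measure_pmf.emeasure_le_1 measure_pmf.emeasure_eq_measure measure_pmf_zero_iff)
  qed
  also have "\<dots> = ennreal (measure_pmf.prob p D)"
    by (simp add: measure_pmf.emeasure_eq_measure)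
  finally show ?thesis by (simp add: ennreal_le_iff)
qed

lemma measure_spmf_conv_prob: "measure (measure_spmf p) A = measure_pmf.prob p (Some ` A)"
  by (simp add: measure_measure_spmf_conv_measure_pmf)

text \<open>The second half of a step, after the state has been drawn. Separating it presents
  \<open>step_spmf\<close> as a plain \<open>bind_pmf\<close>, in which lost mass is the ordinary
  outcome \<open>None\<close>.\<close>

definition act_spmf ::
  "('s, 'a) smdp \<Rightarrow> ('s, 'a) sched \<Rightarrow> ('s \<times> 'a) list \<Rightarrow> 's \<Rightarrow> ('s \<times> 'a) spmf" where
  "act_spmf M \<sigma> h s = (if enabled M s = {} then return_pmf None
      else map_spmf (Pair s) (spmf_of_pmf (\<sigma> h s)))"

lemma step_spmf_eq:
  "step_spmf M \<sigma> n \<omega> = bind_pmf (next_state M n \<omega>)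
     (\<lambda>x. case x of None \<Rightarrow> return_pmf None | Some s \<Rightarrow> act_spmf M \<sigma> (map (the \<circ> \<omega>) [0..<n]) s)"
  unfolding step_spmf_def act_spmf_def bind_spmf_def
  by (intro bind_pmf_cong refl)

lemma act_spmf_ne:
  "enabled M s \<noteq> {} \<Longrightarrow> act_spmf M \<sigma> h s = map_pmf (\<lambda>a. Some (s, a)) (\<sigma> h s)"
  by (simp add: act_spmf_def spmf_of_pmf_def pmf.map_comp comp_def)

lemma pmf_step_Some:
  "pmf (step_spmf M \<sigma> n \<omega>) (Some (s, a)) =
     (if enabled M s = {} then 0
      else spmf (next_state M n \<omega>) s * pmf (\<sigma> (map (the \<circ> \<omega>) [0..<n]) s) a)"
proof -
  let ?h = "map (the \<circ> \<omega>) [0..<n]"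
  let ?f = "\<lambda>x. case x of None \<Rightarrow> return_pmf None | Some s \<Rightarrow> act_spmf M \<sigma> ?h s"
  have f: "pmf (?f x) (Some (s, a)) = pmf (?f (Some s)) (Some (s, a)) * indicator {Some s} x" for x
  proof (cases x)
    case (Some t)
    then show ?thesis
      by (cases "enabled M t = {}")
        (auto simp: act_spmf_ne act_spmf_def pmf_eq_0_set_pmf split: split_indicator)
  qed auto
  have "pmf (step_spmf M \<sigma> n \<omega>) (Some (s, a)) =
      (\<integral>x. pmf (?f (Some s)) (Some (s, a)) * indicator {Some s} x \<partial>measure_pmf (next_state M n \<omega>))"
    unfolding step_spmf_eq pmf_bind by (subst f) simp
  also have "\<dots> = pmf (?f (Some s)) (Some (s, a)) * spmf (next_state M n \<omega>) s"
    by (simp add: measure_pmf_single)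
  also have "pmf (?f (Some s)) (Some (s, a)) = (if enabled M s = {} then 0 else pmf (\<sigma> ?h s) a)"
  proof (cases "enabled M s = {}")
    case False
    have "pmf (map_pmf (\<lambda>a. Some (s, a)) (\<sigma> ?h s)) (Some (s, a)) = pmf (\<sigma> ?h s) a"
      by (rule pmf_map_inj'[of "\<lambda>a. Some (s, a)"]) (auto intro: injI)
    then show ?thesis using False by (simp add: act_spmf_ne)
  qed (simp add: act_spmf_def)
  finally show ?thesis by simp
qed

lemma next_state_Suc: "next_state M (Suc t) \<omega> =
  (case \<omega> t of None \<Rightarrow> return_pmf None | Some (s, a) \<Rightarrow> succ_spmf M s a)"
  by (simp add: next_state_def)

lemma next_state_0: "next_state M 0 \<omega> = return_spmf (initial M)"
  by (simp add: next_state_def)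

text \<open>Only an inequality, because a drawn state of \<open>D\<close> without enabled actions
  ends the run.\<close>

lemma step_in_state_le:
  "measure_pmf.prob (step_spmf M \<sigma> n \<omega>) {Some (s, a) | s a. s \<in> D} \<le> measure (measure_spmf (next_state M n \<omega>)) D"
  unfolding step_spmf_eq measure_spmf_conv_prob
  by (rule prob_bind_le_prob) (auto simp: act_spmf_def in_set_spmf[symmetric] split: option.splits if_splits)

lemma step_support:
  assumes "x \<in> set_pmf (step_spmf M \<sigma> n \<omega>)"
  shows "case x of None \<Rightarrow> True | Some (s, a) \<Rightarrow> s \<in> set_spmf (next_state M n \<omega>) \<and>
     enabled M s \<noteq> {} \<and> a \<in> set_pmf (\<sigma> (map (the \<circ> \<omega>) [0..<n]) s)"
proof (cases x)
  case (Some p)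
  obtain s a where "p = (s, a)" by force
  with Some have x: "x = Some (s, a)" by simp
  from assms have "pmf (step_spmf M \<sigma> n \<omega>) x > 0" by (simp add: pmf_positive_iff)
  then have "pmf (step_spmf M \<sigma> n \<omega>) x \<noteq> 0" by simp
  then show ?thesis unfolding x pmf_step_Some
    by (auto simp: in_set_spmf pmf_eq_0_set_pmf split: if_splits)
qed simp

lemma subsystem_simps [simp]:
  "states (subsystem M T) = T" "actions (subsystem M T) = actions M" "initial (subsystem M T) = initial M"
  by (simp_all add: subsystem_def)

lemma enabled_pairs_subsystem:
  "enabled_pairs (subsystem M T) = {(s, a) \<in> enabled_pairs M. s \<in> T}"
  by (auto simp: enabled_pairs_def subsystem_def)

lemma enabled_subsystem: "enabled (subsystem M T) s = (if s \<in> T then enabled M s else {})"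
  by (auto simp: enabled_def enabled_pairs_subsystem)

lemma succ_subsystem: "succ_spmf (subsystem M T) s a = (if s \<in> T then restrict_spmf (succ_spmf M s a) T else return_pmf None)"
  by (auto simp: succ_spmf_def subsystem_def split: option.splits)

lemma substochastic_subsystem:
  assumes "substochastic_mdp M" "T \<subseteq> states M" "initial M \<in> T"
  shows "substochastic_mdp (subsystem M T)"
  using assms unfolding substochastic_mdp_def enabled_pairs_subsystem
  by (auto simp: succ_subsystem intro: finite_subset)

text \<open>Mass lost by the restriction is accounted for by ending the run.\<close>

lemma step_subsystem_ge:
  assumes t: "\<omega> n = Some (s, a)" and s: "s \<in> T"
  shows "spmf (succ_spmf M s a) t \<le>
    measure_pmf.prob (step_spmf (subsystem M T) \<sigma> (Suc n) \<omega>) (insert None {Some (t, b) | b. True})"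
    (is "_ \<le> measure_pmf.prob _ ?C")
proof -
  let ?N = "subsystem M T" and ?h = "map (the \<circ> \<omega>) [0..<Suc n]"
  let ?g = "\<lambda>x. case x of None \<Rightarrow> return_pmf None | Some s \<Rightarrow> act_spmf ?N \<sigma> ?h s"
  let ?r = "\<lambda>x :: 'a option. x \<bind> (\<lambda>y. if y \<in> T then Some y else None)"
  have "next_state ?N (Suc n) \<omega> = map_pmf ?r (succ_spmf M s a)"
    using t s by (simp add: next_state_Suc succ_subsystem restrict_spmf_def)
  then have step: "step_spmf ?N \<sigma> (Suc n) \<omega> = bind_pmf (succ_spmf M s a) (\<lambda>x. ?g (?r x))"
    by (simp only: step_spmf_eq bind_map_pmf)
  have "set_pmf (?g (?r (Some t))) \<subseteq> ?C"
    by (auto simp: act_spmf_def in_set_spmf[symmetric])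
  then have "measure_pmf.prob (?g (?r (Some t))) ?C = 1"
    by (subst measure_pmf.prob_eq_1) (auto simp: AE_measure_pmf_iff)
  with pmf_mult_prob_le_prob_bind[of "succ_spmf M s a" "Some t" "\<lambda>x. ?g (?r x)" ?C] step
  show ?thesis by simp
qed

lemma path_step:
  assumes "\<forall>n. \<omega> n \<in> set_pmf (step_spmf M \<sigma> n \<omega>)" and "\<omega> (Suc t) = Some (s', a')"
  obtains s a where "\<omega> t = Some (s, a)" "s' \<in> set_spmf (succ_spmf M s a)" "enabled M s' \<noteq> {}"
    "a' \<in> set_pmf (\<sigma> (map (the \<circ> \<omega>) [0..<Suc t]) s')"
proof -
  have "Some (s', a') \<in> set_pmf (step_spmf M \<sigma> (Suc t) \<omega>)" using assms by metis
  from step_support[OF this] that show ?thesis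
    by (cases "\<omega> t") (auto simp: next_state_Suc)
qed

lemma path_init:
  assumes "\<forall>n. \<omega> n \<in> set_pmf (step_spmf M \<sigma> n \<omega>)" and "\<omega> 0 = Some (s', a')"
  shows "s' = initial M" "enabled M s' \<noteq> {}" "a' \<in> set_pmf (\<sigma> [] s')"
proof -
  have "Some (s', a') \<in> set_pmf (step_spmf M \<sigma> 0 \<omega>)" using assms by metis
  from step_support[OF this] show "s' = initial M" "enabled M s' \<noteq> {}" "a' \<in> set_pmf (\<sigma> [] s')"
    by (auto simp: next_state_0)
qed

section \<open>Sums of probabilities over finite and countable families of events\<close>

context prob_space
begin

lemma prob_le_sum:
  assumes "finite F" "Measurable.pred M R" "\<And>i. i \<in> F \<Longrightarrow> Measurable.pred M (B i)"
    and "AE \<omega> in M. R \<omega> \<longrightarrow> (\<exists>i\<in>F. B i \<omega>)"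
  shows "prob {\<omega> \<in> space M. R \<omega>} \<le> (\<Sum>i\<in>F. prob {\<omega> \<in> space M. B i \<omega>})"
proof -
  have B: "{\<omega> \<in> space M. B i \<omega>} \<in> events" if "i \<in> F" for i
    using assms(3)[OF that] by (simp add: pred_def)
  have "prob {\<omega> \<in> space M. R \<omega>} \<le> prob (\<Union>i\<in>F. {\<omega> \<in> space M. B i \<omega>})"
  proof (rule finite_measure_mono_AE)
    show "AE \<omega> in M. \<omega> \<in> {\<omega> \<in> space M. R \<omega>} \<longrightarrow> \<omega> \<in> (\<Union>i\<in>F. {\<omega> \<in> space M. B i \<omega>})"
      using assms(4) by eventually_elim auto
    show "(\<Union>i\<in>F. {\<omega> \<in> space M. B i \<omega>}) \<in> events"
      using assms(1) B by (intro sets.finite_UN) auto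
  qed
  also have "\<dots> \<le> (\<Sum>i\<in>F. prob {\<omega> \<in> space M. B i \<omega>})"
    using assms(1) B by (intro finite_measure_subadditive_finite) auto
  finally show ?thesis .
qed

lemma sum_prob_le:
  assumes "finite F" "Measurable.pred M R" "\<And>i. i \<in> F \<Longrightarrow> Measurable.pred M (B i)"
    and "\<And>i j \<omega>. i \<in> F \<Longrightarrow> j \<in> F \<Longrightarrow> B i \<omega> \<Longrightarrow> B j \<omega> \<Longrightarrow> i = j"
    and "AE \<omega> in M. \<forall>i\<in>F. B i \<omega> \<longrightarrow> R \<omega>"
  shows "(\<Sum>i\<in>F. prob {\<omega> \<in> space M. B i \<omega>}) \<le> prob {\<omega> \<in> space M. R \<omega>}"
proof -
  have B: "{\<omega> \<in> space M. B i \<omega>} \<in> events" if "i \<in> F" for i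
    using assms(3)[OF that] by (simp add: pred_def)
  have "(\<Sum>i\<in>F. prob {\<omega> \<in> space M. B i \<omega>}) = prob (\<Union>i\<in>F. {\<omega> \<in> space M. B i \<omega>})"
    using assms(1,4) B by (intro finite_measure_finite_Union[symmetric]) (auto simp: disjoint_family_on_def)
  also have "\<dots> \<le> prob {\<omega> \<in> space M. R \<omega>}"
  proof (rule finite_measure_mono_AE)
    show "AE \<omega> in M. \<omega> \<in> (\<Union>i\<in>F. {\<omega> \<in> space M. B i \<omega>}) \<longrightarrow> \<omega> \<in> {\<omega> \<in> space M. R \<omega>}"
      using assms(5) by eventually_elim auto
    show "{\<omega> \<in> space M. R \<omega>} \<in> events" using assms(2) by (simp add: pred_def)
  qed
  finally show ?thesis .
qed

lemma emeasure_le_suminf_sum: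
  assumes "finite F" "Measurable.pred M R" "\<And>n i. i \<in> F \<Longrightarrow> Measurable.pred M (B n i)"
    and "AE \<omega> in M. R \<omega> \<longrightarrow> (\<exists>n. \<exists>i\<in>F. B n i \<omega>)"
  shows "emeasure M {\<omega> \<in> space M. R \<omega>} \<le> (\<Sum>n :: nat. \<Sum>i\<in>F. emeasure M {\<omega> \<in> space M. B n i \<omega>})"
proof -
  have B: "{\<omega> \<in> space M. B n i \<omega>} \<in> events" if "i \<in> F" for n i
    using assms(3)[OF that] by (simp add: pred_def)
  have UB: "(\<Union>i\<in>F. {\<omega> \<in> space M. B n i \<omega>}) \<in> events" for n
    using assms(1) B by (intro sets.finite_UN) auto
  have "emeasure M {\<omega> \<in> space M. R \<omega>} \<le> emeasure M (\<Union>n. \<Union>i\<in>F. {\<omega> \<in> space M. B n i \<omega>})"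
  proof (rule emeasure_mono_AE)
    show "AE \<omega> in M. \<omega> \<in> {\<omega> \<in> space M. R \<omega>} \<longrightarrow> \<omega> \<in> (\<Union>n. \<Union>i\<in>F. {\<omega> \<in> space M. B n i \<omega>})"
      using assms(4) by eventually_elim auto
    show "(\<Union>n. \<Union>i\<in>F. {\<omega> \<in> space M. B n i \<omega>}) \<in> events"
      using UB by (intro sets.countable_UN) auto
  qed
  also have "\<dots> \<le> (\<Sum>n. emeasure M (\<Union>i\<in>F. {\<omega> \<in> space M. B n i \<omega>}))"
    using UB by (intro emeasure_subadditive_countably) auto
  also have "\<dots> \<le> (\<Sum>n. \<Sum>i\<in>F. emeasure M {\<omega> \<in> space M. B n i \<omega>})"
    using assms(1) B by (intro suminf_le emeasure_subadditive_finite) auto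
  finally show ?thesis .
qed

text \<open>The events are disjoint only up to a null set. Integrating the sum of their indicators,
  which is almost surely at most 1 and vanishes where \<open>R\<close> fails, avoids removing that
  null set from each event.\<close>

lemma suminf_sum_le_emeasure:
  assumes "finite F" "Measurable.pred M R" "\<And>n i. i \<in> F \<Longrightarrow> Measurable.pred M (B n i)"
    and uniq: "AE \<omega> in M. \<forall>n n'. \<forall>i\<in>F. \<forall>j\<in>F. B n i \<omega> \<longrightarrow> B n' j \<omega> \<longrightarrow> n = n' \<and> i = j"
    and imp: "AE \<omega> in M. \<forall>n. \<forall>i\<in>F. B n i \<omega> \<longrightarrow> R \<omega>"
  shows "(\<Sum>n :: nat. \<Sum>i\<in>F. emeasure M {\<omega> \<in> space M. B n i \<omega>}) \<le> emeasure M {\<omega> \<in> space M. R \<omega>}"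
proof -
  have B[measurable]: "{\<omega> \<in> space M. B n i \<omega>} \<in> events" if "i \<in> F" for n i
    using assms(3)[OF that] by (simp add: pred_def)
  have R: "{\<omega> \<in> space M. R \<omega>} \<in> events" using assms(2) by (simp add: pred_def)
  let ?I = "\<lambda>n i. indicator {\<omega> \<in> space M. B n i \<omega>} :: _ \<Rightarrow> ennreal"
  have "(\<Sum>n. \<Sum>i\<in>F. emeasure M {\<omega> \<in> space M. B n i \<omega>}) = (\<Sum>n. \<Sum>i\<in>F. \<integral>\<^sup>+\<omega>. ?I n i \<omega> \<partial>M)"
    using B by (intro suminf_cong sum.cong refl) simp
  also have "\<dots> = (\<integral>\<^sup>+\<omega>. (\<Sum>n. \<Sum>i\<in>F. ?I n i \<omega>) \<partial>M)"
    using B by (subst nn_integral_suminf) (auto simp: nn_integral_sum intro!: borel_measurable_sum)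
  also have "\<dots> \<le> (\<integral>\<^sup>+\<omega>. indicator {\<omega> \<in> space M. R \<omega>} \<omega> \<partial>M)"
  proof (rule nn_integral_mono_AE)
    show "AE \<omega> in M. (\<Sum>n. \<Sum>i\<in>F. ?I n i \<omega>) \<le> indicator {\<omega> \<in> space M. R \<omega>} \<omega>"
      using uniq imp AE_space
    proof eventually_elim
      fix \<omega> assume u: "\<forall>n n'. \<forall>i\<in>F. \<forall>j\<in>F. B n i \<omega> \<longrightarrow> B n' j \<omega> \<longrightarrow> n = n' \<and> i = j"
        and im: "\<forall>n. \<forall>i\<in>F. B n i \<omega> \<longrightarrow> R \<omega>" and sp: "\<omega> \<in> space M"
      show "(\<Sum>n. \<Sum>i\<in>F. ?I n i \<omega>) \<le> indicator {\<omega> \<in> space M. R \<omega>} \<omega>"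
      proof (cases "\<exists>n. \<exists>i\<in>F. B n i \<omega>")
        case True
        then obtain n0 i0 where n0: "i0 \<in> F" "B n0 i0 \<omega>" by auto
        have "(\<Sum>i\<in>F. ?I n i \<omega>) = (if n = n0 then 1 else 0)" for n
        proof (cases "n = n0")
          case True
          have "(\<Sum>i\<in>F. ?I n i \<omega>) = (\<Sum>i\<in>F. if i = i0 then 1 else 0)"
            using u n0 sp True by (intro sum.cong) (auto split: split_indicator)
          then show ?thesis using assms(1) n0 True by simp
        next
          case False
          then have "(\<Sum>i\<in>F. ?I n i \<omega>) = (\<Sum>i\<in>F. 0)"
            using u n0 by (intro sum.cong) (auto split: split_indicator)
          then show ?thesis using False by simp
        qed
        then have "(\<Sum>n. \<Sum>i\<in>F. ?I n i \<omega>) = (\<Sum>n. if n = n0 then 1 else 0)" by simp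
        also have "\<dots> = 1" by (subst suminf_finite[of "{n0}"]) auto
        finally show ?thesis using im n0 sp by auto
      next
        case False
        then have "(\<Sum>i\<in>F. ?I n i \<omega>) = 0" for n by (intro sum.neutral) auto
        then show ?thesis by simp
      qed
    qed
  qed
  also have "\<dots> = emeasure M {\<omega> \<in> space M. R \<omega>}" using R by simp
  finally show ?thesis .
qed

end

lemma path_None:
  assumes v: "\<forall>n. \<omega> n \<in> set_pmf (step_spmf M \<sigma> n \<omega>)" and "\<omega> t = None" "t \<le> t'"
  shows "\<omega> t' = None"
  using assms(3)
proof (induction t' rule: dec_induct)
  case base then show ?case by fact
next
  case (step n)
  then show ?case using path_step[OF v] by (cases "\<omega> (Suc n)") force+
qed

lemma path_not_lost:
  assumes v: "\<forall>n. \<omega> n \<in> set_pmf (step_spmf M \<sigma> n \<omega>)" and t: "\<omega> t = Some (s, a)"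
    and l: "lossless_spmf (succ_spmf M s a)" and e: "\<And>s'. s' \<in> set_spmf (succ_spmf M s a) \<Longrightarrow> enabled M s' \<noteq> {}"
  shows "\<omega> (Suc t) \<noteq> None"
proof
  assume "\<omega> (Suc t) = None"
  then have "None \<in> set_pmf (step_spmf M \<sigma> (Suc t) \<omega>)" using v by metis
  then obtain x where x: "x \<in> set_pmf (succ_spmf M s a)"
    "None \<in> set_pmf (case x of None \<Rightarrow> return_pmf None | Some s \<Rightarrow> act_spmf M \<sigma> (map (the \<circ> \<omega>) [0..<Suc t]) s)"
    using t by (auto simp: step_spmf_eq next_state_Suc simp del: upt_Suc)
  moreover have "x \<noteq> None" using l x(1) by (metis lossless_iff_set_pmf_None)
  ultimately obtain s' where "s' \<in> set_spmf (succ_spmf M s a)"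
    "None \<in> set_pmf (act_spmf M \<sigma> (map (the \<circ> \<omega>) [0..<Suc t]) s')"
    by (auto simp: in_set_spmf simp del: upt_Suc)
  then show False using e by (auto simp: act_spmf_ne simp del: upt_Suc)
qed

text \<open>Supplies both the distribution of decisions prescribed by a flow and the conditional
  distributions of Kuhn's argument. The multiplied form also covers total weight 0, where every
  weight is 0 and any \<open>p\<close> will do.\<close>

lemma ex_normalized_pmf:
  fixes f :: "'c \<Rightarrow> real"
  assumes C: "finite C" and f: "\<And>c. 0 \<le> f c" and out: "\<And>c. c \<notin> C \<Longrightarrow> f c = 0"
  shows "\<exists>p. (\<forall>c. f c = sum f C * pmf p c) \<and> (sum f C \<noteq> 0 \<longrightarrow> set_pmf p \<subseteq> {c. f c \<noteq> 0})"
proof (cases "sum f C = 0")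
  case True
  then have "f c = 0" for c using C f out sum_nonneg_eq_0_iff[of C f] by (cases "c \<in> C") auto
  with True show ?thesis by auto
next
  case False
  then have pos: "sum f C > 0" using f by (simp add: sum_nonneg less_le)
  let ?g = "\<lambda>c. f c / sum f C"
  have "(\<integral>\<^sup>+c. ennreal (?g c) \<partial>count_space UNIV) = (\<integral>\<^sup>+c. ennreal (?g c) \<partial>count_space C)"
    using out by (intro nn_integral_count_space_eq) auto
  also have "\<dots> = ennreal (\<Sum>c\<in>C. ?g c)"
    using f pos C by (subst nn_integral_count_space_finite) (auto simp: sum_ennreal)
  also have "(\<Sum>c\<in>C. ?g c) = 1" using pos by (simp add: sum_divide_distrib[symmetric])
  finally have g: "(\<integral>\<^sup>+c. ennreal (?g c) \<partial>count_space UNIV) = 1" by simp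
  have "pmf (embed_pmf ?g) c = ?g c" for c
    using f pos g by (intro pmf_embed_pmf) auto
  moreover have "set_pmf (embed_pmf ?g) = {c. ?g c \<noteq> 0}"
    using f pos g by (intro set_embed_pmf) auto
  ultimately show ?thesis using pos by (intro exI[of _ "embed_pmf ?g"]) auto
qed

section \<open>Flows on the quotient\<close>

locale rabin_mdp =
  fixes M :: "('s, 'a) smdp" and k :: nat and P :: "nat \<Rightarrow> ('s set \<times> 's set) set"
  assumes mdp: "mdp M" and disj: "disjoint_actions M"
begin

abbreviation "\<D> \<equiv> mec_partition M"
abbreviation "blk \<equiv> block_of \<D>"
abbreviation "choices \<equiv> rabin_choices M k P"

definition "Q = mdp_quotient M k \<D> choices"

lemmas subM = mdp_sub[OF mdp]

lemma leaves_unique: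
  assumes "leaves M D s a" "leaves M D' s' a" shows "s = s'"
proof (rule ccontr)
  assume "s \<noteq> s'"
  moreover have "s \<in> states M" "s' \<in> states M" "a \<in> enabled M s" "a \<in> enabled M s'"
    using assms enabled_pairs_states(1)[OF subM] by (auto simp: leaves_def enabled_iff)
  ultimately show False using disj unfolding disjoint_actions_def by blast
qed

lemma choicesD: "(D, I) \<in> choices \<Longrightarrow> D \<in> \<D> \<and> I \<subseteq> {1..k}"
  by (auto simp: rabin_choices_def mec_partition_mec)

lemma Q_simps:
  "states Q = Block ` \<D> \<union> Bot ` Pow {1..k}"
  "actions Q = Orig ` actions M \<union> Tau ` Pow {1..k}"
  "initial Q = Block (blk (initial M))"
  "kernel Q = quotient_kernel M k \<D> choices"
  by (simp_all add: Q_def mdp_quotient_def)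

lemma enabled_pairs_Q:
  "(Block D, Orig a) \<in> enabled_pairs Q \<longleftrightarrow> D \<in> \<D> \<and> (\<exists>s. leaves M D s a)"
  "(Block D, Tau I) \<in> enabled_pairs Q \<longleftrightarrow> (D, I) \<in> choices"
  "(Bot I, Orig a) \<notin> enabled_pairs Q"
  "(Bot I, Tau J) \<in> enabled_pairs Q \<longleftrightarrow> I \<subseteq> {1..k} \<and> J = I"
  by (auto simp: enabled_pairs_def Q_simps)

lemma succ_Q_Orig:
  assumes "D \<in> \<D>" "leaves M D s a"
  shows "succ_spmf Q (Block D) (Orig a) = map_spmf (\<lambda>t. Block (blk t)) (succ_spmf M s a)"
proof -
  have "(THE s. leaves M D s a) = s" using assms(2) leaves_unique by (intro the_equality) auto
  then show ?thesis using assms by (auto simp: succ_spmf_def Q_simps)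
qed

lemma succ_Q_Tau:
  "succ_spmf Q (Block D) (Tau I) = (if (D, I) \<in> choices then return_spmf (Bot I) else return_pmf None)"
  "succ_spmf Q (Bot I) (Tau J) = (if I \<subseteq> {1..k} \<and> J = I then return_spmf (Bot I) else return_pmf None)"
  "succ_spmf Q (Bot I) (Orig a) = return_pmf None"
  by (auto simp: succ_spmf_def Q_simps)

lemma succ_Q_support:
  "x \<in> set_spmf (succ_spmf Q (Block D) (Orig a)) \<Longrightarrow> D \<in> \<D> \<and> (\<exists>D'. x = Block D')"
  by (auto simp: succ_spmf_def Q_simps split: if_splits)

text \<open>\<open>blk\<close> is meaningful only on states of \<open>M\<close>, so the two events
  are compared on the support of the successor distribution.\<close>

lemma spmf_succ_Q:
  assumes "D \<in> \<D>" "leaves M D s a" "D' \<in> \<D>"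
  shows "spmf (succ_spmf Q (Block D) (Orig a)) (Block D') = measure (measure_spmf (succ_spmf M s a)) D'"
proof -
  have "set_spmf (succ_spmf M s a) \<subseteq> states M"
    using assms(2) subM by (auto simp: leaves_def substochastic_mdp_def)
  then have "set_spmf (succ_spmf M s a) \<inter> (\<lambda>t. Block (blk t)) -` {Block D'} = set_spmf (succ_spmf M s a) \<inter> D'"
    using block_of_eq[OF assms(3)] block_of_in(2)[of _ M] by auto
  then show ?thesis
    unfolding succ_Q_Orig[OF assms(1,2)] spmf_conv_measure_spmf measure_map_spmf
    by (intro measure_spmf.finite_measure_eq_AE) (auto simp: AE_measure_spmf_iff)
qed

lemma substochastic_Q: "substochastic_mdp Q"
  unfolding substochastic_mdp_def
proof (intro conjI ballI)
  have fin: "finite (states M)" "finite (actions M)" "initial M \<in> states M"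
    using subM by (auto simp: substochastic_mdp_def)
  show "finite (states Q)" "finite (actions Q)" "initial Q \<in> states Q"
    using fin finite_mec_partition[OF subM] block_of_in(1)[of "initial M" M] by (auto simp: Q_simps)
  have en: "s \<in> states Q \<and> a \<in> actions Q" if "(s, a) \<in> enabled_pairs Q" for s a
    using that
    by (cases s; cases a)
      (auto simp: enabled_pairs_Q Q_simps leaves_def dest: choicesD enabled_pairs_states(2)[OF subM])
  then show "enabled_pairs Q \<subseteq> states Q \<times> actions Q" by auto
  fix p assume "p \<in> enabled_pairs Q"
  then obtain s a where p: "p = (s, a)" "(s, a) \<in> enabled_pairs Q" by (cases p) auto
  have "set_spmf (succ_spmf Q s a) \<subseteq> states Q"
  proof (cases s; cases a)
    fix D b assume sa: "s = Block D" "a = Orig b"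
    with p obtain t where t: "D \<in> \<D>" "leaves M D t b" by (auto simp: enabled_pairs_Q)
    then have "set_spmf (succ_spmf M t b) \<subseteq> states M"
      using subM by (auto simp: leaves_def substochastic_mdp_def)
    then show ?thesis using t sa block_of_in(1)[of _ M] by (auto simp: succ_Q_Orig Q_simps)
  qed (use p in \<open>auto simp: enabled_pairs_Q succ_Q_Tau Q_simps dest: choicesD\<close>)
  then show "case p of (s, a) \<Rightarrow> set_spmf (succ_spmf Q s a) \<subseteq> states Q" by (simp add: p)
qed

text \<open>\<open>x n D c\<close> stands for the probability that the \<open>n\<close>-th decision falls in block \<open>D\<close> and is
  \<open>c\<close>. Counting decisions instead of taking expected numbers of visits makes every entry at most 1,
  so that no transience argument is needed.\<close>

definition flow :: "'s qstate set \<Rightarrow> (nat \<Rightarrow> 's set \<Rightarrow> 'a qaction \<Rightarrow> real) \<Rightarrow> bool" where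
  "flow Y x \<longleftrightarrow>
     (\<forall>n D c. 0 \<le> x n D c) \<and>
     (\<forall>n D c. x n D c \<noteq> 0 \<longrightarrow> Block D \<in> Y \<and> (Block D, c) \<in> enabled_pairs Q) \<and>
     (\<forall>D. (\<Sum>c\<in>actions Q. x 0 D c) \<le> of_bool (D = blk (initial M))) \<and>
     (\<forall>n D'. Block D' \<in> Y \<longrightarrow> (\<Sum>c\<in>actions Q. x (Suc n) D' c) \<le>
       (\<Sum>(D, a)\<in>\<D> \<times> actions M. x n D (Orig a) * spmf (succ_spmf Q (Block D) (Orig a)) (Block D')))"

text \<open>An \<open>ennreal\<close> series, so that no summability has to be established before it
  is compared with a path probability.\<close>

definition value_of :: "nat \<Rightarrow> (nat \<Rightarrow> 's set \<Rightarrow> 'a qaction \<Rightarrow> real) \<Rightarrow> ennreal" where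
  "value_of i x = (\<Sum>n. \<Sum>(D, I)\<in>\<D> \<times> {I. I \<subseteq> {1..k} \<and> i \<in> I}. ennreal (x n D (Tau I)))"

end

context mdp_run
begin

lemma prob_step_le:
  assumes "prefix_det n B" "0 \<le> q"
    and "\<And>\<omega>. \<forall>i<n. \<omega> i \<in> outcomes \<Longrightarrow> B \<omega> \<Longrightarrow> measure_pmf.prob (K n \<omega>) C \<le> q"
  shows "prob {\<omega> \<in> space PM. B \<omega> \<and> \<omega> n \<in> C} \<le> prob {\<omega> \<in> space PM. B \<omega>} * q"
  using emeasure_step_le[OF assms(1,3)] assms(2)
  by (simp add: emeasure_eq_measure ennreal_mult'[symmetric] mult.commute)

lemma prob_step_ge:
  assumes "prefix_det n B" "0 \<le> q"
    and "\<And>\<omega>. \<forall>i<n. \<omega> i \<in> outcomes \<Longrightarrow> B \<omega> \<Longrightarrow> q \<le> measure_pmf.prob (K n \<omega>) C"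
  shows "prob {\<omega> \<in> space PM. B \<omega>} * q \<le> prob {\<omega> \<in> space PM. B \<omega> \<and> \<omega> n \<in> C}"
  using emeasure_step_ge[OF assms(1,3)] assms(2)
  by (simp add: emeasure_eq_measure ennreal_mult'[symmetric] mult.commute)

lemma prob_stopped_le:
  assumes "\<And>t. prefix_det t (B t)" "\<And>\<omega> t t'. B t \<omega> \<Longrightarrow> B t' \<omega> \<Longrightarrow> t = t'" "0 \<le> q"
    and "\<And>\<omega> t. \<forall>i<t. \<omega> i \<in> outcomes \<Longrightarrow> B t \<omega> \<Longrightarrow> measure_pmf.prob (K t \<omega>) C \<le> q"
  shows "prob {\<omega> \<in> space PM. \<exists>t. B t \<omega> \<and> \<omega> t \<in> C} \<le> prob {\<omega> \<in> space PM. \<exists>t. B t \<omega>} * q"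
  using emeasure_stopped_le[OF assms(1,2,4)] assms(3)
  by (simp add: emeasure_eq_measure ennreal_mult'[symmetric] mult.commute)

lemma prob_stopped_ge:
  assumes "\<And>t. prefix_det t (B t)" "\<And>\<omega> t t'. B t \<omega> \<Longrightarrow> B t' \<omega> \<Longrightarrow> t = t'" "0 \<le> q"
    and "\<And>\<omega> t. \<forall>i<t. \<omega> i \<in> outcomes \<Longrightarrow> B t \<omega> \<Longrightarrow> q \<le> measure_pmf.prob (K t \<omega>) C"
  shows "prob {\<omega> \<in> space PM. \<exists>t. B t \<omega>} * q \<le> prob {\<omega> \<in> space PM. \<exists>t. B t \<omega> \<and> \<omega> t \<in> C}"
  using emeasure_stopped_ge[OF assms(1,2,4)] assms(3)
  by (simp add: emeasure_eq_measure ennreal_mult'[symmetric] mult.commute)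

lemma outcomes_Some: "\<omega> \<in> space PM \<Longrightarrow> \<omega> n = Some p \<Longrightarrow> p \<in> enabled_pairs M"
  by (auto simp: space_PM dest: spec[of _ n])

lemma pred_eq[measurable]: "Measurable.pred PM (\<lambda>\<omega>. \<omega> n = x)"
  by (rule pred_component[of "\<lambda>y. y = x"])

lemma pred_mem[measurable]: "Measurable.pred PM (\<lambda>\<omega>. \<omega> n \<in> A)"
  by (rule pred_component[of "\<lambda>y. y \<in> A"])

lemma pred_state_mem[measurable]: "Measurable.pred PM (\<lambda>\<omega>. fst (the (\<omega> n)) \<in> A)"
  by (rule pred_component[of "\<lambda>y. fst (the y) \<in> A"])

lemma pred_alive[measurable]: "Measurable.pred PM (\<lambda>\<omega>. \<forall>n. \<omega> n \<noteq> None)"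
  by measurable

lemma pred_reach[measurable]: "Measurable.pred PM (\<lambda>\<omega>. (\<lambda>n. fst (the (\<omega> n))) \<in> reach G)"
  unfolding reach_def by simp

end

lemma prefix_det_component: "i < n \<Longrightarrow> prefix_det n (\<lambda>\<omega>. f (\<omega> i))"
  by (auto simp: prefix_det_def)

section \<open>Schedulers of the quotient and flows\<close>

context rabin_mdp
begin

lemma finite_\<D>: "finite \<D>"
  by (rule finite_mec_partition[OF subM])

lemma finite_actions: "finite (actions M)" "finite (actions Q)"
  using subM by (auto simp: substochastic_mdp_def Q_simps)

lemma finite_index: "finite (\<D> \<times> {I. I \<subseteq> {1..k} \<and> i \<in> I})"
  using finite_\<D> by auto

lemma sub_subsystem_Q:
  "Y \<subseteq> states Q \<Longrightarrow> initial Q \<in> Y \<Longrightarrow> substochastic_mdp (subsystem Q Y)"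
  by (rule substochastic_subsystem[OF substochastic_Q])

lemma enabled_pairs_Q_actions: "(s, c) \<in> enabled_pairs Q \<Longrightarrow> c \<in> actions Q"
  by (rule enabled_pairs_states(2)[OF substochastic_Q])

lemma Bot_in_succ_Q:
  assumes "Bot I \<in> set_spmf (succ_spmf Q s a)"
  shows "(\<exists>D. s = Block D \<and> a = Tau I) \<or> s = Bot I"
proof (cases s)
  case (Block D)
  show ?thesis
  proof (cases a)
    case (Orig b)
    then show ?thesis using assms succ_Q_support[of "Bot I" D b] Block by auto
  next
    case (Tau J)
    then show ?thesis using assms Block by (simp add: succ_Q_Tau split: if_splits)
  qed
next
  case (Bot J)
  then show ?thesis using assms by (cases a) (simp_all add: succ_Q_Tau split: if_splits)
qed

text \<open>The run starts in a block, and the loop at \<open>Bot I\<close> does not change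
  \<open>I\<close>. The first visit to \<open>Bot I\<close> must therefore come from a block by
  \<open>Tau I\<close>.\<close>

lemma bot_history:
  assumes v: "\<forall>n. \<omega> n \<in> set_pmf (step_spmf (subsystem Q Y) \<tau> n \<omega>)"
  shows "\<omega> n = Some (Bot I, c) \<Longrightarrow> \<exists>m D. \<omega> m = Some (Block D, Tau I)"
proof (induction n arbitrary: c)
  case 0
  then show ?case using path_init(1)[OF v] by (auto simp: Q_simps)
next
  case (Suc n)
  from path_step[OF v Suc.prems] obtain s a where
    sa: "\<omega> n = Some (s, a)" "Bot I \<in> set_spmf (succ_spmf (subsystem Q Y) s a)" by metis
  then have "Bot I \<in> set_spmf (succ_spmf Q s a)" by (auto simp: succ_subsystem split: if_splits)
  then consider (block) D where "s = Block D" "a = Tau I" | (bot) "s = Bot I"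
    using Bot_in_succ_Q by blast
  then show ?case
  proof cases
    case block then show ?thesis using sa(1) by auto
  next
    case bot then show ?thesis using sa(1) Suc.IH by simp
  qed
qed

text \<open>In the quotient every step taken in a block is a decision, so until a \<open>Bot\<close>
  state is reached decision numbers and time agree, and the flow is the law of the n-th outcome. A
  goal state is reached only through some \<open>Tau I\<close>, which bounds the path probability by
  the value.\<close>

lemma scheduler_to_flow:
  assumes Y: "Y \<subseteq> states Q" "initial Q \<in> Y" and \<tau>: "scheduler (subsystem Q Y) \<tau>"
  shows "\<exists>x. flow Y x \<and> (\<forall>i. ennreal (path_prob (subsystem Q Y) \<tau> (reach (goal k i))) \<le> value_of i x)"
proof -
  let ?N = "subsystem Q Y"
  interpret R: mdp_run ?N \<tau>
    using sub_subsystem_Q[OF Y] \<tau> by unfold_locales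
  define x where "x n D c = R.prob {\<omega> \<in> space R.PM. \<omega> n = Some (Block D, c)}" for n D c
  have x_supp: "Block D \<in> Y \<and> (Block D, c) \<in> enabled_pairs Q" if "x n D c \<noteq> 0" for n D c
  proof -
    have "\<exists>\<omega>\<in>space R.PM. \<omega> n = Some (Block D, c)"
    proof (rule ccontr)
      assume "\<not> ?thesis"
      then have e: "{\<omega> \<in> space R.PM. \<omega> n = Some (Block D, c)} = {}" by blast
      from that show False unfolding x_def e by simp
    qed
    then obtain \<omega> where "\<omega> \<in> space R.PM" "\<omega> n = Some (Block D, c)" by blast
    from R.outcomes_Some[OF this] show ?thesis by (simp add: enabled_pairs_subsystem)
  qed
  have sum_le: "(\<Sum>c\<in>actions Q. x n D c) \<le> R.prob {\<omega> \<in> space R.PM. \<omega> n \<in> {Some (s, c) | s c. s \<in> {Block D}}}" for n D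
    unfolding x_def
    by (rule R.sum_prob_le[OF finite_actions(2) R.pred_mem]) auto
  have init: "(\<Sum>c\<in>actions Q. x 0 D c) \<le> of_bool (D = blk (initial M))" for D
  proof (cases "D = blk (initial M)")
    case True
    then show ?thesis using order_trans[OF sum_le R.prob_le_1] by simp
  next
    case False
    have "R.prob {\<omega> \<in> space R.PM. \<omega> 0 \<in> {Some (s, c) | s c. s \<in> {Block D}}} = 0"
    proof (rule R.prob_eq_0_AE)
      show "AE \<omega> in R.PM. \<not> \<omega> 0 \<in> {Some (s, c) | s c. s \<in> {Block D}}"
        using R.AE_in_set_pmf
      proof eventually_elim
        case (elim \<omega>)
        then show ?case using path_init(1)[OF elim] False by (auto simp: Q_simps)
      qed
    qed
    then show ?thesis using sum_le[of 0 D] False by simp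
  qed
  have step: "(\<Sum>c\<in>actions Q. x (Suc n) D' c) \<le>
       (\<Sum>(D, a)\<in>\<D> \<times> actions M. x n D (Orig a) * spmf (succ_spmf Q (Block D) (Orig a)) (Block D'))"
    if D': "Block D' \<in> Y" for n D'
  proof -
    let ?C = "{Some (s, c) | s c. s \<in> {Block D'}} :: ('s qstate \<times> 'a qaction) option set"
    let ?B = "\<lambda>(D, a) \<omega>. \<omega> n = Some (Block D, Orig a) \<and> \<omega> (Suc n) \<in> ?C"
    have "(\<Sum>c\<in>actions Q. x (Suc n) D' c) \<le> R.prob {\<omega> \<in> space R.PM. \<omega> (Suc n) \<in> ?C}"
      by (rule sum_le)
    also have "\<dots> \<le> (\<Sum>p\<in>\<D> \<times> actions M. R.prob {\<omega> \<in> space R.PM. ?B p \<omega>})"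
    proof (rule R.prob_le_sum)
      show "finite (\<D> \<times> actions M)" using finite_\<D> finite_actions by simp
      show "Measurable.pred R.PM (\<lambda>\<omega>. \<omega> (Suc n) \<in> ?C)" by (rule R.pred_mem)
      fix p show "Measurable.pred R.PM (?B p)" unfolding case_prod_unfold by (intro pred_intros_logic R.pred_eq R.pred_mem)
    next
      show "AE \<omega> in R.PM. \<omega> (Suc n) \<in> ?C \<longrightarrow> (\<exists>p\<in>\<D> \<times> actions M. ?B p \<omega>)"
        using R.AE_in_set_pmf AE_space
      proof eventually_elim
        case (elim \<omega>)
        show ?case
        proof
          assume C: "\<omega> (Suc n) \<in> ?C"
          then obtain c where "\<omega> (Suc n) = Some (Block D', c)" by auto
          from path_step[OF elim(1) this] obtain s a where
            sa: "\<omega> n = Some (s, a)" "Block D' \<in> set_spmf (succ_spmf ?N s a)" by metis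
          then have b: "Block D' \<in> set_spmf (succ_spmf Q s a)" by (auto simp: succ_subsystem split: if_splits)
          from R.outcomes_Some[OF elim(2) sa(1)] have e: "(s, a) \<in> enabled_pairs Q"
            by (simp add: enabled_pairs_subsystem)
          \<comment> \<open>All actions \<open>Tau\<close> lead to some \<open>Bot\<close>, so the
            predecessor of a block is a block left by an original action.\<close>
          from b e obtain D b where "s = Block D" "a = Orig b"
            by (cases s; cases a) (simp_all add: succ_Q_Tau split: if_splits)
          then show "\<exists>p\<in>\<D> \<times> actions M. ?B p \<omega>"
            using e C sa(1) enabled_pairs_states(2)[OF subM]
            by (auto simp: enabled_pairs_Q leaves_def intro!: bexI[of _ "(D, b)"])
        qed
      qed
    qed
    also have "\<dots> \<le> (\<Sum>(D, a)\<in>\<D> \<times> actions M. x n D (Orig a) * spmf (succ_spmf Q (Block D) (Orig a)) (Block D'))"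
    proof (intro sum_mono, clarify)
      fix D a
      show "R.prob {\<omega> \<in> space R.PM. \<omega> n = Some (Block D, Orig a) \<and> \<omega> (Suc n) \<in> ?C}
          \<le> x n D (Orig a) * spmf (succ_spmf Q (Block D) (Orig a)) (Block D')"
        unfolding x_def
      proof (rule R.prob_step_le)
        show "prefix_det (Suc n) (\<lambda>\<omega>. \<omega> n = Some (Block D, Orig a))"
          by (rule prefix_det_component) simp
        fix \<omega> assume "\<omega> n = Some (Block D, Orig a)"
        then have "measure (measure_spmf (next_state ?N (Suc n) \<omega>)) {Block D'}
            \<le> spmf (succ_spmf Q (Block D) (Orig a)) (Block D')"
          by (simp add: next_state_Suc succ_subsystem spmf_conv_measure_spmf[symmetric] spmf_restrict_spmf)
        with step_in_state_le[of ?N \<tau> "Suc n" \<omega> "{Block D'}"]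
        show "measure_pmf.prob (R.K (Suc n) \<omega>) ?C \<le> spmf (succ_spmf Q (Block D) (Orig a)) (Block D')"
          by linarith
      qed simp
    qed
    finally show ?thesis .
  qed
  have "flow Y x"
    unfolding flow_def using x_supp init step by (auto simp: x_def)
  moreover have "ennreal (path_prob ?N \<tau> (reach (goal k i))) \<le> value_of i x" for i
  proof -
    let ?R = "\<lambda>\<omega> :: nat \<Rightarrow> ('s qstate \<times> 'a qaction) option.
       (\<forall>n. \<omega> n \<noteq> None) \<and> (\<lambda>n. fst (the (\<omega> n))) \<in> reach (goal k i)"
    let ?B = "\<lambda>n (D, I) \<omega>. \<omega> n = Some (Block D, Tau I)"
    have "ennreal (path_prob ?N \<tau> (reach (goal k i))) = emeasure R.PM {\<omega> \<in> space R.PM. ?R \<omega>}"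
      by (simp add: path_prob_def R.emeasure_eq_measure)
    also have "\<dots> \<le> (\<Sum>n. \<Sum>p\<in>\<D> \<times> {I. I \<subseteq> {1..k} \<and> i \<in> I}. emeasure R.PM {\<omega> \<in> space R.PM. ?B n p \<omega>})"
    proof (rule R.emeasure_le_suminf_sum[OF finite_index])
      show "Measurable.pred R.PM ?R" by measurable
      fix n p show "Measurable.pred R.PM (?B n p)" by (cases p) simp
    next
      show "AE \<omega> in R.PM. ?R \<omega> \<longrightarrow> (\<exists>n. \<exists>p\<in>\<D> \<times> {I. I \<subseteq> {1..k} \<and> i \<in> I}. ?B n p \<omega>)"
        using R.AE_in_set_pmf AE_space
      proof eventually_elim
        case (elim \<omega>)
        show ?case
        proof
          assume "?R \<omega>"
          then obtain n I where "fst (the (\<omega> n)) = Bot I" and I: "I \<subseteq> {1..k}" "i \<in> I" and "\<omega> n \<noteq> None"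
            by (auto simp: reach_def goal_def)
          then obtain c where "\<omega> n = Some (Bot I, c)" by auto
          from bot_history[OF elim(1) this] obtain m D where m: "\<omega> m = Some (Block D, Tau I)" by auto
          from R.outcomes_Some[OF elim(2) this] have "D \<in> \<D>"
            by (auto simp: enabled_pairs_subsystem enabled_pairs_Q dest: choicesD)
          with m I show "\<exists>n. \<exists>p\<in>\<D> \<times> {I. I \<subseteq> {1..k} \<and> i \<in> I}. ?B n p \<omega>"
            by (intro exI[of _ m] bexI[of _ "(D, I)"]) auto
        qed
      qed
    qed
    also have "\<dots> = value_of i x"
      unfolding value_of_def x_def by (simp add: R.emeasure_eq_measure case_prod_unfold)
    finally show ?thesis .
  qed
  ultimately show ?thesis by blast
qed

end

context rabin_mdp
begin

lemma flow_nonneg: "flow Y x \<Longrightarrow> 0 \<le> x n D c"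
  by (simp add: flow_def)

lemma flow_support:
  "flow Y x \<Longrightarrow> x n D c \<noteq> 0 \<Longrightarrow> Block D \<in> Y"
  "flow Y x \<Longrightarrow> x n D c \<noteq> 0 \<Longrightarrow> (Block D, c) \<in> enabled_pairs Q"
  unfolding flow_def by blast+

lemma flow_init:
  assumes "flow Y x" "x 0 D c \<noteq> 0"
  shows "D = blk (initial M)" "(\<Sum>c\<in>actions Q. x 0 D c) \<le> 1"
proof -
  have s: "(\<Sum>c\<in>actions Q. x 0 D c) \<le> of_bool (D = blk (initial M))" using assms(1) by (simp add: flow_def)
  have "x 0 D c \<le> (\<Sum>c\<in>actions Q. x 0 D c)"
    using flow_support(2)[OF assms] enabled_pairs_Q_actions flow_nonneg[OF assms(1)] finite_actions
    by (intro member_le_sum) auto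
  moreover have "0 < x 0 D c" using assms flow_nonneg[OF assms(1)] by (simp add: less_le)
  ultimately show "D = blk (initial M)" using s by (cases "D = blk (initial M)") auto
  then show "(\<Sum>c\<in>actions Q. x 0 D c) \<le> 1" using s by simp
qed

lemma flow_step:
  "flow Y x \<Longrightarrow> Block D' \<in> Y \<Longrightarrow> (\<Sum>c\<in>actions Q. x (Suc n) D' c) \<le>
       (\<Sum>(D, a)\<in>\<D> \<times> actions M. x n D (Orig a) * spmf (succ_spmf Q (Block D) (Orig a)) (Block D'))"
  by (simp add: flow_def)

lemma flow_strategy:
  assumes "flow Y x"
  shows "\<exists>q. \<forall>n D. (\<forall>c. x n D c = (\<Sum>c\<in>actions Q. x n D c) * pmf (q n D) c) \<and>
    ((\<Sum>c\<in>actions Q. x n D c) \<noteq> 0 \<longrightarrow> set_pmf (q n D) \<subseteq> {c. x n D c \<noteq> 0})"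
proof -
  have "\<exists>p. (\<forall>c. x n D c = (\<Sum>c\<in>actions Q. x n D c) * pmf p c) \<and>
    ((\<Sum>c\<in>actions Q. x n D c) \<noteq> 0 \<longrightarrow> set_pmf p \<subseteq> {c. x n D c \<noteq> 0})" for n D
    using flow_support(2)[OF assms] enabled_pairs_Q_actions
    by (intro ex_normalized_pmf finite_actions flow_nonneg[OF assms]) blast
  then show ?thesis by metis
qed

text \<open>The scheduler plays the normalised flow at step \<open>length h\<close>. By induction
  the n-th outcome has at least the probability that the flow assigns to it: the balance inequality
  bounds the flow by exactly the mass that arrives. All \<open>Bot\<close> states belong to
  \<open>Y\<close>, so that no \<open>Tau I\<close> loses its mass.\<close>

lemma flow_to_scheduler:
  assumes Y: "Y \<subseteq> states Q" "initial Q \<in> Y" "Bot ` Pow {1..k} \<subseteq> Y" and x: "flow Y x"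
  shows "\<exists>\<tau>. scheduler (subsystem Q Y) \<tau> \<and>
    (\<forall>i. value_of i x \<le> ennreal (path_prob (subsystem Q Y) \<tau> (reach (goal k i))))"
proof -
  let ?N = "subsystem Q Y"
  define z where "z n D = (\<Sum>c\<in>actions Q. x n D c)" for n D
  obtain q where q: "\<And>n D c. x n D c = z n D * pmf (q n D) c"
    "\<And>n D. z n D \<noteq> 0 \<Longrightarrow> set_pmf (q n D) \<subseteq> {c. x n D c \<noteq> 0}"
    using flow_strategy[OF x] unfolding z_def by blast
  \<comment> \<open>Where the flow has no weight any enabled action will do; the choice below only
    makes this a scheduler.\<close>
  define \<tau> :: "('s qstate, 'a qaction) sched" where
    "\<tau> h s = (case s of Block D \<Rightarrow>
        if z (length h) D \<noteq> 0 then q (length h) D else return_pmf (SOME c. c \<in> enabled ?N s)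
      | Bot I \<Rightarrow> return_pmf (SOME c. c \<in> enabled ?N s))" for h s
  have \<tau>_sched: "scheduler ?N \<tau>"
    unfolding scheduler_def
  proof (intro allI ballI impI)
    fix h s assume "s \<in> states ?N" and ne: "enabled ?N s \<noteq> {}"
    then have some: "(SOME c. c \<in> enabled ?N s) \<in> enabled ?N s" by (simp add: some_in_eq)
    show "set_pmf (\<tau> h s) \<subseteq> enabled ?N s"
    proof (cases "\<exists>D. s = Block D \<and> z (length h) D \<noteq> 0")
      case True
      then obtain D where D: "s = Block D" "z (length h) D \<noteq> 0" by auto
      have "c \<in> enabled ?N s" if "c \<in> set_pmf (\<tau> h s)" for c
        using that D q(2)[OF D(2)] flow_support[OF x, of "length h" D c]
        by (auto simp: \<tau>_def enabled_iff enabled_pairs_subsystem)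
      then show ?thesis by auto
    next
      case False
      then have "\<tau> h s = return_pmf (SOME c. c \<in> enabled ?N s)"
        by (cases s) (auto simp: \<tau>_def)
      then show ?thesis using some by simp
    qed
  qed
  interpret R: mdp_run ?N \<tau>
    using sub_subsystem_Q[OF Y(1,2)] \<tau>_sched by unfold_locales
  have ne: "enabled ?N (Block D) \<noteq> {}" if "x n D c \<noteq> 0" for n D c
    using flow_support[OF x that] by (auto simp: enabled_iff enabled_pairs_subsystem)
  have z_ne: "z n D \<noteq> 0" if "x n D c \<noteq> 0" for n D c using that q(1)[of n D c] by auto
  have Block_le: "x n D c \<le> R.prob {\<omega> \<in> space R.PM. \<omega> n = Some (Block D, c)}" for n D c
  proof (cases "x n D c = 0")
    case False
    then show ?thesis
    proof (induction n arbitrary: D c)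
      case 0
      let ?C = "{Some (Block D, c)}"
      have "R.prob {\<omega> \<in> space R.PM. True} * pmf (q 0 D) c \<le> R.prob {\<omega> \<in> space R.PM. True \<and> \<omega> 0 \<in> ?C}"
      proof (rule R.prob_step_ge)
        fix \<omega> :: "nat \<Rightarrow> ('s qstate \<times> 'a qaction) option"
        show "pmf (q 0 D) c \<le> measure_pmf.prob (R.K 0 \<omega>) ?C"
          using ne[OF 0] z_ne[OF 0] flow_init(1)[OF x 0]
          by (simp add: measure_pmf_single pmf_step_Some next_state_0 Q_simps \<tau>_def)
      qed (auto simp: prefix_det_def)
      moreover have "x 0 D c \<le> 1 * pmf (q 0 D) c"
        unfolding q(1)[of 0 D c] using flow_init(2)[OF x 0] by (intro mult_right_mono) (auto simp: z_def)
      ultimately show ?case by (simp add: R.prob_space)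
    next
      case (Suc n)
      note nz = Suc.prems
      let ?w = "\<lambda>D' a. spmf (succ_spmf Q (Block D') (Orig a)) (Block D)"
      let ?B = "\<lambda>(D', a) \<omega>. \<omega> n = Some (Block D', Orig a) \<and> \<omega> (Suc n) \<in> {Some (Block D, c)}"
      have DY: "Block D \<in> Y" using flow_support[OF x nz] by simp
      have "x (Suc n) D c = z (Suc n) D * pmf (q (Suc n) D) c" by (rule q)
      also have "\<dots> \<le> (\<Sum>(D', a)\<in>\<D> \<times> actions M. x n D' (Orig a) * ?w D' a) * pmf (q (Suc n) D) c"
        using flow_step[OF x DY] by (intro mult_right_mono) (auto simp: z_def)
      also have "\<dots> = (\<Sum>(D', a)\<in>\<D> \<times> actions M. x n D' (Orig a) * (?w D' a * pmf (q (Suc n) D) c))"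
        by (simp add: sum_distrib_right case_prod_unfold mult.assoc)
      also have "\<dots> \<le> (\<Sum>p\<in>\<D> \<times> actions M. R.prob {\<omega> \<in> space R.PM. ?B p \<omega>})"
      proof (rule sum_mono, clarify)
        fix D' a
        show "x n D' (Orig a) * (?w D' a * pmf (q (Suc n) D) c)
          \<le> R.prob {\<omega> \<in> space R.PM. \<omega> n = Some (Block D', Orig a) \<and> \<omega> (Suc n) \<in> {Some (Block D, c)}}"
        proof (cases "x n D' (Orig a) = 0")
          case False
          have "x n D' (Orig a) * (?w D' a * pmf (q (Suc n) D) c) \<le>
            R.prob {\<omega> \<in> space R.PM. \<omega> n = Some (Block D', Orig a)} * (?w D' a * pmf (q (Suc n) D) c)"
            using Suc.IH[OF False] by (rule mult_right_mono) auto
          also have "\<dots> \<le> R.prob {\<omega> \<in> space R.PM. \<omega> n = Some (Block D', Orig a) \<and> \<omega> (Suc n) \<in> {Some (Block D, c)}}"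
          proof (rule R.prob_step_ge)
            show "prefix_det (Suc n) (\<lambda>\<omega>. \<omega> n = Some (Block D', Orig a))"
              by (rule prefix_det_component) simp
            fix \<omega> assume \<omega>: "\<omega> n = Some (Block D', Orig a)"
            have "\<tau> (map (the \<circ> \<omega>) [0..<Suc n]) (Block D) = q (Suc n) D"
              using z_ne[OF nz] by (simp add: \<tau>_def del: upt_Suc)
            moreover have "spmf (next_state ?N (Suc n) \<omega>) (Block D) = ?w D' a"
              using \<omega> DY flow_support(1)[OF x False] by (simp add: next_state_Suc succ_subsystem)
            ultimately show "?w D' a * pmf (q (Suc n) D) c \<le> measure_pmf.prob (R.K (Suc n) \<omega>) {Some (Block D, c)}"
              using ne[OF nz] by (simp add: measure_pmf_single pmf_step_Some del: upt_Suc)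
          qed simp
          finally show ?thesis .
        qed simp
      qed
      also have "\<dots> \<le> R.prob {\<omega> \<in> space R.PM. \<omega> (Suc n) = Some (Block D, c)}"
      proof (rule R.sum_prob_le)
        show "finite (\<D> \<times> actions M)" using finite_\<D> finite_actions by simp
        fix p show "Measurable.pred R.PM (?B p)" unfolding case_prod_unfold by (intro pred_intros_logic R.pred_eq R.pred_mem)
      qed auto
      finally show ?case .
    qed
  qed simp
  have "value_of i x \<le> ennreal (path_prob ?N \<tau> (reach (goal k i)))" for i
  proof -
    let ?R = "\<lambda>\<omega> :: nat \<Rightarrow> ('s qstate \<times> 'a qaction) option.
       (\<forall>n. \<omega> n \<noteq> None) \<and> (\<lambda>n. fst (the (\<omega> n))) \<in> reach (goal k i)"
    let ?F = "\<D> \<times> {I. I \<subseteq> {1..k} \<and> i \<in> I}"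
    let ?B = "\<lambda>n (D, I) \<omega>. \<omega> n = Some (Block D, Tau I)"
    \<comment> \<open>After \<open>Tau I\<close> the run loops in \<open>Bot I\<close> forever.
      Hence it never ends, and it takes \<open>Tau\<close> from a block at most once, so the events
      being summed are disjoint.\<close>
    have bot: "m > n \<longrightarrow> \<omega> m = Some (Bot I, Tau I)"
      if v: "\<forall>n. \<omega> n \<in> set_pmf (R.K n \<omega>)" and sp: "\<omega> \<in> space R.PM" and \<omega>: "\<omega> n = Some (Block D, Tau I)" for \<omega> n D I m
    proof (induction m)
      case (Suc m)
      have DI: "(D, I) \<in> choices" "Block D \<in> Y"
        using R.outcomes_Some[OF sp \<omega>] by (auto simp: enabled_pairs_subsystem enabled_pairs_Q)
      then have IY: "Bot I \<in> Y" and Ik: "I \<subseteq> {1..k}" using Y(3) choicesD by auto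
      have en: "enabled ?N (Bot I) = {Tau I}"
      proof -
        have "c \<in> enabled ?N (Bot I) \<longleftrightarrow> c = Tau I" for c
          using IY Ik by (cases c) (auto simp: enabled_iff enabled_pairs_subsystem enabled_pairs_Q)
        then show ?thesis by auto
      qed
      show ?case
      proof
        assume "n < Suc m"
        then obtain s c where m: "\<omega> m = Some (s, c)" "succ_spmf ?N s c = return_spmf (Bot I)"
        proof (cases "m = n")
          case True
          then show ?thesis using that \<omega> DI IY by (simp add: succ_subsystem succ_Q_Tau)
        next
          case False
          then show ?thesis using that \<open>n < Suc m\<close> Suc IY Ik by (simp add: succ_subsystem succ_Q_Tau)
        qed
        have "\<omega> (Suc m) \<noteq> None"
          by (rule path_not_lost[OF v m(1)]) (use m en in auto)
        then obtain s' c' where m': "\<omega> (Suc m) = Some (s', c')" by auto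
        from path_step[OF v this] m have s': "s' = Bot I" by auto
        from R.outcomes_Some[OF sp m'] have "c' \<in> enabled ?N s'" by (simp add: enabled_iff)
        with s' en m' show "\<omega> (Suc m) = Some (Bot I, Tau I)" by simp
      qed
    qed simp
    have "value_of i x \<le> (\<Sum>n. \<Sum>p\<in>?F. emeasure R.PM {\<omega> \<in> space R.PM. ?B n p \<omega>})"
      unfolding value_of_def R.emeasure_eq_measure
      using Block_le by (intro suminf_le sum_mono) (auto intro!: ennreal_leI)
    also have "\<dots> \<le> emeasure R.PM {\<omega> \<in> space R.PM. ?R \<omega>}"
    proof (rule R.suminf_sum_le_emeasure[OF finite_index])
      show "Measurable.pred R.PM ?R" by measurable
      fix n p show "Measurable.pred R.PM (?B n p)" by (cases p) simp
    next
      show "AE \<omega> in R.PM. \<forall>n n'. \<forall>p\<in>?F. \<forall>p'\<in>?F. ?B n p \<omega> \<longrightarrow> ?B n' p' \<omega> \<longrightarrow> n = n' \<and> p = p'"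
        using R.AE_in_set_pmf AE_space
      proof eventually_elim
        case (elim \<omega>)
        have lt: "\<not> n < n'" if "\<omega> n = Some (Block D, Tau I)" "\<omega> n' = Some (Block D', Tau I')" for n n' D D' I I'
          using bot[OF elim that(1), of n'] that(2) by auto
        have "n = n' \<and> p = p'" if "?B n p \<omega>" "?B n' p' \<omega>" for n n' p p'
        proof -
          obtain D I D' I' where p: "p = (D, I)" "p' = (D', I')" by (cases p; cases p') auto
          with that have "n = n'" using lt[of n D I n' D' I'] lt[of n' D' I' n D I] by simp
          with that p show ?thesis by simp
        qed
        then show ?case by blast
      qed
      show "AE \<omega> in R.PM. \<forall>n. \<forall>p\<in>?F. ?B n p \<omega> \<longrightarrow> ?R \<omega>"
        using R.AE_in_set_pmf AE_space
      proof eventually_elim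
        case (elim \<omega>)
        have "?R \<omega>" if "\<omega> n = Some (Block D, Tau I)" "I \<subseteq> {1..k}" "i \<in> I" for n D I
        proof
          show "\<forall>m. \<omega> m \<noteq> None"
          proof
            fix m
            have "\<omega> (Suc (max n m)) \<noteq> None" using bot[OF elim that(1), of "Suc (max n m)"] by simp
            then show "\<omega> m \<noteq> None"
              using path_None[OF elim(1), of m "Suc (max n m)"] by (meson le_SucI max.cobounded2)
          qed
          have "\<omega> (Suc n) = Some (Bot I, Tau I)" using bot[OF elim that(1), of "Suc n"] by simp
          then show "(\<lambda>n. fst (the (\<omega> n))) \<in> reach (goal k i)"
            using that by (auto simp: reach_def goal_def intro!: exI[of _ "Suc n"])
        qed
        then show ?case by auto
      qed
    qed
    also have "\<dots> = ennreal (path_prob ?N \<tau> (reach (goal k i)))"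
      by (simp add: path_prob_def R.emeasure_eq_measure)
    finally show ?thesis .
  qed
  with \<tau>_sched show ?thesis by blast
qed

end

text \<open>Phrased through the history list because a scheduler sees just this list and can read
  off the same number. Once a run has ended the count depends on the unspecified
  \<open>the None\<close>.\<close>

definition count_before :: "('p \<Rightarrow> bool) \<Rightarrow> nat \<Rightarrow> (nat \<Rightarrow> 'p option) \<Rightarrow> nat" where
  "count_before f t \<omega> = length (filter f (map (the \<circ> \<omega>) [0..<t]))"

lemma count_before_0 [simp]: "count_before f 0 \<omega> = 0"
  by (simp add: count_before_def)

lemma count_before_Suc:
  "count_before f (Suc t) \<omega> = (if f (the (\<omega> t)) then Suc (count_before f t \<omega>) else count_before f t \<omega>)"
  by (simp add: count_before_def)

lemma count_before_mono: "t \<le> t' \<Longrightarrow> count_before f t \<omega> \<le> count_before f t' \<omega>"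
  by (induction t' rule: dec_induct) (auto simp: count_before_Suc)

lemma count_before_inj:
  assumes "f (the (\<omega> t))" "f (the (\<omega> t'))" "count_before f t \<omega> = count_before f t' \<omega>"
  shows "t = t'"
proof -
  have "\<not> t < t'" if "f (the (\<omega> t))" "count_before f t \<omega> = count_before f t' \<omega>" for t t'
    using count_before_mono[of "Suc t" t' f \<omega>] that by (auto simp: count_before_Suc)
  from this[of t t'] this[of t' t] assms show ?thesis by auto
qed

lemma count_before_cong:
  assumes "\<And>i. i < t \<Longrightarrow> \<omega> i = \<omega>' i" shows "count_before f t \<omega> = count_before f t \<omega>'"
proof -
  have "map (the \<circ> \<omega>) [0..<t] = map (the \<circ> \<omega>') [0..<t]" using assms by simp
  then show ?thesis by (simp only: count_before_def)
qed

lemma prefix_det_count_before: "prefix_det t (count_before f t)"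
  by (rule prefix_detI) (rule count_before_cong)

lemma count_before_const:
  assumes "\<And>t. t0 \<le> t \<Longrightarrow> \<not> f (the (\<omega> t))" "t0 \<le> t"
  shows "count_before f t \<omega> = count_before f t0 \<omega>"
  using assms(2) by (induction t rule: dec_induct) (auto simp: count_before_Suc assms(1))

lemma prefix_det_conj: "prefix_det n A \<Longrightarrow> prefix_det n B \<Longrightarrow> prefix_det n (\<lambda>\<omega>. A \<omega> \<and> B \<omega>)"
  unfolding prefix_det_def by metis

lemma prefix_det_comp: "prefix_det n A \<Longrightarrow> prefix_det n (\<lambda>\<omega>. f (A \<omega>))"
  unfolding prefix_det_def by metis

lemma (in mdp_run) pred_count[measurable]: "Measurable.pred PM (\<lambda>\<omega>. count_before f t \<omega> = n)"
  by (rule pred_prefix_det[OF prefix_det_comp[OF prefix_det_count_before]])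

lemma (in mdp_run) pred_frequently[measurable]: "Measurable.pred PM (\<lambda>\<omega>. \<exists>\<^sub>\<infinity>t. \<omega> t = x)"
  unfolding INFM_nat_le by measurable

lemma (in mdp_run) pred_rabin[measurable]:
  assumes "finite R"
  shows "Measurable.pred PM (\<lambda>\<omega>. (\<lambda>n. fst (the (\<omega> n))) \<in> rabin R)"
proof -
  have eq: "(\<lambda>\<omega> :: nat \<Rightarrow> ('s \<times> 'a) option. (\<lambda>n. fst (the (\<omega> n))) \<in> rabin R) =
    (\<lambda>\<omega>. \<exists>p\<in>R. (\<forall>m. \<exists>n. m \<le> n \<and> fst (the (\<omega> n)) \<in> fst p) \<and> (\<exists>m. \<forall>n. m \<le> n \<longrightarrow> fst (the (\<omega> n)) \<in> snd p))"
    by (auto simp: rabin_def INFM_nat_le MOST_nat_le case_prod_unfold fun_eq_iff)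
  show ?thesis
    unfolding eq
    by (intro pred_intros_finite(4) assms pred_intros_logic pred_intros_countable pred_state_mem) auto
qed

section \<open>Limit behaviour of a run\<close>

text \<open>The successors are taken in \<open>M0\<close>, not in the subsystem. One outside
  \<open>T\<close> would end the run with a fixed positive probability at each recurrence, so on
  infinite runs the limit set is closed under all successors of \<open>M0\<close>.\<close>

lemma (in mdp_run) AE_limit_closed:
  assumes M: "M = subsystem M0 T"
  shows "AE \<omega> in PM. \<forall>p\<in>enabled_pairs M. \<forall>t'\<in>set_spmf (succ_spmf M0 (fst p) (snd p)).
    (\<exists>\<^sub>\<infinity>t. \<omega> t = Some p) \<longrightarrow> (\<exists>\<^sub>\<infinity>t. \<omega> t \<in> insert None {Some (t', b) | b. True})"
proof (intro AE_ball_countable' AE_ball_countable[THEN iffD2] ballI)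
  show "countable (enabled_pairs M)" using finite_enabled_pairs by (rule countable_finite)
  fix p assume p: "p \<in> enabled_pairs M"
  obtain s a where sa: "p = (s, a)" by (cases p)
  show "countable (set_spmf (succ_spmf M0 (fst p) (snd p)))" by (rule countable_set_spmf)
  fix t' assume t': "t' \<in> set_spmf (succ_spmf M0 (fst p) (snd p))"
  let ?C = "insert None {Some (t', b) | b. True} :: ('s \<times> 'a) option set"
  show "AE \<omega> in PM. (\<exists>\<^sub>\<infinity>t. \<omega> t = Some p) \<longrightarrow> (\<exists>\<^sub>\<infinity>t. \<omega> t \<in> ?C)"
  proof (rule AE_frequently_next)
    show "0 < spmf (succ_spmf M0 s a) t'" using t' sa by (simp add: in_set_spmf_iff_spmf less_le)
    have "s \<in> T" using p by (auto simp: M sa enabled_pairs_subsystem)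
    then show "spmf (succ_spmf M0 s a) t' \<le> measure_pmf.prob (K (Suc n) \<omega>) ?C" if "\<omega> n = Some p" for \<omega> n
      using step_subsystem_ge[of \<omega> n s a T M0 t' \<sigma>] that by (simp add: M sa)
  qed
qed

definition limit_pairs :: "('s, 'a) smdp \<Rightarrow> (nat \<Rightarrow> ('s \<times> 'a) option) \<Rightarrow> ('s \<times> 'a) set" where
  "limit_pairs N \<omega> = {p \<in> enabled_pairs N. \<exists>\<^sub>\<infinity>t. \<omega> t = Some p}"

text \<open>There are finitely many candidates for the limit set, and each is described by finitely
  many events of the form that a pair recurs.\<close>

lemma (in mdp_run) pred_limit_pairs[measurable]: "Measurable.pred PM (\<lambda>\<omega>. limit_pairs M \<omega> \<in> X)"
proof -
  have eq: "(\<lambda>\<omega>. limit_pairs M \<omega> \<in> X) = (\<lambda>\<omega>. \<exists>l\<in>X \<inter> Pow (enabled_pairs M).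
    \<forall>p\<in>enabled_pairs M. (p \<in> l) = (\<exists>\<^sub>\<infinity>t. \<omega> t = Some p))" (is "_ = ?R")
  proof
    fix \<omega>
    have uniq: "limit_pairs M \<omega> = l" if "l \<subseteq> enabled_pairs M"
      "\<forall>p\<in>enabled_pairs M. (p \<in> l) = (\<exists>\<^sub>\<infinity>t. \<omega> t = Some p)" for l
      using that by (auto simp: limit_pairs_def)
    show "(limit_pairs M \<omega> \<in> X) = ?R \<omega>"
    proof
      assume "limit_pairs M \<omega> \<in> X"
      then show "?R \<omega>" by (intro bexI[of _ "limit_pairs M \<omega>"]) (auto simp: limit_pairs_def)
    next
      assume "?R \<omega>"
      then obtain l where "l \<in> X" "l \<subseteq> enabled_pairs M"
        "\<forall>p\<in>enabled_pairs M. (p \<in> l) = (\<exists>\<^sub>\<infinity>t. \<omega> t = Some p)" by (elim bexE IntE PowD[elim_format])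
      with uniq[of l] show "limit_pairs M \<omega> \<in> X" by simp
    qed
  qed
  show ?thesis
    unfolding eq using finite_enabled_pairs
    by (intro pred_intros_finite(3,4) pred_intros_logic pred_frequently) auto
qed

lemma limit_pairs_cofinal:
  assumes fin: "finite (enabled_pairs N)" and out: "\<And>t. \<omega> t \<in> Some ` enabled_pairs N"
  shows "\<forall>\<^sub>\<infinity>t. \<omega> t \<in> Some ` limit_pairs N \<omega>" "limit_pairs N \<omega> \<noteq> {}"
proof -
  have "\<forall>\<^sub>\<infinity>t. \<forall>p\<in>enabled_pairs N - limit_pairs N \<omega>. \<omega> t \<noteq> Some p"
  proof (subst MOST_finite_Ball_distrib, use fin in blast, rule ballI)
    fix p assume "p \<in> enabled_pairs N - limit_pairs N \<omega>"
    then have "\<not> (\<exists>\<^sub>\<infinity>t. \<omega> t = Some p)" unfolding limit_pairs_def by blast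
    then show "\<forall>\<^sub>\<infinity>t. \<omega> t \<noteq> Some p" by (simp only: not_frequently)
  qed
  then show *: "\<forall>\<^sub>\<infinity>t. \<omega> t \<in> Some ` limit_pairs N \<omega>"
  proof (rule MOST_mono)
    fix t assume "\<forall>p\<in>enabled_pairs N - limit_pairs N \<omega>. \<omega> t \<noteq> Some p"
    with out[of t] show "\<omega> t \<in> Some ` limit_pairs N \<omega>" by auto
  qed
  from MOST_nat[THEN iffD1, OF *] show "limit_pairs N \<omega> \<noteq> {}" by auto
qed

text \<open>Closure is \<open>cl\<close>, since an infinite run excludes \<open>None\<close>. For
  connectivity, follow the run from a late occurrence of \<open>s\<close> to a later one of
  \<open>t\<close>: from some time on, all pairs in between belong to the limit set.\<close>

lemma limit_end_component:
  assumes M: "substochastic_mdp M" and v: "\<forall>n. \<omega> n \<in> set_pmf (step_spmf (subsystem M T) \<sigma> n \<omega>)"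
    and out: "\<And>t. \<omega> t \<in> Some ` enabled_pairs (subsystem M T)"
    and cl: "\<forall>p\<in>enabled_pairs (subsystem M T). \<forall>t'\<in>set_spmf (succ_spmf M (fst p) (snd p)).
      (\<exists>\<^sub>\<infinity>t. \<omega> t = Some p) \<longrightarrow> (\<exists>\<^sub>\<infinity>t. \<omega> t \<in> insert None {Some (t', b) | b. True})"
  shows "end_component M (limit_pairs (subsystem M T) \<omega>)"
proof -
  let ?N = "subsystem M T" and ?L = "limit_pairs (subsystem M T) \<omega>"
  have fin: "finite (enabled_pairs ?N)"
    by (rule finite_subset[OF _ finite_enabled_pairs[OF M]]) (auto simp: enabled_pairs_subsystem)
  note cof = limit_pairs_cofinal[of ?N \<omega>, OF fin out]
  have "?L \<subseteq> enabled_pairs M" by (auto simp: limit_pairs_def enabled_pairs_subsystem)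
  moreover have "set_spmf (succ_spmf M s a) \<subseteq> ec_states ?L" if "(s, a) \<in> ?L" for s a
  proof
    fix t' assume "t' \<in> set_spmf (succ_spmf M s a)"
    with that cl have "\<exists>\<^sub>\<infinity>t. \<omega> t \<in> insert None {Some (t', b) | b. True}"
      by (fastforce simp: limit_pairs_def)
    then have "\<exists>\<^sub>\<infinity>t. \<exists>p\<in>{p \<in> enabled_pairs ?N. fst p = t'}. \<omega> t = Some p"
      by (rule INFM_mono) (use out in fastforce)
    then obtain p where "p \<in> enabled_pairs ?N" "fst p = t'" "\<exists>\<^sub>\<infinity>t. \<omega> t = Some p"
      using fin by (subst (asm) INFM_finite_Bex_distrib) auto
    then show "t' \<in> ec_states ?L" by (auto simp: limit_pairs_def)
  qed
  moreover have "(s, t) \<in> (ec_edges M ?L)\<^sup>*" if s: "s \<in> ec_states ?L" and t: "t \<in> ec_states ?L" for s t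
  proof -
    from cof(1) obtain m where m: "\<And>n. n > m \<Longrightarrow> \<omega> n \<in> Some ` ?L" by (auto simp: MOST_nat)
    from s obtain p where p: "p \<in> ?L" "fst p = s" by auto
    from t obtain p' where p': "p' \<in> ?L" "fst p' = t" by auto
    from p obtain n1 where n1: "n1 > m" "\<omega> n1 = Some p" by (auto simp: limit_pairs_def INFM_nat)
    from p' obtain n2 where n2: "n2 > n1" "\<omega> n2 = Some p'" by (auto simp: limit_pairs_def INFM_nat)
    have "(s, fst (the (\<omega> n))) \<in> (ec_edges M ?L)\<^sup>*" if "n1 \<le> n" for n
      using that
    proof (induction n rule: dec_induct)
      case base then show ?case using n1 p by simp
    next
      case (step n)
      from out[of "Suc n"] obtain s' a' where Sn: "\<omega> (Suc n) = Some (s', a')" by auto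
      from path_step[OF v Sn] obtain u b where u: "\<omega> n = Some (u, b)" "s' \<in> set_spmf (succ_spmf ?N u b)" by metis
      have "\<omega> n \<in> Some ` ?L" using m[of n] step n1 by simp
      with u have "(u, b) \<in> ?L" by auto
      with u(2) have "(u, s') \<in> ec_edges M ?L" by (auto simp: ec_edges_def succ_subsystem split: if_splits)
      with step u Sn show ?case by simp
    qed
    from this[of n2] n2 p' show ?thesis by simp
  qed
  ultimately show ?thesis using cof(2) unfolding end_component_def by blast
qed

section \<open>From schedulers of a subsystem of \<open>M\<close> to flows\<close>

context rabin_mdp
begin

text \<open>For the converse, the visits of a run to a block are cut at the actions that may leave it.\<close>

definition leave :: "'s \<times> 'a \<Rightarrow> bool" where
  "leave p \<longleftrightarrow> leaves M (blk (fst p)) (fst p) (snd p)"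

abbreviation "epoch \<equiv> count_before leave"

lemma leaves_imp_leave:
  "D \<in> \<D> \<Longrightarrow> leaves M D s a \<Longrightarrow> leave (s, a)"
  by (metis block_of_eq fst_conv leave_def leaves_def snd_conv)

lemma leaves_state: "leaves M D s a \<Longrightarrow> s \<in> D"
  by (simp add: leaves_def)

text \<open>A successor outside \<open>D\<close> would carry positive mass and leave less than 1 for
  \<open>D\<close>.\<close>

lemma not_leaves_stays:
  assumes "(s, a) \<in> enabled_pairs M" "s \<in> D" "\<not> leaves M D s a" "s' \<in> set_spmf (succ_spmf M s a)"
  shows "s' \<in> D"
proof (rule ccontr)
  assume "s' \<notin> D"
  let ?m = "measure (measure_spmf (succ_spmf M s a))"
  have "?m D + ?m {s'} = ?m (D \<union> {s'})"
    using \<open>s' \<notin> D\<close> by (intro measure_spmf.finite_measure_Union[symmetric]) auto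
  also have "\<dots> \<le> 1" by (rule measure_spmf.subprob_measure_le_1)
  finally have "?m D + spmf (succ_spmf M s a) s' \<le> 1" by (simp add: spmf_conv_measure_spmf)
  moreover have "0 < spmf (succ_spmf M s a) s'" using assms(4) by (simp add: in_set_spmf_iff_spmf less_le)
  ultimately show False using assms by (auto simp: leaves_def)
qed

text \<open>Only a leaving action can change the block, so the block is constant during an epoch and
  is fixed by the place where the previous leaving action landed. Such an action opens a new epoch
  even if it returns to the block it came from.\<close>

lemma epoch_start:
  assumes T: "T \<subseteq> states M" and D: "D \<in> \<D>" and v: "\<forall>n. \<omega> n \<in> set_pmf (step_spmf (subsystem M T) \<sigma> n \<omega>)"
    and out: "\<And>t p. \<omega> t = Some p \<Longrightarrow> p \<in> enabled_pairs (subsystem M T)"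
  shows "\<omega> t = Some (s, a) \<Longrightarrow> s \<in> D \<Longrightarrow>
    (if epoch t \<omega> = 0 then initial M \<in> D
     else \<exists>t'. \<omega> t' \<noteq> None \<and> leave (the (\<omega> t')) \<and> Suc (epoch t' \<omega>) = epoch t \<omega> \<and>
       (\<exists>s' b. \<omega> (Suc t') = Some (s', b) \<and> s' \<in> D))"
proof (induction t arbitrary: s a)
  case 0
  then show ?case using path_init(1)[OF v] by auto
next
  case (Suc t)
  from path_step[OF v Suc.prems(1)] obtain u b where
    u: "\<omega> t = Some (u, b)" "s \<in> set_spmf (succ_spmf (subsystem M T) u b)" by metis
  then have s: "s \<in> set_spmf (succ_spmf M u b)" by (auto simp: succ_subsystem split: if_splits)
  show ?case
  proof (cases "leave (u, b)")
    case True
    then show ?thesis using u Suc.prems by (auto simp: count_before_Suc intro!: exI[of _ t])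
  next
    case False
    from out[OF u(1)] have e: "(u, b) \<in> enabled_pairs M" by (simp add: enabled_pairs_subsystem)
    then have "u \<in> states M" by (rule enabled_pairs_states[OF subM])
    note blk = block_of_in[OF this]
    have "s \<in> blk u"
      using not_leaves_stays[OF e blk(2) _ s] False by (simp add: leave_def)
    then have "blk u = D" using mec_partition_unique[OF blk(1) D] Suc.prems by blast
    then have "u \<in> D" using blk(2) by simp
    note IH = Suc.IH[OF u(1) this]
    have eq: "epoch (Suc t) \<omega> = epoch t \<omega>" using False u(1) by (simp add: count_before_Suc)
    show ?thesis unfolding eq by (rule IH)
  qed
qed

text \<open>A run whose limit set has type \<open>(D, I)\<close> plays the role of the decision \<open>Tau I\<close> in block \<open>D\<close>.\<close>

definition limit_type :: "'s set \<Rightarrow> nat set \<Rightarrow> ('s \<times> 'a) set set" where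
  "limit_type D I = {l. end_component M l \<and> (\<exists>E. mec M E \<and> l \<subseteq> E \<and> ec_states E = D) \<and>
     I = {i \<in> {1..k}. ec_rabin l (P i)}}"

lemma limit_type_choices: "l \<in> limit_type D I \<Longrightarrow> (D, I) \<in> choices"
  unfolding limit_type_def rabin_choices_def by blast

lemma limit_type_inj: "l \<in> limit_type D I \<Longrightarrow> l \<in> limit_type D J \<Longrightarrow> I = J"
  by (simp add: limit_type_def)

text \<open>Transitions of \<open>M\<close> are lossless and those of a MEC stay inside it, so the
  block keeps the full mass 1.\<close>

lemma mec_not_leave:
  assumes "mec M E" "p \<in> E"
  shows "\<not> leave p"
proof -
  obtain s a where p: "p = (s, a)" by (cases p)
  have ec: "end_component M E" using assms by (simp add: mec_def)
  have "set_spmf (succ_spmf M s a) \<subseteq> ec_states E" "(s, a) \<in> enabled_pairs M"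
    using ec assms(2) by (auto simp: end_component_def p)
  moreover have "blk s = ec_states E"
    using assms by (intro block_of_eq mec_partition_mec) (auto simp: p intro: rev_image_eqI)
  moreover have "lossless_spmf (succ_spmf M s a)"
    using mdp \<open>(s, a) \<in> enabled_pairs M\<close> by (auto simp: mdp_def)
  moreover have "measure (measure_spmf (succ_spmf M s a)) (ec_states E) = measure (measure_spmf (succ_spmf M s a)) UNIV"
    if "set_spmf (succ_spmf M s a) \<subseteq> ec_states E"
    using that by (intro measure_spmf.finite_measure_eq_AE) (auto simp: AE_measure_spmf_iff)
  ultimately have "measure (measure_spmf (succ_spmf M s a)) (blk s) = 1"
    by (simp add: lossless_spmf_def weight_spmf_def)
  then show ?thesis by (simp add: p leave_def leaves_def)
qed

text \<open>For \<open>Tau I\<close> the event depends on the infinite future and no prefix decides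
  it. Its probability is therefore controlled through the start of epoch \<open>n\<close>, not
  through the law of one step.\<close>

definition occurs :: "('s, 'a) smdp \<Rightarrow> nat \<Rightarrow> 's set \<Rightarrow> 'a qaction \<Rightarrow> (nat \<Rightarrow> ('s \<times> 'a) option) \<Rightarrow> bool" where
  "occurs N n D c \<omega> \<longleftrightarrow> D \<in> \<D> \<and> (case c of
      Orig a \<Rightarrow> \<exists>t. (\<exists>s. leaves M D s a \<and> \<omega> t = Some (s, a)) \<and> epoch t \<omega> = n
    | Tau I \<Rightarrow> (\<forall>t. \<omega> t \<noteq> None) \<and> (\<exists>t0. \<forall>t\<ge>t0. epoch t \<omega> = n) \<and> limit_pairs N \<omega> \<in> limit_type D I)"

text \<open>A leaving action closes its epoch, which excludes both a second one with the same number
  and staying in that epoch forever. Two choices to stay agree because the limit set determines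
  \<open>I\<close>.\<close>

lemma occurs_inj:
  assumes "occurs N n D c \<omega>" "occurs N n D c' \<omega>"
  shows "c = c'"
proof -
  have ot: False if "occurs N n D (Orig a) \<omega>" "occurs N n D (Tau I) \<omega>" for a I
  proof -
    from that(1) obtain t s where t: "leaves M D s a" "\<omega> t = Some (s, a)" "epoch t \<omega> = n" "D \<in> \<D>"
      by (auto simp: occurs_def)
    then have "epoch (Suc t) \<omega> = Suc n" using leaves_imp_leave[OF t(4,1)] by (simp add: count_before_Suc)
    moreover from that(2) obtain t0 where "\<forall>t\<ge>t0. epoch t \<omega> = n" by (auto simp: occurs_def)
    ultimately show False
      using count_before_mono[of "Suc t" "max t0 (Suc t)" leave \<omega>] by simp
  qed
  have oo: "a = b" if "occurs N n D (Orig a) \<omega>" "occurs N n D (Orig b) \<omega>" for a b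
  proof -
    from that(1) obtain t s where t: "leaves M D s a" "\<omega> t = Some (s, a)" "epoch t \<omega> = n" "D \<in> \<D>"
      by (auto simp: occurs_def)
    from that(2) obtain t' s' where t': "leaves M D s' b" "\<omega> t' = Some (s', b)" "epoch t' \<omega> = n"
      by (auto simp: occurs_def)
    have "t = t'"
      using t t' leaves_imp_leave[OF t(4,1)] leaves_imp_leave[OF t(4) t'(1)]
      by (intro count_before_inj[of leave \<omega> t t']) simp_all
    then show ?thesis using t t' by simp
  qed
  show ?thesis
  proof (cases c; cases c')
    fix I J assume "c = Tau I" "c' = Tau J"
    then show ?thesis using assms limit_type_inj by (simp add: occurs_def) blast
  qed (use assms ot oo in auto)
qed

lemma (in mdp_run) pred_leaves_at:
  "Measurable.pred PM (\<lambda>\<omega>. \<exists>s. R s a \<and> \<omega> t = Some (s, a))"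
  using pred_component[of "\<lambda>y. \<exists>s. R s a \<and> y = Some (s, a)" t] by simp

lemma pred_occurs:
  assumes "mdp_run N \<sigma>"
  shows "Measurable.pred (path_measure N \<sigma>) (occurs N n D c)"
proof -
  interpret R: mdp_run N \<sigma> by fact
  show ?thesis
  proof (cases c)
    case (Orig a)
    have "Measurable.pred R.PM (\<lambda>\<omega>. \<exists>t. (\<exists>s. leaves M D s a \<and> \<omega> t = Some (s, a)) \<and> epoch t \<omega> = n)"
      by (intro pred_intros_countable pred_intros_logic R.pred_leaves_at R.pred_count)
    then have "Measurable.pred R.PM (\<lambda>\<omega>. D \<in> \<D> \<and>
        (\<exists>t. (\<exists>s. leaves M D s a \<and> \<omega> t = Some (s, a)) \<and> epoch t \<omega> = n))"
      by (rule pred_intros_conj1')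
    then show ?thesis unfolding Orig occurs_def qaction.case .
  next
    case (Tau I)
    have "Measurable.pred R.PM (\<lambda>\<omega>. (\<forall>t. \<omega> t \<noteq> None) \<and> (\<exists>t0. \<forall>t. t0 \<le> t \<longrightarrow> epoch t \<omega> = n) \<and>
        limit_pairs N \<omega> \<in> limit_type D I)"
      by (intro pred_intros_countable pred_intros_logic R.pred_alive R.pred_count R.pred_limit_pairs) simp
    then have "Measurable.pred R.PM (\<lambda>\<omega>. D \<in> \<D> \<and> (\<forall>t. \<omega> t \<noteq> None) \<and>
        (\<exists>t0. \<forall>t. t0 \<le> t \<longrightarrow> epoch t \<omega> = n) \<and> limit_pairs N \<omega> \<in> limit_type D I)"
      by (rule pred_intros_conj1')
    then show ?thesis unfolding Tau occurs_def qaction.case .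
  qed
qed

text \<open>A subsystem may contain only part of a block while the quotient knows whole blocks;
  hence \<open>Y\<close> collects the blocks that meet \<open>T\<close>. The balance inequality
  holds because decision \<open>Suc n\<close> in \<open>D'\<close>, of whatever kind, requires
  leaving action number \<open>n\<close> to have landed in \<open>D'\<close>.\<close>

lemma scheduler_to_flow_rabin:
  assumes T: "T \<subseteq> states M" "initial M \<in> T" and \<sigma>: "scheduler (subsystem M T) \<sigma>"
    and fin: "\<And>i. i \<in> {1..k} \<Longrightarrow> finite (P i)"
    and Y: "Y = Block ` {D \<in> \<D>. D \<inter> T \<noteq> {}} \<union> Bot ` Pow {1..k}"
  shows "\<exists>x. flow Y x \<and> (\<forall>i\<in>{1..k}. ennreal (path_prob (subsystem M T) \<sigma> (rabin (P i))) \<le> value_of i x)"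
proof -
  let ?N = "subsystem M T"
  interpret R: mdp_run ?N \<sigma>
    using substochastic_subsystem[OF subM T] \<sigma> by unfold_locales
  note pred_occ = pred_occurs[OF R.mdp_run_axioms]
  define x where "x n D c = R.prob {\<omega> \<in> space R.PM. occurs ?N n D c \<omega>}" for n D c
  have out: "p \<in> enabled_pairs M \<and> fst p \<in> T" if "\<omega> \<in> space R.PM" "\<omega> t = Some p" for \<omega> t p
    using R.outcomes_Some[OF that] by (auto simp: enabled_pairs_subsystem)
  have x_supp: "Block D \<in> Y \<and> (Block D, c) \<in> enabled_pairs Q" if "x n D c \<noteq> 0" for n D c
  proof -
    have "\<exists>\<omega>\<in>space R.PM. occurs ?N n D c \<omega>"
    proof (rule ccontr)
      assume "\<not> ?thesis"
      then have e: "{\<omega> \<in> space R.PM. occurs ?N n D c \<omega>} = {}" by blast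
      from that show False unfolding x_def e by simp
    qed
    then obtain \<omega> where sp: "\<omega> \<in> space R.PM" and occ: "occurs ?N n D c \<omega>" by blast
    show ?thesis
    proof (cases c)
      case (Orig a)
      with occ obtain t s where t: "D \<in> \<D>" "leaves M D s a" "\<omega> t = Some (s, a)" by (auto simp: occurs_def)
      from out[OF sp t(3)] leaves_state[OF t(2)] have "D \<inter> T \<noteq> {}" by auto
      with t show ?thesis by (auto simp: Y enabled_pairs_Q Orig)
    next
      case (Tau I)
      with occ have l: "D \<in> \<D>" "limit_pairs ?N \<omega> \<in> limit_type D I" by (auto simp: occurs_def)
      then obtain E where E: "end_component M (limit_pairs ?N \<omega>)" "limit_pairs ?N \<omega> \<subseteq> E" "ec_states E = D"
        by (auto simp: limit_type_def)
      then obtain p where p: "p \<in> limit_pairs ?N \<omega>" by (auto simp: end_component_def)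
      then have "fst p \<in> T" by (auto simp: limit_pairs_def enabled_pairs_subsystem)
      moreover have "fst p \<in> D" using E p by auto
      ultimately show ?thesis using l limit_type_choices[OF l(2)] by (auto simp: Y enabled_pairs_Q Tau)
    qed
  qed
  have valid: "AE \<omega> in R.PM. \<omega> \<in> space R.PM \<and> (\<forall>n. \<omega> n \<in> set_pmf (R.K n \<omega>))"
    using R.AE_in_set_pmf AE_space by eventually_elim simp
  \<comment> \<open>Any moment of epoch \<open>n\<close> spent in \<open>D\<close> gives access to
    \<open>epoch_start\<close>. For \<open>Tau I\<close> such a moment exists because the limit
    pairs, whose states lie in \<open>D\<close>, recur after the last epoch has begun.\<close>
  have start: "if n = 0 then initial M \<in> D else \<exists>t'. \<omega> t' \<noteq> None \<and> leave (the (\<omega> t')) \<and> Suc (epoch t' \<omega>) = n \<and>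
       (\<exists>s' b. \<omega> (Suc t') = Some (s', b) \<and> s' \<in> D)"
    if \<omega>: "\<omega> \<in> space R.PM \<and> (\<forall>n. \<omega> n \<in> set_pmf (R.K n \<omega>))" and occ: "occurs ?N n D c \<omega>" for \<omega> n D c
  proof -
    have "\<exists>t s a. \<omega> t = Some (s, a) \<and> s \<in> D \<and> epoch t \<omega> = n"
    proof (cases c)
      case (Orig a)
      then show ?thesis using occ leaves_state by (force simp: occurs_def)
    next
      case (Tau I)
      with occ obtain t0 E where t0: "\<forall>t\<ge>t0. epoch t \<omega> = n" "end_component M (limit_pairs ?N \<omega>)"
        "limit_pairs ?N \<omega> \<subseteq> E" "ec_states E = D"
        by (auto simp: occurs_def limit_type_def)
      then obtain p where p: "p \<in> limit_pairs ?N \<omega>" by (auto simp: end_component_def)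
      then obtain t where t: "t > t0" "\<omega> t = Some p" by (auto simp: limit_pairs_def INFM_nat)
      have "fst p \<in> D" using t0 p by auto
      with t t0(1) show ?thesis by (intro exI[of _ t] exI[of _ "fst p"] exI[of _ "snd p"]) auto
    qed
    then obtain t s a where t: "\<omega> t = Some (s, a)" "s \<in> D" "epoch t \<omega> = n" by auto
    have "D \<in> \<D>" using occ by (simp add: occurs_def)
    note es = epoch_start[of T D \<omega> \<sigma> t s a, OF T(1) this _ _ t(1,2)]
    have v: "\<forall>n. \<omega> n \<in> set_pmf (R.K n \<omega>)" and sp: "\<omega> \<in> space R.PM" using \<omega> by blast+
    from es[OF v R.outcomes_Some[OF sp]] show ?thesis unfolding t(3) .
  qed
  have init: "(\<Sum>c\<in>actions Q. x 0 D c) \<le> of_bool (D = blk (initial M))" for D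
  proof -
    have "(\<Sum>c\<in>actions Q. x 0 D c) \<le> R.prob {\<omega> \<in> space R.PM. D = blk (initial M)}"
      unfolding x_def
    proof (rule R.sum_prob_le[OF finite_actions(2) _ pred_occ])
      show "AE \<omega> in R.PM. \<forall>c\<in>actions Q. occurs ?N 0 D c \<omega> \<longrightarrow> D = blk (initial M)"
        using valid
      proof eventually_elim
        case (elim \<omega>)
        have "D = blk (initial M)" if "occurs ?N 0 D c \<omega>" for c
        proof -
          have "initial M \<in> D" using start[OF elim that] by simp
          moreover have "D \<in> \<D>" using that by (simp add: occurs_def)
          ultimately show ?thesis using block_of_eq by metis
        qed
        then show ?case by blast
      qed
    qed (use occurs_inj in auto)
    also have "\<dots> \<le> of_bool (D = blk (initial M))" by simp
    finally show ?thesis .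
  qed
  have step: "(\<Sum>c\<in>actions Q. x (Suc n) D' c) \<le>
       (\<Sum>(D, a)\<in>\<D> \<times> actions M. x n D (Orig a) * spmf (succ_spmf Q (Block D) (Orig a)) (Block D'))"
    if D': "Block D' \<in> Y" for n D'
  proof -
    have D'\<D>: "D' \<in> \<D>" using D' by (auto simp: Y)
    let ?C = "{Some (s, b) | s b. s \<in> D'} :: ('s \<times> 'a) option set"
    \<comment> \<open>\<open>G D a t\<close> places \<open>t\<close> directly after the leaving
      action. It thus depends on the first \<open>t\<close> outcomes, and the landing state is the
      outcome at \<open>t\<close> itself.\<close>
    define G where "G D a t \<omega> \<longleftrightarrow> 0 < t \<and> (\<exists>s. leaves M D s a \<and> \<omega> (t - 1) = Some (s, a)) \<and> epoch (t - 1) \<omega> = n"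
      for D a t and \<omega> :: "nat \<Rightarrow> ('s \<times> 'a) option"
    have pdG: "prefix_det t (G D a t)" for D a t
    proof (cases t)
      case (Suc u)
      have "prefix_det t (\<lambda>\<omega>. epoch u \<omega> = n)"
        by (rule prefix_det_mono[OF prefix_det_comp[OF prefix_det_count_before]]) (simp add: Suc)
      moreover have "prefix_det t (\<lambda>\<omega>. \<exists>s. leaves M D s a \<and> \<omega> u = Some (s, a))"
        using prefix_det_component[of u t "\<lambda>y. \<exists>s. leaves M D s a \<and> y = Some (s, a)"] Suc by simp
      moreover have "G D a t = (\<lambda>\<omega>. (\<exists>s. leaves M D s a \<and> \<omega> u = Some (s, a)) \<and> epoch u \<omega> = n)"
        by (simp add: G_def Suc fun_eq_iff)
      ultimately show ?thesis by (simp only: prefix_det_conj)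
    qed (simp add: G_def prefix_det_def)
    let ?B = "\<lambda>(D, a) \<omega>. \<exists>t. G D a t \<omega> \<and> \<omega> t \<in> ?C"
    have predB: "Measurable.pred R.PM (?B p)" for p
      unfolding case_prod_unfold
      by (intro pred_intros_countable pred_intros_logic R.pred_prefix_det[OF pdG] R.pred_mem)
    have finX: "finite (\<D> \<times> actions M)" using finite_\<D> finite_actions by simp
    have predR: "Measurable.pred R.PM (\<lambda>\<omega>. \<exists>p\<in>\<D> \<times> actions M. ?B p \<omega>)"
      by (intro pred_intros_finite(4) finX predB)
    have "(\<Sum>c\<in>actions Q. x (Suc n) D' c) \<le> R.prob {\<omega> \<in> space R.PM. \<exists>p\<in>\<D> \<times> actions M. ?B p \<omega>}"
      unfolding x_def
    proof (rule R.sum_prob_le[OF finite_actions(2) predR pred_occ])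
      show "AE \<omega> in R.PM. \<forall>c\<in>actions Q. occurs ?N (Suc n) D' c \<omega> \<longrightarrow> (\<exists>p\<in>\<D> \<times> actions M. ?B p \<omega>)"
        using valid
      proof eventually_elim
        case (elim \<omega>)
        have "\<exists>p\<in>\<D> \<times> actions M. ?B p \<omega>" if "occurs ?N (Suc n) D' c \<omega>" for c
        proof -
          from start[OF elim that] obtain t s b s' b' where
            t: "\<omega> t = Some (s, b)" "leave (s, b)" "epoch t \<omega> = n" "\<omega> (Suc t) = Some (s', b')" "s' \<in> D'" by auto
          have e: "(s, b) \<in> enabled_pairs M" using out elim t(1) by blast
          have "(blk s, b) \<in> \<D> \<times> actions M"
            using enabled_pairs_states[OF subM e] block_of_in(1) by auto
          moreover have "?B (blk s, b) \<omega>"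
            using t by (auto simp: G_def leave_def intro!: exI[of _ "Suc t"])
          ultimately show ?thesis by blast
        qed
        then show ?case by blast
      qed
    qed (use occurs_inj in auto)
    also have "\<dots> \<le> (\<Sum>p\<in>\<D> \<times> actions M. R.prob {\<omega> \<in> space R.PM. ?B p \<omega>})"
      by (rule R.prob_le_sum[OF finX predR predB]) auto
    also have "\<dots> \<le> (\<Sum>(D, a)\<in>\<D> \<times> actions M. x n D (Orig a) * spmf (succ_spmf Q (Block D) (Orig a)) (Block D'))"
    proof (rule sum_mono, clarify)
      fix D a assume D: "D \<in> \<D>"
      have "R.prob {\<omega> \<in> space R.PM. \<exists>t. G D a t \<omega> \<and> \<omega> t \<in> ?C}
          \<le> R.prob {\<omega> \<in> space R.PM. \<exists>t. G D a t \<omega>} * spmf (succ_spmf Q (Block D) (Orig a)) (Block D')"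
      proof (rule R.prob_stopped_le[OF pdG])
        fix \<omega> t t' assume "G D a t \<omega>" "G D a t' \<omega>"
        then obtain s s' where g: "0 < t" "0 < t'" "leaves M D s a" "\<omega> (t - 1) = Some (s, a)"
          "leaves M D s' a" "\<omega> (t' - 1) = Some (s', a)" "epoch (t - 1) \<omega> = epoch (t' - 1) \<omega>"
          by (auto simp: G_def)
        have "t - 1 = t' - 1"
          using leaves_imp_leave[OF D g(3)] leaves_imp_leave[OF D g(5)] g
          by (intro count_before_inj[of leave \<omega> "t - 1" "t' - 1", OF _ _ g(7)]) simp_all
        with g(1,2) show "t = t'" by simp
      next
        fix \<omega> t assume "G D a t \<omega>"
        then obtain u s where t: "t = Suc u" "leaves M D s a" "\<omega> u = Some (s, a)" by (cases t) (auto simp: G_def)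
        \<comment> \<open>Restriction to \<open>T\<close> can only remove mass.\<close>
        have "measure (measure_spmf (next_state ?N t \<omega>)) D' \<le> measure (measure_spmf (succ_spmf M s a)) D'"
          using t by (auto simp: next_state_Suc succ_subsystem measure_spmf.finite_measure_mono)
        also have "\<dots> = spmf (succ_spmf Q (Block D) (Orig a)) (Block D')"
          by (rule spmf_succ_Q[OF D t(2) D'\<D>, symmetric])
        finally show "measure_pmf.prob (R.K t \<omega>) ?C \<le> spmf (succ_spmf Q (Block D) (Orig a)) (Block D')"
          using step_in_state_le[of ?N \<sigma> t \<omega> D'] by linarith
      qed simp
      also have "R.prob {\<omega> \<in> space R.PM. \<exists>t. G D a t \<omega>} = x n D (Orig a)"
      proof -
        have "(\<exists>t. G D a t \<omega>) \<longleftrightarrow> occurs ?N n D (Orig a) \<omega>" for \<omega>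
        proof
          assume "\<exists>t. G D a t \<omega>" then show "occurs ?N n D (Orig a) \<omega>" using D by (auto simp: G_def occurs_def)
        next
          assume "occurs ?N n D (Orig a) \<omega>"
          then obtain t s where "leaves M D s a" "\<omega> t = Some (s, a)" "epoch t \<omega> = n" by (auto simp: occurs_def)
          then have "G D a (Suc t) \<omega>" by (auto simp: G_def)
          then show "\<exists>t. G D a t \<omega>" by blast
        qed
        then show ?thesis by (simp add: x_def)
      qed
      finally show "R.prob {\<omega> \<in> space R.PM. \<exists>t. G D a t \<omega> \<and> \<omega> t \<in> ?C}
        \<le> x n D (Orig a) * spmf (succ_spmf Q (Block D) (Orig a)) (Block D')" .
    qed
    finally show ?thesis .
  qed
  have "flow Y x"
    unfolding flow_def using x_supp init step by (auto simp: x_def)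
  moreover have "ennreal (path_prob ?N \<sigma> (rabin (P i))) \<le> value_of i x" if i: "i \<in> {1..k}" for i
  proof -
    let ?R = "\<lambda>\<omega> :: nat \<Rightarrow> ('s \<times> 'a) option. (\<forall>n. \<omega> n \<noteq> None) \<and> (\<lambda>n. fst (the (\<omega> n))) \<in> rabin (P i)"
    let ?F = "\<D> \<times> {I. I \<subseteq> {1..k} \<and> i \<in> I}"
    let ?B = "\<lambda>n (D, I). occurs ?N n D (Tau I)"
    have "ennreal (path_prob ?N \<sigma> (rabin (P i))) = emeasure R.PM {\<omega> \<in> space R.PM. ?R \<omega>}"
      by (simp add: path_prob_def R.emeasure_eq_measure)
    also have "\<dots> \<le> (\<Sum>n. \<Sum>p\<in>?F. emeasure R.PM {\<omega> \<in> space R.PM. ?B n p \<omega>})"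
    proof (rule R.emeasure_le_suminf_sum[OF finite_index])
      show "Measurable.pred R.PM ?R"
        by (intro pred_intros_logic R.pred_alive R.pred_rabin fin i)
      fix n p show "Measurable.pred R.PM (?B n p)" unfolding case_prod_unfold by (rule pred_occ)
    next
      show "AE \<omega> in R.PM. ?R \<omega> \<longrightarrow> (\<exists>n. \<exists>p\<in>?F. ?B n p \<omega>)"
        using valid R.AE_limit_closed[OF refl]
      proof eventually_elim
        case (elim \<omega>)
        show ?case
        proof
          assume \<omega>: "?R \<omega>"
          let ?L = "limit_pairs ?N \<omega>"
          have o: "\<omega> t \<in> Some ` enabled_pairs ?N" for t
          proof -
            from \<omega> have "\<omega> t \<noteq> None" by blast
            then obtain p where "\<omega> t = Some p" by blast
            with R.outcomes_Some[of \<omega> t p] elim(1) show ?thesis by simp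
          qed
          have L: "end_component M ?L"
            using limit_end_component[OF subM _ o elim(2)] elim(1) by blast
          note cof = limit_pairs_cofinal[of ?N \<omega>, OF R.finite_enabled_pairs o]
          from ex_mec[OF subM L] obtain E where E: "mec M E" "?L \<subseteq> E" by auto
          from \<omega> obtain F A where FA: "(F, A) \<in> P i" "\<exists>\<^sub>\<infinity>n. fst (the (\<omega> n)) \<in> F"
            "\<forall>\<^sub>\<infinity>n. fst (the (\<omega> n)) \<in> A" by (auto simp: rabin_def)
          have "\<exists>\<^sub>\<infinity>n. fst (the (\<omega> n)) \<in> F \<and> \<omega> n \<in> Some ` ?L"
            using FA(2) cof(1) by (rule INFM_conjI)
          from INFM_EX[OF this] obtain n where n: "fst (the (\<omega> n)) \<in> F" "\<omega> n \<in> Some ` ?L" by blast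
          have "ec_states ?L \<subseteq> A"
          proof clarify
            fix s a assume "(s, a) \<in> ?L"
            then have "\<exists>\<^sub>\<infinity>t. \<omega> t = Some (s, a)" by (simp add: limit_pairs_def)
            from INFM_EX[OF INFM_conjI[OF this FA(3)]] obtain t where
              "\<omega> t = Some (s, a)" "fst (the (\<omega> t)) \<in> A" by blast
            then show "fst (s, a) \<in> A" by simp
          qed
          moreover have "ec_states ?L \<inter> F \<noteq> {}" using n by force
          ultimately have rab: "ec_rabin ?L (P i)" unfolding ec_rabin_def
            by (intro bexI[OF _ FA(1)]) simp
          \<comment> \<open>All satisfied indices are collected, not just \<open>i\<close>. The
            limit set then has exactly one type, and the same decision serves every property at
            once.\<close>
          define I where "I = {i \<in> {1..k}. ec_rabin ?L (P i)}"
          have lt: "?L \<in> limit_type (ec_states E) I" using L E by (auto simp: limit_type_def I_def)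
          from cof(1) obtain t0 where t0: "\<And>t. t \<ge> t0 \<Longrightarrow> \<omega> t \<in> Some ` ?L" by (auto simp: MOST_nat_le)
          have "\<not> leave (the (\<omega> t))" if "t0 \<le> t" for t
            using t0[OF that] E mec_not_leave by auto
          from count_before_const[of t0 leave \<omega>, OF this] have "\<forall>t\<ge>t0. epoch t \<omega> = epoch t0 \<omega>" by blast
          with lt \<omega> mec_partition_mec[OF E(1)] have "occurs ?N (epoch t0 \<omega>) (ec_states E) (Tau I) \<omega>"
            unfolding occurs_def qaction.case by blast
          moreover have "(ec_states E, I) \<in> ?F"
            using rab i mec_partition_mec[OF E(1)] by (auto simp: I_def)
          ultimately show "\<exists>n. \<exists>p\<in>?F. ?B n p \<omega>" by blast
        qed
      qed
    qed
    also have "\<dots> = value_of i x"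
      unfolding value_of_def x_def by (simp add: R.emeasure_eq_measure case_prod_unfold)
    finally show ?thesis .
  qed
  ultimately show ?thesis by blast
qed

end

section \<open>Schedulers with memory\<close>

text \<open>A scheduler with memory is a scheduler of an MDP whose actions also record the memory
  content.\<close>

definition memory_mdp :: "('s, 'a) smdp \<Rightarrow> 'm set \<Rightarrow> ('s, 'a \<times> 'm) smdp" where
  "memory_mdp N C = \<lparr>states = states N, actions = actions N \<times> C, initial = initial N,
     kernel = (\<lambda>s (a, c). if c \<in> C then kernel N s a else None)\<rparr>"

definition forget :: "('s \<times> 'a \<times> 'm) option \<Rightarrow> ('s \<times> 'a) option" where
  "forget = map_option (\<lambda>(s, a, c). (s, a))"

lemma forget_simps [simp]:
  "forget None = None" "forget (Some (s, a, c)) = Some (s, a)"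
  "forget x = None \<longleftrightarrow> x = None" "forget x = Some (s, a) \<longleftrightarrow> (\<exists>c. x = Some (s, a, c))"
  by (auto simp: forget_def)

lemma memory_mdp_simps [simp]:
  "states (memory_mdp N C) = states N" "initial (memory_mdp N C) = initial N"
  "actions (memory_mdp N C) = actions N \<times> C"
  by (simp_all add: memory_mdp_def)

lemma enabled_pairs_memory: "(s, a, c) \<in> enabled_pairs (memory_mdp N C) \<longleftrightarrow> (s, a) \<in> enabled_pairs N \<and> c \<in> C"
  by (auto simp: enabled_pairs_def memory_mdp_def)

lemma enabled_memory: "enabled (memory_mdp N C) s = enabled N s \<times> C"
  by (auto simp: enabled_iff enabled_pairs_memory)

lemma succ_memory: "c \<in> C \<Longrightarrow> succ_spmf (memory_mdp N C) s (a, c) = succ_spmf N s a"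
  by (simp add: succ_spmf_def memory_mdp_def)

lemma substochastic_memory:
  assumes "substochastic_mdp N" "finite C"
  shows "substochastic_mdp (memory_mdp N C)"
  unfolding substochastic_mdp_def
proof (intro conjI ballI)
  fix p assume "p \<in> enabled_pairs (memory_mdp N C)"
  then show "case p of (s, a) \<Rightarrow> set_spmf (succ_spmf (memory_mdp N C) s a) \<subseteq> states (memory_mdp N C)"
    using mdp_succ_states[OF assms(1)] by (cases p) (auto simp: enabled_pairs_memory succ_memory)
qed (use assms in \<open>auto simp: substochastic_mdp_def enabled_pairs_memory\<close>)

lemma step_state_prob:
  assumes "enabled M s \<noteq> {}"
  shows "measure_pmf.prob (step_spmf M \<sigma> n \<omega>) {Some (s, a) | a. True} = spmf (next_state M n \<omega>) s"
proof (rule antisym)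
  show "measure_pmf.prob (step_spmf M \<sigma> n \<omega>) {Some (s, a) | a. True} \<le> spmf (next_state M n \<omega>) s"
    using step_in_state_le[of M \<sigma> n \<omega> "{s}"] by (simp add: spmf_conv_measure_spmf)
  let ?h = "map (the \<circ> \<omega>) [0..<n]"
  let ?f = "\<lambda>x. case x of None \<Rightarrow> return_pmf None | Some s \<Rightarrow> act_spmf M \<sigma> ?h s"
  have "set_pmf (?f (Some s)) \<subseteq> {Some (s, a) | a. True}" using assms by (auto simp: act_spmf_ne)
  then have "measure_pmf.prob (?f (Some s)) {Some (s, a) | a. True} = 1"
    by (subst measure_pmf.prob_eq_1) (auto simp: AE_measure_pmf_iff)
  with pmf_mult_prob_le_prob_bind[of "next_state M n \<omega>" "Some s" ?f "{Some (s, a) | a. True}"]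
  show "spmf (next_state M n \<omega>) s \<le> measure_pmf.prob (step_spmf M \<sigma> n \<omega>) {Some (s, a) | a. True}"
    by (simp add: step_spmf_eq)
qed

definition agrees :: "'x list \<Rightarrow> (nat \<Rightarrow> 'x) \<Rightarrow> bool" where
  "agrees l \<omega> \<longleftrightarrow> (\<forall>i<length l. \<omega> i = l ! i)"

lemma agrees_Nil [simp]: "agrees [] \<omega>"
  by (simp add: agrees_def)

lemma agrees_snoc: "agrees (l @ [y]) \<omega> \<longleftrightarrow> agrees l \<omega> \<and> \<omega> (length l) = y"
  by (auto simp: agrees_def nth_append less_Suc_eq)

lemma agrees_unique: "agrees l \<omega> \<Longrightarrow> agrees l' \<omega> \<Longrightarrow> length l = length l' \<Longrightarrow> l = l'"
  by (auto simp: agrees_def intro: nth_equalityI)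

lemma agrees_map_upt: "agrees (map \<omega> [0..<n]) \<omega>"
  by (simp add: agrees_def)

context prob_space
begin

text \<open>The map \<open>f\<close> lets one decomposition into cylinders serve both a run and its
  image after the memory has been forgotten.\<close>

lemma prob_prefix_det_eq_sum:
  assumes A: "finite A" and f: "\<And>\<omega> i. \<omega> \<in> space M \<Longrightarrow> f \<omega> i \<in> A"
    and meas: "\<And>l. Measurable.pred M (\<lambda>\<omega>. agrees l (f \<omega>))"
    and B: "prefix_det n B" "Measurable.pred M (\<lambda>\<omega>. B (f \<omega>))"
  shows "prob {\<omega> \<in> space M. B (f \<omega>)} =
    (\<Sum>l\<in>{l. set l \<subseteq> A \<and> length l = n \<and> B (\<lambda>i. l ! i)}. prob {\<omega> \<in> space M. agrees l (f \<omega>)})"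
proof (rule antisym)
  let ?L = "{l. set l \<subseteq> A \<and> length l = n \<and> B (\<lambda>i. l ! i)}"
  have fin: "finite ?L"
    by (rule finite_subset[OF _ finite_lists_length_eq[OF A, of n]]) auto
  have B_iff: "B (f \<omega>) = B (\<lambda>i. l ! i)" if "agrees l (f \<omega>)" "length l = n" for l \<omega>
    using that by (intro prefix_detD[OF B(1)]) (auto simp: agrees_def)
  show "prob {\<omega> \<in> space M. B (f \<omega>)} \<le> (\<Sum>l\<in>?L. prob {\<omega> \<in> space M. agrees l (f \<omega>)})"
  proof (rule prob_le_sum[OF fin B(2) meas], rule AE_I2, rule impI)
    fix \<omega> assume sp: "\<omega> \<in> space M" and Bf: "B (f \<omega>)"
    have "map (f \<omega>) [0..<n] \<in> ?L"
      using f[OF sp] Bf B_iff[OF agrees_map_upt[of "f \<omega>" n]] by auto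
    then show "\<exists>l\<in>?L. agrees l (f \<omega>)" using agrees_map_upt by blast
  qed
  show "(\<Sum>l\<in>?L. prob {\<omega> \<in> space M. agrees l (f \<omega>)}) \<le> prob {\<omega> \<in> space M. B (f \<omega>)}"
    using B_iff by (intro sum_prob_le[OF fin B(2) meas]) (auto dest: agrees_unique)
qed

end

lemma prefix_det_agrees: "prefix_det (length l) (agrees l)"
  by (auto simp: prefix_det_def agrees_def)

lemma (in mdp_run) prob_agrees_snoc:
  "prob {\<omega> \<in> space PM. agrees (l @ [y]) \<omega>} =
    prob {\<omega> \<in> space PM. agrees l \<omega>} * pmf (K (length l) (\<lambda>i. l ! i)) y"
proof -
  have eq: "{\<omega> \<in> space PM. agrees (l @ [y]) \<omega>} = {\<omega> \<in> space PM. agrees l \<omega> \<and> \<omega> (length l) \<in> {y}}"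
    by (auto simp: agrees_snoc)
  have K: "measure_pmf.prob (K (length l) \<omega>) {y} = pmf (K (length l) (\<lambda>i. l ! i)) y" if "agrees l \<omega>" for \<omega>
  proof -
    have "K (length l) \<omega> = K (length l) (\<lambda>i. l ! i)"
      using that by (intro step_spmf_cong) (simp add: agrees_def)
    then show ?thesis by (simp add: measure_pmf_single)
  qed
  show ?thesis unfolding eq
    using K by (intro antisym prob_step_le prob_step_ge prefix_det_agrees) auto
qed

section \<open>Removal of the memory by conditional distributions\<close>

locale memory_run =
  fixes N :: "('s, 'a) smdp" and C :: "'m set" and \<tau> :: "('s, 'a \<times> 'm) sched"
  assumes subN: "substochastic_mdp N" and C: "finite C" "C \<noteq> {}" and \<tau>: "scheduler (memory_mdp N C) \<tau>"
begin

sublocale R: mdp_run "memory_mdp N C" \<tau>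
  using substochastic_memory[OF subN C(1)] \<tau> by unfold_locales

abbreviation "outN \<equiv> insert None (Some ` enabled_pairs N)"

definition forgets :: "(nat \<Rightarrow> ('s \<times> 'a \<times> 'm) option) \<Rightarrow> nat \<Rightarrow> ('s \<times> 'a) option" where
  "forgets \<omega> n = forget (\<omega> n)"

definition cyl :: "('s \<times> 'a) option list \<Rightarrow> real" where
  "cyl l = R.prob {\<omega> \<in> space R.PM. agrees l (forgets \<omega>)}"

definition induced_weight :: "('s \<times> 'a) list \<Rightarrow> 's \<Rightarrow> 'a \<Rightarrow> real" where
  "induced_weight h s a = (if a \<in> enabled N s then cyl (map Some h @ [Some (s, a)]) else 0)"

definition is_induced :: "('s \<times> 'a) list \<Rightarrow> 's \<Rightarrow> 'a pmf \<Rightarrow> bool" where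
  "is_induced h s p \<longleftrightarrow>
    (\<forall>a. induced_weight h s a = (\<Sum>a\<in>enabled N s. induced_weight h s a) * pmf p a) \<and>
    (enabled N s \<noteq> {} \<longrightarrow> set_pmf p \<subseteq> enabled N s)"

text \<open>The conditional distribution of the next action given the visible history; if that history
  has probability 0, any distribution on the enabled actions.\<close>

definition induced :: "('s, 'a) sched" where
  "induced h s = (SOME p. is_induced h s p)"

lemma finite_enabled: "finite (enabled N s)"
  by (rule finite_subset[of _ "snd ` enabled_pairs N"])
    (use finite_enabled_pairs[OF subN] in \<open>auto simp: enabled_iff intro: rev_image_eqI\<close>)

lemma finite_outN: "finite outN"
  using finite_enabled_pairs[OF subN] by simp

lemma induced_weight_nonneg: "0 \<le> induced_weight h s a"
  by (simp add: induced_weight_def cyl_def)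

lemma induced_weight_out: "a \<notin> enabled N s \<Longrightarrow> induced_weight h s a = 0"
  by (simp add: induced_weight_def)

lemma induced: "is_induced h s (induced h s)"
  unfolding induced_def
proof (rule someI_ex)
  let ?f = "induced_weight h s"
  obtain p where p: "\<forall>a. ?f a = sum ?f (enabled N s) * pmf p a"
    "sum ?f (enabled N s) \<noteq> 0 \<longrightarrow> set_pmf p \<subseteq> {a. ?f a \<noteq> 0}"
    using ex_normalized_pmf[where f="induced_weight h s" and C="enabled N s",
        OF finite_enabled induced_weight_nonneg induced_weight_out] by blast
  show "\<exists>p. is_induced h s p"
  proof (cases "sum ?f (enabled N s) = 0 \<and> enabled N s \<noteq> {}")
    case True
    then obtain a where "a \<in> enabled N s" by auto
    moreover have "?f a = 0" for a using p(1) True by simp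
    ultimately have "is_induced h s (return_pmf a)" by (simp add: is_induced_def)
    then show ?thesis by blast
  next
    case False
    then have "is_induced h s p" using p by (auto simp: is_induced_def induced_weight_def split: if_splits)
    then show ?thesis by blast
  qed
qed

lemma scheduler_induced: "scheduler N induced"
  unfolding scheduler_def using induced by (auto simp: is_induced_def)

sublocale S: mdp_run N induced
  using subN scheduler_induced by unfold_locales

lemma forgets_outN: "\<omega> \<in> space R.PM \<Longrightarrow> forgets \<omega> n \<in> outN"
  by (cases "\<omega> n") (auto simp: forgets_def enabled_pairs_memory dest: R.outcomes_Some)

lemma prefix_det_forgets: "prefix_det n B \<Longrightarrow> prefix_det n (\<lambda>\<omega>. B (forgets \<omega>))"
  unfolding prefix_det_def forgets_def by simp

lemma pred_agrees: "Measurable.pred R.PM (\<lambda>\<omega>. agrees l (forgets \<omega>))"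
  by (rule R.pred_prefix_det[OF prefix_det_forgets[OF prefix_det_agrees]])

lemma next_state_forgets:
  assumes "\<forall>i<n. \<omega> i \<in> R.outcomes" "agrees l (forgets \<omega>)" "length l = n"
  shows "next_state (memory_mdp N C) n \<omega> = next_state N n (\<lambda>i. l ! i)"
proof (cases n)
  case (Suc m)
  then have "\<omega> m \<in> R.outcomes" "l ! m = forget (\<omega> m)" using assms by (auto simp: agrees_def forgets_def)
  then show ?thesis by (auto simp: Suc next_state_Suc enabled_pairs_memory succ_memory)
qed (simp add: next_state_0)

lemma cyl_snoc_le: "cyl (l @ [y]) \<le> cyl l"
  unfolding cyl_def using pred_agrees
  by (intro R.finite_measure_mono) (auto simp: agrees_snoc pred_def)

lemma cyl_None:
  assumes "cyl l \<noteq> 0" "j < length l" "l ! j = None" "j \<le> j'" "j' < length l"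
  shows "l ! j' = None"
proof (rule ccontr)
  assume n: "l ! j' \<noteq> None"
  have "AE \<omega> in R.PM. \<not> agrees l (forgets \<omega>)"
    using R.AE_in_set_pmf
  proof eventually_elim
    case (elim \<omega>)
    show ?case
    proof
      assume "agrees l (forgets \<omega>)"
      then have "l ! j = forget (\<omega> j)" "l ! j' = forget (\<omega> j')" using assms by (auto simp: agrees_def forgets_def)
      with n assms(3) path_None[OF elim _ assms(4)] show False by simp
    qed
  qed
  then have "cyl l = 0" unfolding cyl_def by (rule R.prob_eq_0_AE)
  with assms(1) show False by simp
qed

text \<open>The normalising constant factorises because transitions do not depend on the memory:
  given the visible history, the next state has the same law whatever the hidden memory contents
  are.\<close>

lemma sum_induced_weight:
  assumes ne: "enabled N s \<noteq> {}" and l: "l = map Some h"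
  shows "(\<Sum>a\<in>enabled N s. induced_weight h s a) = cyl l * spmf (next_state N (length l) (\<lambda>i. l ! i)) s"
proof -
  let ?n = "length l" and ?B = "\<lambda>\<omega>. agrees l (forgets \<omega>)"
  let ?C = "{Some (s, x) | x. True} :: ('s \<times> 'a \<times> 'm) option set"
  let ?q = "spmf (next_state N ?n (\<lambda>i. l ! i)) s"
  have pd: "prefix_det ?n ?B" by (rule prefix_det_forgets[OF prefix_det_agrees])
  have K: "measure_pmf.prob (R.K ?n \<omega>) ?C = ?q" if "\<forall>i<?n. \<omega> i \<in> R.outcomes" "?B \<omega>" for \<omega>
    using ne C next_state_forgets[OF that refl] by (subst step_state_prob) (auto simp: enabled_memory)
  have "R.prob {\<omega> \<in> space R.PM. ?B \<omega> \<and> \<omega> ?n \<in> ?C} = R.prob {\<omega> \<in> space R.PM. ?B \<omega>} * ?q"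
    using K by (intro antisym R.prob_step_le R.prob_step_ge pd) auto
  moreover have "(\<Sum>a\<in>enabled N s. induced_weight h s a) = R.prob {\<omega> \<in> space R.PM. ?B \<omega> \<and> \<omega> ?n \<in> ?C}"
  proof -
    have pC: "Measurable.pred R.PM (\<lambda>\<omega>. ?B \<omega> \<and> \<omega> ?n \<in> ?C)"
      by (intro pred_intros_logic pred_agrees R.pred_mem)
    have "(\<Sum>a\<in>enabled N s. induced_weight h s a) =
        (\<Sum>a\<in>enabled N s. R.prob {\<omega> \<in> space R.PM. agrees (l @ [Some (s, a)]) (forgets \<omega>)})"
      by (simp add: induced_weight_def cyl_def l)
    also have "\<dots> = R.prob {\<omega> \<in> space R.PM. ?B \<omega> \<and> \<omega> ?n \<in> ?C}"
    proof (rule antisym)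
      show "(\<Sum>a\<in>enabled N s. R.prob {\<omega> \<in> space R.PM. agrees (l @ [Some (s, a)]) (forgets \<omega>)}) \<le> R.prob {\<omega> \<in> space R.PM. ?B \<omega> \<and> \<omega> ?n \<in> ?C}"
        by (rule R.sum_prob_le[OF finite_enabled pC pred_agrees]) (auto simp: agrees_snoc forgets_def)
      show "R.prob {\<omega> \<in> space R.PM. ?B \<omega> \<and> \<omega> ?n \<in> ?C} \<le> (\<Sum>a\<in>enabled N s. R.prob {\<omega> \<in> space R.PM. agrees (l @ [Some (s, a)]) (forgets \<omega>)})"
      proof (rule R.prob_le_sum[OF finite_enabled pC pred_agrees], rule AE_I2, rule impI)
        fix \<omega> assume sp: "\<omega> \<in> space R.PM" and "?B \<omega> \<and> \<omega> ?n \<in> ?C"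
        then obtain a c where \<omega>: "?B \<omega>" "\<omega> ?n = Some (s, a, c)" by auto
        from R.outcomes_Some[OF sp \<omega>(2)] have "a \<in> enabled N s" by (simp add: enabled_pairs_memory enabled_iff)
        then show "\<exists>a\<in>enabled N s. agrees (l @ [Some (s, a)]) (forgets \<omega>)"
          using \<omega> by (auto simp: agrees_snoc forgets_def)
      qed
    qed
    finally show ?thesis .
  qed
  ultimately show ?thesis by (simp add: cyl_def)
qed

text \<open>The heart of Kuhn's argument: joint weight equals normalising constant times conditional
  probability, so the visible cylinders obey the recursion of a run under
  \<open>induced\<close>.\<close>

lemma cyl_Some:
  assumes "cyl l \<noteq> 0"
  shows "cyl (l @ [Some (s, a)]) = cyl l * pmf (S.K (length l) (\<lambda>i. l ! i)) (Some (s, a))"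
proof (cases "(s, a) \<in> enabled_pairs N \<and> None \<notin> set l")
  case True
  define h where "h = map the l"
  have l: "l = map Some h" using True by (auto simp: h_def intro!: nth_equalityI) (metis nth_mem option.collapse)
  have h: "map (the \<circ> (\<lambda>i. l ! i)) [0..<length l] = h" by (auto simp: h_def intro: nth_equalityI)
  have ne: "enabled N s \<noteq> {}" "a \<in> enabled N s" using True by (auto simp: enabled_iff)
  have "cyl (l @ [Some (s, a)]) = induced_weight h s a" using ne by (simp add: induced_weight_def l)
  also have "\<dots> = cyl l * spmf (next_state N (length l) (\<lambda>i. l ! i)) s * pmf (induced h s) a"
    using induced[of h s] sum_induced_weight[OF ne(1) l] by (simp add: is_induced_def)
  finally show ?thesis using ne by (simp add: pmf_step_Some h)
next
  \<comment> \<open>Both sides vanish here: either the pair is not enabled, or the history already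
    contains \<open>None\<close> and the run cannot resume.\<close>
  case False
  have "cyl (l @ [Some (s, a)]) = 0"
  proof (cases "(s, a) \<in> enabled_pairs N")
    case True
    with False obtain j where j: "j < length l" "l ! j = None" by (metis in_set_conv_nth)
    show ?thesis
    proof (rule ccontr)
      assume "cyl (l @ [Some (s, a)]) \<noteq> 0"
      from cyl_None[OF this, of j "length l"] j show False by (auto simp: nth_append)
    qed
  next
    case False
    have "{\<omega> \<in> space R.PM. agrees (l @ [Some (s, a)]) (forgets \<omega>)} = {}"
    proof -
      have "forgets \<omega> (length l) \<noteq> Some (s, a)" if "\<omega> \<in> space R.PM" for \<omega>
        using forgets_outN[OF that, of "length l"] False by auto
      then show ?thesis by (auto simp: agrees_snoc)
    qed
    then show ?thesis by (simp only: cyl_def measure_empty)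
  qed
  moreover have "pmf (S.K (length l) (\<lambda>i. l ! i)) (Some (s, a)) = 0"
  proof (cases "(s, a) \<in> enabled_pairs N")
    case True
    with False obtain j where j: "j < length l" "l ! j = None" by (metis in_set_conv_nth)
    with cyl_None[OF assms j, of "length l - 1"] have "length l \<noteq> 0" "l ! (length l - 1) = None" by auto
    then show ?thesis by (simp add: pmf_step_Some next_state_def)
  next
    case False
    then have "a \<notin> enabled N s" by (simp add: enabled_iff)
    then have "enabled N s = {} \<or> a \<notin> set_pmf (induced h s)" for h
      using induced[of h s] by (auto simp: is_induced_def)
    then show ?thesis by (auto simp: pmf_step_Some pmf_eq_0_set_pmf)
  qed
  ultimately show ?thesis by simp
qed

lemma cyl_snoc:
  assumes l: "set l \<subseteq> outN" and y: "y \<in> outN"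
  shows "cyl (l @ [y]) = cyl l * pmf (S.K (length l) (\<lambda>i. l ! i)) y"
proof (cases "cyl l = 0")
  case True
  moreover have "0 \<le> cyl (l @ [y])" by (simp add: cyl_def)
  ultimately show ?thesis using cyl_snoc_le[of l y] by simp
next
  case False
  let ?p = "S.K (length l) (\<lambda>i. l ! i)"
  show ?thesis
  proof (cases y)
    case (Some p)
    then show ?thesis using cyl_Some[OF False] by (cases p) simp
  next
    case None
    \<comment> \<open>The cylinders over all outcomes add up to \<open>cyl l\<close> and the step
      law has total mass 1. The equation for \<open>None\<close> follows by subtracting the
      equations for all pairs.\<close>
    have "(\<Sum>y\<in>outN. cyl (l @ [y])) = cyl l"
    proof (rule antisym)
      show "(\<Sum>y\<in>outN. cyl (l @ [y])) \<le> cyl l"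
        unfolding cyl_def by (rule R.sum_prob_le[OF finite_outN pred_agrees pred_agrees]) (auto simp: agrees_snoc)
      show "cyl l \<le> (\<Sum>y\<in>outN. cyl (l @ [y]))"
        unfolding cyl_def using forgets_outN
        by (intro R.prob_le_sum[OF finite_outN pred_agrees pred_agrees] AE_I2) (auto simp: agrees_snoc)
    qed
    moreover have "(\<Sum>y\<in>outN. pmf ?p y) = 1"
      using l by (intro sum_pmf_eq_1 finite_outN S.set_pmf_K) (auto simp: subset_iff)
    moreover have "(\<Sum>y\<in>outN. f y) = f None + (\<Sum>y\<in>Some ` enabled_pairs N. f y)" for f :: "_ \<Rightarrow> real"
      using finite_enabled_pairs[OF subN] by (subst sum.insert) auto
    moreover have "(\<Sum>y\<in>Some ` enabled_pairs N. cyl (l @ [y])) = cyl l * (\<Sum>y\<in>Some ` enabled_pairs N. pmf ?p y)"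
      using cyl_Some[OF False] by (auto simp: sum_distrib_left intro!: sum.cong)
    moreover define z where "z = (\<Sum>y\<in>Some ` enabled_pairs N. pmf ?p y)"
    ultimately have "cyl (l @ [None]) + cyl l * z = cyl l" "z = 1 - pmf ?p None" by simp_all
    then show ?thesis by (simp add: None algebra_simps)
  qed
qed

lemma prob_agrees_eq: "set l \<subseteq> outN \<Longrightarrow> S.prob {\<omega> \<in> space S.PM. agrees l \<omega>} = cyl l"
proof (induction l rule: rev_induct)
  case Nil
  then show ?case by (simp add: cyl_def S.prob_space R.prob_space)
next
  case (snoc y l)
  then show ?case using S.prob_agrees_snoc[of l y] cyl_snoc[of l y] by simp
qed

lemma prob_prefix_det_eq:
  assumes "prefix_det n B"
  shows "S.prob {\<omega> \<in> space S.PM. B \<omega>} = R.prob {\<omega> \<in> space R.PM. B (forgets \<omega>)}"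
proof -
  let ?L = "{l. set l \<subseteq> outN \<and> length l = n \<and> B (\<lambda>i. l ! i)}"
  have "S.prob {\<omega> \<in> space S.PM. B \<omega>} = (\<Sum>l\<in>?L. S.prob {\<omega> \<in> space S.PM. agrees l \<omega>})"
    by (rule S.prob_prefix_det_eq_sum[OF finite_outN _ S.pred_prefix_det[OF prefix_det_agrees] assms S.pred_prefix_det[OF assms]])
      (simp add: S.space_PM)
  also have "\<dots> = (\<Sum>l\<in>?L. cyl l)" by (intro sum.cong refl prob_agrees_eq) simp
  also have "\<dots> = R.prob {\<omega> \<in> space R.PM. B (forgets \<omega>)}"
    unfolding cyl_def
    by (rule R.prob_prefix_det_eq_sum[symmetric, OF finite_outN _ pred_agrees assms
        R.pred_prefix_det[OF prefix_det_forgets[OF assms]]])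
      (rule forgets_outN)
  finally show ?thesis .
qed

lemma measurable_forgets: "forgets \<in> R.PM \<rightarrow>\<^sub>M PiM UNIV (\<lambda>_. step_space N)"
proof (rule measurable_PiM_single')
  fix n :: nat
  have "(\<lambda>\<omega>. forget (\<omega> n)) \<in> R.PM \<rightarrow>\<^sub>M count_space outN"
  proof (intro measurable_count_space_eq2[THEN iffD2, OF finite_outN] conjI ballI)
    show "(\<lambda>\<omega>. forget (\<omega> n)) \<in> space R.PM \<rightarrow> outN"
      using forgets_outN by (simp add: forgets_def)
    fix y
    have "(\<lambda>\<omega>. forget (\<omega> n)) -` {y} \<inter> space R.PM = {\<omega> \<in> space R.PM. forget (\<omega> n) = y}" by auto
    then show "(\<lambda>\<omega>. forget (\<omega> n)) -` {y} \<inter> space R.PM \<in> sets R.PM"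
      using R.pred_component[of "\<lambda>x. forget x = y" n] by (simp add: pred_def)
  qed
  then show "(\<lambda>\<omega>. forgets \<omega> n) \<in> R.PM \<rightarrow>\<^sub>M step_space N"
    by (simp add: step_space_def forgets_def)
qed (use forgets_outN in \<open>auto simp: S.space_step_space\<close>)

text \<open>The two measures agree on all events with finitely many constrained coordinates, and
  these determine a finite measure on the product space.\<close>

lemma distr_forgets: "distr R.PM (PiM UNIV (\<lambda>_. step_space N)) forgets = S.PM"
proof (rule measure_eqI_PiM_infinite)
  fix A and J :: "nat set" assume J: "finite J" and A: "\<And>i. i \<in> J \<Longrightarrow> A i \<in> sets (step_space N)"
  let ?X = "prod_emb UNIV (\<lambda>_. step_space N) J (Pi\<^sub>E J A)"
  let ?B = "\<lambda>\<omega>. \<forall>i\<in>J. \<omega> i \<in> A i"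
  obtain n where n: "\<And>i. i \<in> J \<Longrightarrow> i < n" using finite_nat_set_iff_bounded[THEN iffD1, OF J] by blast
  have X: "?X = {\<omega> \<in> space S.PM. ?B \<omega>}"
    by (auto simp: prod_emb_def S.space_PM S.space_step_space PiE_iff)
  have X_sets: "?X \<in> sets (PiM UNIV (\<lambda>_. step_space N))"
    using J A by (intro sets_PiM_I) auto
  have "prefix_det n ?B" using n by (auto simp: prefix_det_def)
  from prob_prefix_det_eq[OF this]
  have "S.prob ?X = R.prob {\<omega> \<in> space R.PM. ?B (forgets \<omega>)}" by (simp add: X)
  also have "{\<omega> \<in> space R.PM. ?B (forgets \<omega>)} = forgets -` ?X \<inter> space R.PM"
    using forgets_outN unfolding X by (auto simp: S.space_PM)
  finally show "emeasure (distr R.PM (PiM UNIV (\<lambda>_. step_space N)) forgets) ?X = emeasure S.PM ?X"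
    by (simp add: emeasure_distr[OF measurable_forgets X_sets] R.emeasure_eq_measure S.emeasure_eq_measure)
next
  show "finite_measure (distr R.PM (PiM UNIV (\<lambda>_. step_space N)) forgets)"
    by (rule R.finite_measure_distr[OF measurable_forgets])
qed (simp_all add: S.sets_PM)

lemma path_prob_induced:
  assumes "Measurable.pred S.PM (\<lambda>\<omega>. (\<lambda>n. fst (the (\<omega> n))) \<in> \<psi>)"
  shows "path_prob N induced \<psi> = path_prob (memory_mdp N C) \<tau> \<psi>"
proof -
  let ?X = "{\<omega> \<in> space S.PM. (\<forall>n. \<omega> n \<noteq> None) \<and> (\<lambda>n. fst (the (\<omega> n))) \<in> \<psi>}"
  have "Measurable.pred S.PM (\<lambda>\<omega>. (\<forall>n. \<omega> n \<noteq> None) \<and> (\<lambda>n. fst (the (\<omega> n))) \<in> \<psi>)"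
    by (intro pred_intros_logic S.pred_alive assms)
  then have X: "?X \<in> sets (PiM UNIV (\<lambda>_. step_space N))" by (simp add: pred_def S.sets_PM)
  have fst_eq: "(\<lambda>n. fst (the (forgets \<omega> n))) = (\<lambda>n. fst (the (\<omega> n)))" if "\<forall>n. \<omega> n \<noteq> None" for \<omega>
  proof
    fix n
    from that obtain p where "\<omega> n = Some p" by blast
    then show "fst (the (forgets \<omega> n)) = fst (the (\<omega> n))" by (cases p) (simp add: forgets_def)
  qed
  have alive: "(\<forall>n. forgets \<omega> n \<noteq> None) \<longleftrightarrow> (\<forall>n. \<omega> n \<noteq> None)" for \<omega> by (simp add: forgets_def)
  have "path_prob N induced \<psi> = measure (distr R.PM (PiM UNIV (\<lambda>_. step_space N)) forgets) ?X"
    unfolding path_prob_def distr_forgets ..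
  also have "\<dots> = R.prob (forgets -` ?X \<inter> space R.PM)"
    by (rule measure_distr[OF measurable_forgets X])
  also have "forgets -` ?X \<inter> space R.PM = {\<omega> \<in> space R.PM. (\<forall>n. \<omega> n \<noteq> None) \<and> (\<lambda>n. fst (the (\<omega> n))) \<in> \<psi>}"
    using forgets_outN alive fst_eq by (auto simp: S.space_PM)
  finally show ?thesis by (simp add: path_prob_def)
qed

end

lemma prob_le_prob_bind:
  assumes "\<And>x. x \<in> D \<Longrightarrow> r \<le> measure_pmf.prob (f x) C" "0 \<le> r"
  shows "measure_pmf.prob p D * r \<le> measure_pmf.prob (bind_pmf p f) C"
proof -
  have "ennreal (measure_pmf.prob p D * r) = (\<integral>\<^sup>+x. ennreal r * indicator D x \<partial>measure_pmf p)"
    using assms(2)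
    by (subst nn_integral_cmult_indicator)
      (simp_all add: measure_pmf.emeasure_eq_measure ennreal_mult' mult.commute)
  also have "\<dots> \<le> (\<integral>\<^sup>+x. emeasure (measure_pmf (f x)) C \<partial>measure_pmf p)"
    using assms(1)
    by (intro nn_integral_mono) (auto split: split_indicator simp: measure_pmf.emeasure_eq_measure intro!: ennreal_leI)
  also have "\<dots> = ennreal (measure_pmf.prob (bind_pmf p f) C)"
    by (simp only: emeasure_bind_pmf measure_pmf.emeasure_eq_measure[symmetric])
  finally show ?thesis by (simp add: ennreal_le_iff)
qed

lemma step_prob_ge:
  assumes "\<And>s. s \<in> D \<Longrightarrow> enabled M s \<noteq> {} \<and> r \<le> measure_pmf.prob (\<sigma> (map (the \<circ> \<omega>) [0..<n]) s) A" "0 \<le> r"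
  shows "measure (measure_spmf (next_state M n \<omega>)) D * r \<le>
    measure_pmf.prob (step_spmf M \<sigma> n \<omega>) {Some (s, a) | s a. s \<in> D \<and> a \<in> A}"
  unfolding step_spmf_eq measure_spmf_conv_prob
proof (rule prob_le_prob_bind[OF _ assms(2)])
  let ?h = "map (the \<circ> \<omega>) [0..<n]" and ?C = "{Some (s, a) | s a. s \<in> D \<and> a \<in> A}"
  fix x assume "x \<in> Some ` D"
  then obtain s where s: "x = Some s" "s \<in> D" by auto
  have "(\<lambda>a. Some (s, a)) -` ?C = A" using s by auto
  then have "measure_pmf.prob (act_spmf M \<sigma> ?h s) ?C = measure_pmf.prob (\<sigma> ?h s) A"
    using assms(1)[OF s(2)] by (simp add: act_spmf_ne measure_map_pmf)
  then show "r \<le> measure_pmf.prob (case x of None \<Rightarrow> return_pmf None | Some s \<Rightarrow> act_spmf M \<sigma> ?h s) ?C"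
    using assms(1)[OF s(2)] s by simp
qed

section \<open>From flows to schedulers\<close>

text \<open>Marks the moment when the remembered decision is carried out. An original action played
  for any other reason is not counted, so the count numbers the decisions of the flow.\<close>

definition takes :: "'s \<times> 'a \<times> 'a qaction option \<Rightarrow> bool" where
  "takes p \<longleftrightarrow> snd (snd p) = Some (Orig (fst (snd p)))"

lemma takes_simp [simp]: "takes (s, a, c) \<longleftrightarrow> c = Some (Orig a)"
  by (simp add: takes_def)

context rabin_mdp
begin

lemma enabled_unique: "(s, a) \<in> enabled_pairs M \<Longrightarrow> (s', a) \<in> enabled_pairs M \<Longrightarrow> s = s'"
  using disj enabled_pairs_states(1)[OF subM] unfolding disjoint_actions_def enabled_def by blast

definition mec_of :: "'s set \<Rightarrow> ('s \<times> 'a) set" where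
  "mec_of D = (THE E. mec M E \<and> ec_states E = D)"

lemma mec_of_eq:
  assumes "mec M E" shows "mec_of (ec_states E) = E"
  unfolding mec_of_def
proof (rule the_equality)
  fix E' assume E': "mec M E' \<and> ec_states E' = ec_states E"
  obtain p where "p \<in> E" using assms by (auto simp: mec_def end_component_def)
  then have "fst p \<in> ec_states E" by simp
  with E' show "E' = E" using mec_unique[of M E' E "fst p"] assms by simp
qed (use assms in simp)

definition target :: "'s set \<Rightarrow> nat set \<Rightarrow> ('s \<times> 'a) set" where
  "target D I = (SOME E'. E' \<subseteq> mec_of D \<and> end_component M E' \<and> (\<forall>i\<in>I. ec_rabin E' (P i)))"

lemma choices_target:
  assumes "(D, I) \<in> choices"
  shows "mec M (mec_of D)" "ec_states (mec_of D) = D" "target D I \<subseteq> mec_of D"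
    "end_component M (target D I)" "\<And>i. i \<in> I \<Longrightarrow> ec_rabin (target D I) (P i)"
proof -
  from assms obtain E E' where E: "mec M E" "ec_states E = D"
    "E' \<subseteq> E" "end_component M E'" "\<forall>i\<in>I. ec_rabin E' (P i)"
    unfolding rabin_choices_def by blast
  have eq: "mec_of D = E" using mec_of_eq[OF E(1)] E(2) by simp
  then show "mec M (mec_of D)" "ec_states (mec_of D) = D" using E by simp_all
  have "\<exists>E'. E' \<subseteq> mec_of D \<and> end_component M E' \<and> (\<forall>i\<in>I. ec_rabin E' (P i))"
    using E eq by blast
  from someI_ex[OF this] show "target D I \<subseteq> mec_of D" "end_component M (target D I)"
    "\<And>i. i \<in> I \<Longrightarrow> ec_rabin (target D I) (P i)"
    unfolding target_def by blast+
qed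

text \<open>A block with two different states is not a singleton class. If the decided action
  belongs to another state of the block, there is thus a MEC to walk through.\<close>

lemma mec_of_other_state:
  assumes "D \<in> \<D>" "s \<in> D" "t \<in> D" "s \<noteq> t"
  shows "mec M (mec_of D)" "ec_states (mec_of D) = D"
proof -
  from assms obtain E where "mec M E" "D = ec_states E"
    unfolding mec_partition_def by auto
  then show "mec M (mec_of D)" "ec_states (mec_of D) = D" using mec_of_eq by simp_all
qed

lemma end_component_succ:
  "end_component M E \<Longrightarrow> (s, a) \<in> E \<Longrightarrow> t \<in> set_spmf (succ_spmf M s a) \<Longrightarrow> t \<in> ec_states E"
  unfolding end_component_def by blast

lemma end_component_enabled: "end_component M E \<Longrightarrow> p \<in> E \<Longrightarrow> p \<in> enabled_pairs M"
  unfolding end_component_def by blast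

text \<open>The moves that implement a decision: walk to the state owning the chosen leaving action, or
  walk into the chosen end component and stay there.\<close>

definition moves :: "'s \<Rightarrow> 'a qaction option \<Rightarrow> 'a set" where
  "moves s c = (case c of None \<Rightarrow> {}
    | Some (Orig a) \<Rightarrow> if leaves M (blk s) s a then {a} else {b. (s, b) \<in> mec_of (blk s)}
    | Some (Tau I) \<Rightarrow> if s \<in> ec_states (target (blk s) I) then {b. (s, b) \<in> target (blk s) I}
        else {b. (s, b) \<in> mec_of (blk s)})"

text \<open>The fallback to all enabled actions keeps the choice nonempty for arbitrary memory
  contents. By \<open>acts_Orig\<close> and \<open>acts_Tau\<close> it does not occur for the
  decisions available in the quotient at the block of \<open>s\<close>.\<close>

definition acts :: "'s \<Rightarrow> 'a qaction option \<Rightarrow> 'a set" where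
  "acts s c = (if moves s c \<inter> enabled M s = {} then enabled M s else moves s c \<inter> enabled M s)"

lemma acts_enabled: "acts s c \<subseteq> enabled M s"
  by (auto simp: acts_def)

lemma acts_nonempty: "enabled M s \<noteq> {} \<Longrightarrow> acts s c \<noteq> {}"
  by (auto simp: acts_def)

lemma finite_acts: "finite (acts s c)"
proof (rule finite_subset[OF acts_enabled])
  show "finite (enabled M s)"
    by (rule finite_subset[OF _ finite_actions(1)])
      (auto simp: enabled_iff dest: enabled_pairs_states(2)[OF subM])
qed

lemma acts_eq:
  assumes "end_component M E" "E' \<subseteq> E" "moves s c = {b. (s, b) \<in> E'}" "s \<in> ec_states E'"
  shows "acts s c = {b. (s, b) \<in> E'}"
proof -
  have "moves s c \<subseteq> enabled M s"
    using assms end_component_enabled[OF assms(1)] by (auto simp: enabled_iff)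
  moreover have "moves s c \<noteq> {}" using assms(3,4) by auto
  ultimately show ?thesis using assms(3) by (auto simp: acts_def)
qed

lemma acts_Orig:
  assumes D: "D \<in> \<D>" and b: "leaves M D u b" and s: "s \<in> D"
  shows "acts s (Some (Orig b)) = (if s = u then {b} else {a. (s, a) \<in> mec_of D})"
proof (cases "s = u")
  case True
  have "blk s = D" by (rule block_of_eq[OF D s])
  then have "moves s (Some (Orig b)) = {b}" using True b by (simp add: moves_def)
  moreover have "b \<in> enabled M s" using b True by (simp add: leaves_def enabled_iff)
  ultimately show ?thesis using True by (simp add: acts_def)
next
  case False
  have "blk s = D" by (rule block_of_eq[OF D s])
  moreover have "\<not> leaves M D s b" using leaves_unique[OF b] False by blast
  ultimately have mv: "moves s (Some (Orig b)) = {a. (s, a) \<in> mec_of D}" by (simp add: moves_def)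
  note E = mec_of_other_state[OF D s leaves_state[OF b] False]
  have "end_component M (mec_of D)" using E(1) by (simp add: mec_def)
  moreover have "s \<in> ec_states (mec_of D)" by (subst E(2)) (rule s)
  ultimately have "acts s (Some (Orig b)) = {a. (s, a) \<in> mec_of D}" by (rule acts_eq[OF _ subset_refl mv])
  then show ?thesis using False by (simp only: if_False)
qed

lemma acts_Tau:
  assumes I: "(D, I) \<in> choices" and s: "s \<in> D"
  shows "acts s (Some (Tau I)) =
    (if s \<in> ec_states (target D I) then {b. (s, b) \<in> target D I} else {b. (s, b) \<in> mec_of D})"
proof -
  note E = choices_target[OF I]
  have ec: "end_component M (mec_of D)" using E(1) by (simp add: mec_def)
  have blk: "blk s = D" by (rule block_of_eq[OF conjunct1[OF choicesD[OF I]] s])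
  show ?thesis
  proof (cases "s \<in> ec_states (target D I)")
    case True
    then have "moves s (Some (Tau I)) = {b. (s, b) \<in> target D I}" by (simp add: moves_def blk)
    from acts_eq[OF ec E(3) this True] True show ?thesis by simp
  next
    case False
    then have "moves s (Some (Tau I)) = {b. (s, b) \<in> mec_of D}" by (simp add: moves_def blk)
    moreover have "s \<in> ec_states (mec_of D)" by (subst E(2)) (rule s)
    ultimately have "acts s (Some (Tau I)) = {b. (s, b) \<in> mec_of D}" by (rule acts_eq[OF ec subset_refl])
    then show ?thesis using False by (simp only: if_False)
  qed
qed

end

locale rabin_flow = rabin_mdp M k P
  for M :: "('s, 'a) smdp" and k :: nat and P :: "nat \<Rightarrow> ('s set \<times> 's set) set" +
  fixes Y :: "'s qstate set" and x :: "nat \<Rightarrow> 's set \<Rightarrow> 'a qaction \<Rightarrow> real"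
  assumes Y: "Y \<subseteq> states Q" "initial Q \<in> Y" and x: "flow Y x"
begin

definition S where "S = \<Union>{D \<in> \<D>. Block D \<in> Y}"

abbreviation "N \<equiv> subsystem M S"

definition C :: "'a qaction option set" where "C = insert None (Some ` actions Q)"

definition z where "z n D = (\<Sum>c\<in>actions Q. x n D c)"

definition q where "q = (SOME q. \<forall>n D. (\<forall>c. x n D c = (\<Sum>c\<in>actions Q. x n D c) * pmf (q n D) c) \<and>
    ((\<Sum>c\<in>actions Q. x n D c) \<noteq> 0 \<longrightarrow> set_pmf (q n D) \<subseteq> {c. x n D c \<noteq> 0}))"

lemma q: "x n D c = z n D * pmf (q n D) c" "z n D \<noteq> 0 \<Longrightarrow> set_pmf (q n D) \<subseteq> {c. x n D c \<noteq> 0}"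
  using someI_ex[OF flow_strategy[OF x]] unfolding q_def z_def by blast+

lemma z_nonzero: "x n D c \<noteq> 0 \<Longrightarrow> z n D \<noteq> 0"
  using q(1)[of n D c] by auto

text \<open>The memory content is the current decision (\<open>None\<close> if there is nothing to imitate). The number
  of leaving actions taken so far is read off the history.\<close>

definition decide :: "('s \<times> 'a \<times> 'a qaction option) list \<Rightarrow> 's \<Rightarrow> 'a qaction option pmf" where
  "decide h s =
    (if h = [] \<or> takes (last h) then
       (if z (length (filter takes h)) (blk s) \<noteq> 0
        then map_pmf Some (q (length (filter takes h)) (blk s)) else return_pmf None)
     else return_pmf (if snd (snd (last h)) \<in> C then snd (snd (last h)) else None))"

text \<open>Uniform choice among finitely many actions bounds the probability of each one away from
  0; the recurrence arguments live on this.\<close>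

definition walk :: "('s, 'a \<times> 'a qaction option) sched" where
  "walk h s = bind_pmf (decide h s) (\<lambda>c. map_pmf (\<lambda>a. (a, c)) (pmf_of_set (acts s c)))"

lemma S_states: "S \<subseteq> states M"
  using mec_partition_subset[OF subM] unfolding S_def by blast

lemma block_S: "D \<in> \<D> \<Longrightarrow> Block D \<in> Y \<Longrightarrow> D \<subseteq> S"
  unfolding S_def by blast

lemma initial_S: "initial M \<in> S"
proof -
  have "initial M \<in> states M" using subM by (simp add: substochastic_mdp_def)
  from block_of_in[OF this] show ?thesis using Y(2) unfolding S_def by (auto simp: Q_simps)
qed

lemma subN: "substochastic_mdp N"
  by (rule substochastic_subsystem[OF subM S_states initial_S])

lemma finite_C: "finite C" "C \<noteq> {}"
  using finite_actions by (auto simp: C_def)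

lemma flow_actions: "x n D c \<noteq> 0 \<Longrightarrow> c \<in> actions Q"
  using flow_support(2)[OF x] enabled_pairs_Q_actions by blast

lemma enabled_N: "s \<in> S \<Longrightarrow> enabled N s = enabled M s"
  by (simp add: enabled_subsystem)

text \<open>A scheduler is total on histories, including those whose last memory content lies
  outside \<open>C\<close>; the guard in \<open>decide\<close> replaces such a content by
  \<open>None\<close>.\<close>

lemma decide_C: "set_pmf (decide h s) \<subseteq> C"
proof (cases "(h = [] \<or> takes (last h)) \<and> z (length (filter takes h)) (blk s) \<noteq> 0")
  case True
  then have "set_pmf (decide h s) = Some ` set_pmf (q (length (filter takes h)) (blk s))"
    by (simp add: decide_def)
  moreover have "set_pmf (q (length (filter takes h)) (blk s)) \<subseteq> actions Q"
    using q(2)[of "length (filter takes h)" "blk s"] True flow_actions by blast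
  ultimately show ?thesis by (auto simp: C_def)
next
  case False
  then have "\<exists>c\<in>C. decide h s = return_pmf c"
    by (auto simp: decide_def C_def)
  then show ?thesis by auto
qed

lemma scheduler_walk: "scheduler (memory_mdp N C) walk"
  unfolding scheduler_def
proof (intro allI ballI impI)
  fix h s assume "s \<in> states (memory_mdp N C)" "enabled (memory_mdp N C) s \<noteq> {}"
  then have s: "s \<in> S" "enabled M s \<noteq> {}" by (auto simp: enabled_memory enabled_N)
  have "set_pmf (pmf_of_set (acts s c)) = acts s c" for c
    using finite_acts acts_nonempty[OF s(2)] by simp
  then show "set_pmf (walk h s) \<subseteq> enabled (memory_mdp N C) s"
    using decide_C[of h s] s
    by (auto simp: walk_def enabled_memory enabled_N dest!: subsetD[OF acts_enabled])
qed

sublocale memory_run N C walk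
  by unfold_locales (rule subN finite_C scheduler_walk)+

abbreviation "visits \<equiv> count_before takes"

lemma walk_memory: "map_pmf snd (walk h s) = decide h s"
proof -
  have "map_pmf snd (walk h s) = bind_pmf (decide h s) (\<lambda>c. map_pmf (\<lambda>a. c) (pmf_of_set (acts s c)))"
    by (simp add: walk_def map_bind_pmf pmf.map_comp comp_def)
  also have "\<dots> = decide h s" by (simp add: map_pmf_const bind_return_pmf')
  finally show ?thesis .
qed

lemma walk_new:
  assumes "h = [] \<or> takes (last h)" "z (length (filter takes h)) (blk s) \<noteq> 0"
  shows "measure_pmf.prob (walk h s) {(a, Some c) | a. True} = pmf (q (length (filter takes h)) (blk s)) c"
proof -
  let ?q = "q (length (filter takes h)) (blk s)"
  have eq: "{(a, Some c) | a. True} = snd -` {Some c}" by auto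
  have "measure_pmf.prob (walk h s) {(a, Some c) | a. True} = measure_pmf.prob (map_pmf snd (walk h s)) {Some c}"
    by (simp only: measure_map_pmf eq)
  also have "\<dots> = pmf (map_pmf Some ?q) (Some c)"
    unfolding walk_memory using assms by (simp add: decide_def measure_pmf_single)
  also have "\<dots> = pmf ?q c" by (rule pmf_map_inj') simp
  finally show ?thesis .
qed

lemma walk_old:
  assumes "h \<noteq> []" "\<not> takes (last h)" "snd (snd (last h)) = c" "c \<in> C" "enabled M s \<noteq> {}" "a \<in> acts s c"
  shows "pmf (walk h s) (a, c) = 1 / card (acts s c)"
proof -
  have "walk h s = map_pmf (\<lambda>a. (a, c)) (pmf_of_set (acts s c))"
    using assms(1-4) by (simp add: walk_def decide_def bind_return_pmf)
  then have "pmf (walk h s) (a, c) = pmf (pmf_of_set (acts s c)) a"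
    by (simp add: pmf_map_inj'[where f="\<lambda>a. (a, c)"] inj_def)
  also have "\<dots> = 1 / card (acts s c)"
    using assms(6) finite_acts acts_nonempty[OF assms(5)] by (simp add: pmf_of_set)
  finally show ?thesis .
qed

lemma walk_support:
  assumes "enabled M s \<noteq> {}" "(a, c) \<in> set_pmf (walk h s)"
  shows "a \<in> acts s c" "c \<in> set_pmf (decide h s)"
  using assms finite_acts acts_nonempty[OF assms(1)] by (auto simp: walk_def)

end

section \<open>Runs of the walk while a decision is pending\<close>

context rabin_flow
begin

text \<open>What positive flow weight guarantees about a decision (\<open>flow_mode\<close>). The
  path arguments need only this and become independent of the decision number.\<close>

definition mode :: "'s set \<Rightarrow> 'a qaction \<Rightarrow> bool" where
  "mode D c \<longleftrightarrow> D \<in> \<D> \<and> Block D \<in> Y \<and> (Block D, c) \<in> enabled_pairs Q"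

lemma flow_mode: "x n D c \<noteq> 0 \<Longrightarrow> mode D c"
  using flow_support[OF x, of n D c] by (cases c) (auto simp: mode_def enabled_pairs_Q dest: choicesD)

lemma mode_C: "mode D c \<Longrightarrow> Some c \<in> C"
  using enabled_pairs_Q_actions by (auto simp: mode_def C_def)

lemma mode_S: "mode D c \<Longrightarrow> D \<subseteq> S"
  using block_S by (auto simp: mode_def)

lemma mode_Orig: "mode D (Orig b) \<Longrightarrow> \<exists>u. leaves M D u b"
  by (simp add: mode_def enabled_pairs_Q)

lemma mode_Tau: "mode D (Tau I) \<Longrightarrow> (D, I) \<in> choices"
  by (simp add: mode_def enabled_pairs_Q)

text \<open>Until the decided action is played, only pairs of the MEC are used, so the walk can
  neither lose mass nor leave \<open>D\<close>.\<close>

lemma acts_internal: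
  assumes m: "mode D c" and s: "s \<in> D" and a: "a \<in> acts s (Some c)" and nt: "c \<noteq> Orig a"
  shows "mec M (mec_of D)" "ec_states (mec_of D) = D" "(s, a) \<in> mec_of D"
proof -
  have "mec M (mec_of D) \<and> ec_states (mec_of D) = D \<and> (s, a) \<in> mec_of D"
  proof (cases c)
    case (Orig b)
    from mode_Orig m Orig obtain u where u: "leaves M D u b" by blast
    have D: "D \<in> \<D>" using m by (simp add: mode_def)
    have acts: "acts s (Some (Orig b)) = (if s = u then {b} else {a. (s, a) \<in> mec_of D})"
      by (rule acts_Orig[OF D u s])
    have "s \<noteq> u" using a nt acts Orig by auto
    with mec_of_other_state[OF D s leaves_state[OF u]] acts a Orig show ?thesis by auto
  next
    case (Tau I)
    have I: "(D, I) \<in> choices" using m mode_Tau Tau by blast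
    have "acts s (Some (Tau I)) =
      (if s \<in> ec_states (target D I) then {b. (s, b) \<in> target D I} else {b. (s, b) \<in> mec_of D})"
      by (rule acts_Tau[OF I s])
    with choices_target(1-3)[OF I] a Tau show ?thesis by (auto split: if_splits)
  qed
  then show "mec M (mec_of D)" "ec_states (mec_of D) = D" "(s, a) \<in> mec_of D" by blast+
qed

text \<open>A state of \<open>D\<close> either owns the decided action or lies in a MEC, so the walk
  meets no dead end.\<close>

lemma mode_enabled:
  assumes m: "mode D c" and s: "s \<in> D"
  shows "enabled M s \<noteq> {}"
proof (cases c)
  case (Orig b)
  with m obtain u where u: "leaves M D u b" using mode_Orig by blast
  have D: "D \<in> \<D>" using m by (simp add: mode_def)
  show ?thesis
  proof (cases "s = u")
    case True
    then show ?thesis using u by (auto simp: leaves_def enabled_iff)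
  next
    case False
    note E = mec_of_other_state[OF D s leaves_state[OF u] False]
    then obtain a where "(s, a) \<in> mec_of D" using s by force
    then show ?thesis using E(1) end_component_enabled by (fastforce simp: mec_def enabled_iff)
  qed
next
  case (Tau I)
  note E = choices_target(1,2)[OF mode_Tau[OF m[unfolded Tau]]]
  then obtain a where "(s, a) \<in> mec_of D" using s by force
  then show ?thesis using E(1) end_component_enabled by (fastforce simp: mec_def enabled_iff)
qed

lemma internal_succ:
  assumes m: "mode D c" and E: "mec M (mec_of D)" "ec_states (mec_of D) = D" "(s, a) \<in> mec_of D"
  shows "set_spmf (succ_spmf M s a) \<subseteq> D" "lossless_spmf (succ_spmf M s a)"
    "succ_spmf N s a = succ_spmf M s a" "s \<in> D"
proof -
  have ec: "end_component M (mec_of D)" using E(1) by (simp add: mec_def)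
  show sD: "s \<in> D" using E(2,3) by force
  show sub: "set_spmf (succ_spmf M s a) \<subseteq> D"
    using end_component_succ[OF ec E(3)] E(2) by auto
  show "lossless_spmf (succ_spmf M s a)"
    using mdp end_component_enabled[OF ec E(3)] by (auto simp: mdp_def)
  show "succ_spmf N s a = succ_spmf M s a"
    using mode_S[OF m] sD sub by (auto simp: succ_subsystem intro!: restrict_spmf_trivial')
qed

definition valid :: "(nat \<Rightarrow> ('s \<times> 'a \<times> 'a qaction option) option) \<Rightarrow> bool" where
  "valid \<omega> \<longleftrightarrow> \<omega> \<in> space R.PM \<and> (\<forall>n. \<omega> n \<in> set_pmf (R.K n \<omega>))"

lemma AE_valid: "AE \<omega> in R.PM. valid \<omega>"
  using R.AE_in_set_pmf AE_space by eventually_elim (simp add: valid_def)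

lemma valid_space: "valid \<omega> \<Longrightarrow> \<omega> \<in> space R.PM" and valid_pmf: "valid \<omega> \<Longrightarrow> \<forall>n. \<omega> n \<in> set_pmf (R.K n \<omega>)"
  by (simp_all add: valid_def)

lemma valid_enabled: "valid \<omega> \<Longrightarrow> \<omega> t = Some (s, a, c) \<Longrightarrow> (s, a) \<in> enabled_pairs M \<and> s \<in> S \<and> c \<in> C"
  using R.outcomes_Some[OF valid_space, of \<omega> t "(s, a, c)"]
  by (auto simp: enabled_pairs_memory enabled_pairs_subsystem)

lemma valid_acts:
  assumes v: "valid \<omega>" and t: "\<omega> t = Some (s, a, c)"
  shows "a \<in> acts s c" "c \<in> set_pmf (decide (map (the \<circ> \<omega>) [0..<t]) s)"
proof -
  have "Some (s, a, c) \<in> set_pmf (R.K t \<omega>)" using valid_pmf[OF v] t by metis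
  from step_support[OF this] have "(a, c) \<in> set_pmf (walk (map (the \<circ> \<omega>) [0..<t]) s)" by simp
  moreover have "enabled M s \<noteq> {}" using valid_enabled[OF v t] by (auto simp: enabled_iff)
  ultimately show "a \<in> acts s c" "c \<in> set_pmf (decide (map (the \<circ> \<omega>) [0..<t]) s)"
    using walk_support by blast+
qed

lemma valid_stay:
  assumes v: "valid \<omega>" and m: "mode D c" and t: "\<omega> t = Some (s, a, Some c)" and s: "s \<in> D" and nt: "c \<noteq> Orig a"
  shows "\<exists>s' a'. \<omega> (Suc t) = Some (s', a', Some c) \<and> s' \<in> set_spmf (succ_spmf M s a) \<and> s' \<in> D"
proof -
  note E = acts_internal[OF m s valid_acts(1)[OF v t] nt]
  note int = internal_succ[OF m E]
  have succ: "succ_spmf (memory_mdp N C) s (a, Some c) = succ_spmf M s a"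
    using mode_C[OF m] int(3) by (simp add: succ_memory)
  have "\<omega> (Suc t) \<noteq> None"
  proof (rule path_not_lost[OF valid_pmf[OF v] t])
    show "lossless_spmf (succ_spmf (memory_mdp N C) s (a, Some c))" using succ int(2) by simp
    fix s' assume "s' \<in> set_spmf (succ_spmf (memory_mdp N C) s (a, Some c))"
    then have "s' \<in> D" using succ int(1) by auto
    then show "enabled (memory_mdp N C) s' \<noteq> {}"
      using mode_enabled[OF m, of s'] mode_S[OF m] finite_C(2) by (auto simp: enabled_memory enabled_N)
  qed
  then obtain s' a' c' where t': "\<omega> (Suc t) = Some (s', a', c')" by auto
  from path_step[OF valid_pmf[OF v] t'] t succ have s': "s' \<in> set_spmf (succ_spmf M s a)" by auto
  have "c' \<in> set_pmf (decide (map (the \<circ> \<omega>) [0..<Suc t]) s')" by (rule valid_acts(2)[OF v t'])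
  then have "c' = Some c" using t nt mode_C[OF m] by (simp add: decide_def)
  with t' s' int(1) show ?thesis by auto
qed

lemma valid_persist:
  assumes v: "valid \<omega>" and m: "mode D c" and t0: "\<omega> t0 = Some (s, a, Some c)" "s \<in> D"
    and le: "t0 \<le> t" and nt: "\<And>u. t0 \<le> u \<Longrightarrow> u < t \<Longrightarrow> \<not> takes (the (\<omega> u))"
  shows "\<exists>s a. \<omega> t = Some (s, a, Some c) \<and> s \<in> D \<and> visits t \<omega> = visits t0 \<omega>"
  using le nt
proof (induction t rule: dec_induct)
  case base
  then show ?case using t0 by blast
next
  case (step t)
  then obtain s a where t: "\<omega> t = Some (s, a, Some c)" "s \<in> D" "visits t \<omega> = visits t0 \<omega>" by fastforce
  have "\<not> takes (the (\<omega> t))" using step by simp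
  then have "c \<noteq> Orig a" using t(1) by simp
  from valid_stay[OF v m t(1,2) this] obtain s' a' where "\<omega> (Suc t) = Some (s', a', Some c)" "s' \<in> D" by auto
  moreover have "visits (Suc t) \<omega> = visits t0 \<omega>"
    using \<open>\<not> takes (the (\<omega> t))\<close> t(3) by (simp add: count_before_Suc)
  ultimately show ?case by blast
qed

text \<open>Fairness of the walk. It is restricted to pairs that do not carry out their decision,
  since afterwards the memory is drawn anew.\<close>

definition closed_run :: "(nat \<Rightarrow> ('s \<times> 'a \<times> 'a qaction option) option) \<Rightarrow> bool" where
  "closed_run \<omega> \<longleftrightarrow> (\<forall>p\<in>enabled_pairs (memory_mdp N C). \<forall>p'\<in>enabled_pairs (memory_mdp N C).
     \<not> takes p \<and> fst p' \<in> set_spmf (succ_spmf N (fst p) (fst (snd p))) \<and> snd (snd p') = snd (snd p) \<and>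
       fst (snd p') \<in> acts (fst p') (snd (snd p)) \<longrightarrow>
     (\<exists>\<^sub>\<infinity>t. \<omega> t = Some p) \<longrightarrow> (\<exists>\<^sub>\<infinity>t. \<omega> t = Some p'))"

lemma ne_of_mem: "a \<in> A \<Longrightarrow> A \<noteq> {}"
  by blast

lemma AE_closed_run: "AE \<omega> in R.PM. closed_run \<omega>"
  unfolding closed_run_def
proof (intro AE_ball_countable[THEN iffD2] ballI AE_impI)
  have fin: "finite (enabled_pairs (memory_mdp N C))" by (rule R.finite_enabled_pairs)
  then show "countable (enabled_pairs (memory_mdp N C))" "countable (enabled_pairs (memory_mdp N C))"
    by (rule countable_finite)+
  fix p p' assume p: "p \<in> enabled_pairs (memory_mdp N C)" and p': "p' \<in> enabled_pairs (memory_mdp N C)"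
    and cond: "\<not> takes p \<and> fst p' \<in> set_spmf (succ_spmf N (fst p) (fst (snd p))) \<and> snd (snd p') = snd (snd p) \<and>
       fst (snd p') \<in> acts (fst p') (snd (snd p))"
  obtain s a c where pp: "p = (s, a, c)" by (cases p)
  obtain s' a' where pp': "p' = (s', a', c)" using cond pp by (cases p') auto
  have ac: "a' \<in> acts s' c" and sc: "s' \<in> set_spmf (succ_spmf N s a)" using cond pp pp' by auto
  have cC: "c \<in> C" and en: "enabled M s' \<noteq> {}" "enabled N s' \<noteq> {}" "enabled (memory_mdp N C) s' \<noteq> {}"
  proof -
    from p' have e: "(s', a') \<in> enabled_pairs N" "c \<in> C" by (simp_all add: pp' enabled_pairs_memory)
    then show "c \<in> C" by simp
    have aN: "a' \<in> enabled N s'" unfolding enabled_iff by (rule e(1))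
    then show "enabled N s' \<noteq> {}" by (rule ne_of_mem)
    have "(a', c) \<in> enabled (memory_mdp N C) s'" unfolding enabled_iff pp'[symmetric] by (rule p')
    then show "enabled (memory_mdp N C) s' \<noteq> {}" by (rule ne_of_mem)
    have "a' \<in> enabled M s'" using aN by (simp add: enabled_subsystem split: if_splits)
    then show "enabled M s' \<noteq> {}" by (rule ne_of_mem)
  qed
  \<comment> \<open>Probability of moving to \<open>s'\<close> times that of picking
    \<open>a'\<close> uniformly; with the decision still pending, the memory is copied with
    certainty.\<close>
  let ?r = "spmf (succ_spmf N s a) s' * (1 / card (acts s' c))"
  have "AE \<omega> in R.PM. (\<exists>\<^sub>\<infinity>t. \<omega> t = Some p) \<longrightarrow> (\<exists>\<^sub>\<infinity>t. \<omega> t \<in> {Some p'})"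
  proof (rule R.AE_frequently_next)
    have "0 < card (acts s' c)" by (simp only: card_gt_0_iff finite_acts ne_of_mem[OF ac] simp_thms not_False_eq_True)
    moreover have "0 < spmf (succ_spmf N s a) s'"
      using sc by (simp only: in_set_spmf_iff_spmf less_le pmf_nonneg simp_thms)
    ultimately show "0 < ?r" by simp
    fix \<omega> and n :: nat assume n: "\<omega> n = Some p"
    have "pmf (walk (map (the \<circ> \<omega>) [0..<Suc n]) s') (a', c) = 1 / card (acts s' c)"
      using n cond pp cC en(1) ac by (intro walk_old) auto
    then have "?r \<le> pmf (R.K (Suc n) \<omega>) (Some p')"
      using n en cC by (simp add: pp pp' pmf_step_Some next_state_Suc succ_memory del: upt_Suc)
    then show "?r \<le> measure_pmf.prob (R.K (Suc n) \<omega>) {Some p'}" by (simp add: measure_pmf_single)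
  qed
  then show "AE \<omega> in R.PM. (\<exists>\<^sub>\<infinity>t. \<omega> t = Some p) \<longrightarrow> (\<exists>\<^sub>\<infinity>t. \<omega> t = Some p')" by simp
qed

text \<open>Asking for all acts at \<open>s\<close>, not just for infinitely many visits, is what
  lets recurrence pass along every edge of the walk.\<close>

definition recurrent :: "'s set \<Rightarrow> 'a qaction \<Rightarrow> (nat \<Rightarrow> ('s \<times> 'a \<times> 'a qaction option) option) \<Rightarrow> 's set" where
  "recurrent D c \<omega> = {s \<in> D. \<forall>a\<in>acts s (Some c). \<exists>\<^sub>\<infinity>t. \<omega> t = Some (s, a, Some c)}"

lemma frequently_succ_recurrent:
  assumes cl: "closed_run \<omega>" and m: "mode D c" and s: "s \<in> D" and a: "a \<in> acts s (Some c)" "c \<noteq> Orig a"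
    and inf: "\<exists>\<^sub>\<infinity>t. \<omega> t = Some (s, a, Some c)" and s': "s' \<in> set_spmf (succ_spmf M s a)"
  shows "s' \<in> recurrent D c \<omega>"
proof -
  note E = acts_internal[OF m s a]
  note int = internal_succ[OF m E]
  have "s' \<in> D" using s' int(1) by blast
  have en: "(u, b, Some c) \<in> enabled_pairs (memory_mdp N C)" if "u \<in> D" "b \<in> acts u (Some c)" for u b
    using that subsetD[OF acts_enabled that(2)] mode_S[OF m] mode_C[OF m]
    by (auto simp: enabled_pairs_memory enabled_pairs_subsystem enabled_iff)
  have "\<exists>\<^sub>\<infinity>t. \<omega> t = Some (s', a', Some c)" if "a' \<in> acts s' (Some c)" for a'
    using cl en[OF s a(1)] en[OF \<open>s' \<in> D\<close> that] that a(2) s' int(3) inf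
    unfolding closed_run_def by fastforce
  with \<open>s' \<in> D\<close> show ?thesis by (simp add: recurrent_def)
qed

lemma recurrent_frequently:
  assumes "s \<in> recurrent D c \<omega>" "mode D c"
  obtains a where "a \<in> acts s (Some c)" "\<exists>\<^sub>\<infinity>t. \<omega> t = Some (s, a, Some c)"
proof -
  have "s \<in> D" using assms(1) by (simp add: recurrent_def)
  from acts_nonempty[OF mode_enabled[OF assms(2) this]] obtain a where "a \<in> acts s (Some c)" by blast
  with assms(1) that show ?thesis by (auto simp: recurrent_def)
qed

text \<open>By the pigeonhole principle one pair recurs. It has a successor because its action is
  lossless, and by fairness that successor is recurrent.\<close>

lemma forever_recurrent:
  assumes cl: "closed_run \<omega>" and v: "valid \<omega>" and m: "mode D c"
    and fo: "\<And>t. t0 \<le> t \<Longrightarrow> \<exists>s a. \<omega> t = Some (s, a, Some c) \<and> s \<in> D \<and> c \<noteq> Orig a"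
  shows "recurrent D c \<omega> \<noteq> {}"
proof -
  let ?A = "{p \<in> enabled_pairs (memory_mdp N C). fst p \<in> D \<and> snd (snd p) = Some c \<and> c \<noteq> Orig (fst (snd p))}"
  have "\<exists>\<^sub>\<infinity>t. \<exists>p\<in>?A. \<omega> t = Some p"
    unfolding INFM_nat_le
  proof
    fix k
    from fo[of "max k t0"] obtain s a where
      t: "\<omega> (max k t0) = Some (s, a, Some c)" "s \<in> D" "c \<noteq> Orig a" by auto
    then have "(s, a, Some c) \<in> ?A" using R.outcomes_Some[OF valid_space[OF v] t(1)] by simp
    with t(1) show "\<exists>t\<ge>k. \<exists>p\<in>?A. \<omega> t = Some p" by (intro exI[of _ "max k t0"]) auto
  qed
  moreover have "finite ?A" using R.finite_enabled_pairs by (rule finite_subset[rotated]) auto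
  ultimately obtain p where p: "p \<in> ?A" "\<exists>\<^sub>\<infinity>t. \<omega> t = Some p"
    using INFM_finite_Bex_distrib[of ?A "\<lambda>p t. \<omega> t = Some p"] by blast
  then obtain s a where s: "p = (s, a, Some c)" "s \<in> D" "c \<noteq> Orig a" by (cases p) auto
  from INFM_EX[OF p(2)] obtain t where "\<omega> t = Some (s, a, Some c)" using s by blast
  then have a: "a \<in> acts s (Some c)" using valid_acts(1)[OF v] by blast
  have "lossless_spmf (succ_spmf M s a)"
    using internal_succ(2)[OF m acts_internal[OF m s(2) a s(3)]] .
  then have "set_spmf (succ_spmf M s a) \<noteq> {}"
    using measure_spmf_zero_iff[of "succ_spmf M s a" UNIV] by (simp add: lossless_spmf_def weight_spmf_def)
  then obtain s' where "s' \<in> set_spmf (succ_spmf M s a)" by blast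
  from frequently_succ_recurrent[OF cl m s(2) a s(3) p(2)[unfolded s(1)] this] show ?thesis by blast
qed

text \<open>Recurrence propagates along a path of \<open>E\<close> until the path meets
  \<open>Z\<close>, where the walk may follow other rules. \<open>Z\<close> will be the owner of the
  decided action or the state set of the target component.\<close>

lemma recurrent_reaches:
  assumes cl: "closed_run \<omega>" and m: "mode D c"
    and st: "s \<in> recurrent D c \<omega>" and path: "(s, e) \<in> (ec_edges M E)\<^sup>*" and e: "e \<in> Z"
    and E: "\<And>u. u \<in> recurrent D c \<omega> - Z \<Longrightarrow> acts u (Some c) = {a. (u, a) \<in> E} \<and> (\<forall>a. (u, a) \<in> E \<longrightarrow> c \<noteq> Orig a)"
  shows "\<exists>u\<in>recurrent D c \<omega>. u \<in> Z"
  using path st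
proof (induction rule: converse_rtrancl_induct)
  case base
  then show ?case using e by blast
next
  case (step u u')
  show ?case
  proof (cases "u \<in> Z")
    case True
    then show ?thesis using step by blast
  next
    case False
    from step(1) obtain a where a: "(u, a) \<in> E" "u' \<in> set_spmf (succ_spmf M u a)" by (auto simp: ec_edges_def)
    have acts: "a \<in> acts u (Some c)" "c \<noteq> Orig a" using E[of u] step.prems False a by auto
    have "u \<in> D" "\<exists>\<^sub>\<infinity>t. \<omega> t = Some (u, a, Some c)" using step.prems acts(1) by (auto simp: recurrent_def)
    from frequently_succ_recurrent[OF cl m this(1) acts this(2) a(2)] show ?thesis by (rule step.IH)
  qed
qed

end

section \<open>Decisions are carried out, and the resulting probabilities\<close>

context rabin_flow
begin

lemma end_component_path:
  "end_component M E \<Longrightarrow> s \<in> ec_states E \<Longrightarrow> t \<in> ec_states E \<Longrightarrow> (s, t) \<in> (ec_edges M E)\<^sup>*"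
  unfolding end_component_def by blast

text \<open>Otherwise the run would stay in \<open>D\<close> forever with the same memory. Some
  state would be recurrent, hence also the owner of \<open>b\<close>, whose only act is
  \<open>b\<close>; so \<open>b\<close> would be taken after all.\<close>

lemma leaving_action_taken:
  assumes cl: "closed_run \<omega>" and v: "valid \<omega>" and m: "mode D (Orig b)"
    and t0: "\<omega> t0 = Some (s, a, Some (Orig b))" "s \<in> D"
  shows "\<exists>t u. \<omega> t = Some (u, b, Some (Orig b)) \<and> u \<in> D \<and> visits t \<omega> = visits t0 \<omega>"
proof -
  have "\<exists>t\<ge>t0. takes (the (\<omega> t))"
  proof (rule ccontr)
    assume "\<not> ?thesis"
    then have nt: "\<not> takes (the (\<omega> t))" if "t0 \<le> t" for t using that by blast
    have fo: "\<exists>s a. \<omega> t = Some (s, a, Some (Orig b)) \<and> s \<in> D \<and> Orig b \<noteq> Orig a" if "t0 \<le> t" for t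
    proof -
      obtain s a where "\<omega> t = Some (s, a, Some (Orig b))" "s \<in> D"
        using valid_persist[OF v m t0 \<open>t0 \<le> t\<close> nt] by blast
      with nt[OF that] show ?thesis by auto
    qed
    obtain u where u: "leaves M D u b" using mode_Orig[OF m] by blast
    have D: "D \<in> \<D>" using m by (simp add: mode_def)
    have uD: "u \<in> D" by (rule leaves_state[OF u])
    from forever_recurrent[OF cl v m fo] obtain r where r: "r \<in> recurrent D (Orig b) \<omega>" by blast
    then have rD: "r \<in> D" by (simp add: recurrent_def)
    have "u \<in> recurrent D (Orig b) \<omega>"
    proof (cases "r = u")
      case False
      note E = mec_of_other_state[OF D rD uD False]
      have ec: "end_component M (mec_of D)" using E(1) by (simp add: mec_def)
      have "\<exists>v\<in>recurrent D (Orig b) \<omega>. v \<in> {u}"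
      proof (rule recurrent_reaches[OF cl m r])
        show "(r, u) \<in> (ec_edges M (mec_of D))\<^sup>*"
          using end_component_path[OF ec, unfolded E(2), OF rD uD] .
        fix v assume v: "v \<in> recurrent D (Orig b) \<omega> - {u}"
        then have "v \<in> D" "v \<noteq> u" by (auto simp: recurrent_def)
        \<comment> \<open>By disjointness of actions, an action of \<open>v\<close> equal to
          \<open>b\<close> would make \<open>v\<close> its owner.\<close>
        have "Orig b \<noteq> Orig a" if "(v, a) \<in> mec_of D" for a
        proof
          assume "Orig b = Orig a"
          moreover have "(v, a) \<in> enabled_pairs M" by (rule end_component_enabled[OF ec that])
          moreover have "(u, b) \<in> enabled_pairs M" using u by (simp add: leaves_def)
          ultimately show False using enabled_unique[of v a u] \<open>v \<noteq> u\<close> by simp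
        qed
        with acts_Orig[OF D u \<open>v \<in> D\<close>] \<open>v \<noteq> u\<close>
        show "acts v (Some (Orig b)) = {a. (v, a) \<in> mec_of D} \<and> (\<forall>a. (v, a) \<in> mec_of D \<longrightarrow> Orig b \<noteq> Orig a)"
          by simp
      qed simp
      then show ?thesis by simp
    qed (use r in simp)
    moreover have "b \<in> acts u (Some (Orig b))" using acts_Orig[OF D u uD] by simp
    ultimately have "\<exists>\<^sub>\<infinity>t. \<omega> t = Some (u, b, Some (Orig b))" by (simp add: recurrent_def)
    then obtain t where "t \<ge> t0" "\<omega> t = Some (u, b, Some (Orig b))" by (auto simp: INFM_nat_le)
    with nt show False by fastforce
  qed
  then obtain t where t: "t0 \<le> t" "takes (the (\<omega> t))" "\<And>u. t0 \<le> u \<Longrightarrow> u < t \<Longrightarrow> \<not> takes (the (\<omega> u))"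
    using exists_least_iff[of "\<lambda>t. t0 \<le> t \<and> takes (the (\<omega> t))"] by auto
  from valid_persist[OF v m t0 t(1) t(3)] obtain s a where
    "\<omega> t = Some (s, a, Some (Orig b))" "s \<in> D" "visits t \<omega> = visits t0 \<omega>" by blast
  with t(2) show ?thesis by (intro exI[of _ t] exI[of _ s]) simp
qed

lemma tau_forever:
  assumes v: "valid \<omega>" and m: "mode D (Tau I)" and t0: "\<omega> t0 = Some (s, a, Some (Tau I))" "s \<in> D" and le: "t0 \<le> t"
  shows "\<exists>s a. \<omega> t = Some (s, a, Some (Tau I)) \<and> s \<in> D \<and> visits t \<omega> = visits t0 \<omega>"
  using le
proof (induction t rule: dec_induct)
  case base
  then show ?case using t0 by blast
next
  case (step t)
  then obtain s a where t: "\<omega> t = Some (s, a, Some (Tau I))" "s \<in> D" "visits t \<omega> = visits t0 \<omega>" by blast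
  from valid_stay[OF v m t(1,2)] obtain s' a' where "\<omega> (Suc t) = Some (s', a', Some (Tau I))" "s' \<in> D" by auto
  moreover have "visits (Suc t) \<omega> = visits t0 \<omega>" using t by (simp add: count_before_Suc)
  ultimately show ?case by blast
qed

text \<open>Recurrence travels through the MEC into the target component and there, by strong
  connectivity, to all of its states; after its first entry the walk no longer leaves it. The first
  fact gives the recurrence half of the Rabin pair, the second the persistence half.\<close>

lemma tau_rabin:
  assumes cl: "closed_run \<omega>" and v: "valid \<omega>" and m: "mode D (Tau I)"
    and t0: "\<omega> t0 = Some (s, a, Some (Tau I))" "s \<in> D" and i: "i \<in> I"
  shows "\<forall>t. \<omega> t \<noteq> None" "(\<lambda>n. fst (the (\<omega> n))) \<in> rabin (P i)"
proof -
  note fo = tau_forever[OF v m t0]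
  show "\<forall>t. \<omega> t \<noteq> None"
  proof
    fix t
    have "\<omega> (max t t0) \<noteq> None" using fo[of "max t t0"] by auto
    then show "\<omega> t \<noteq> None" using path_None[OF valid_pmf[OF v], of t "max t t0"] by (meson max.cobounded1)
  qed
  have I: "(D, I) \<in> choices" by (rule mode_Tau[OF m])
  note E = choices_target[OF I]
  let ?E = "mec_of D" and ?E' = "target D I"
  have ec: "end_component M ?E" using E(1) by (simp add: mec_def)
  have sub: "ec_states ?E' \<subseteq> D" using E(2,3) by blast
  have "recurrent D (Tau I) \<omega> \<noteq> {}"
  proof (rule forever_recurrent[OF cl v m])
    fix t assume "t0 \<le> t"
    from fo[OF this] show "\<exists>s a. \<omega> t = Some (s, a, Some (Tau I)) \<and> s \<in> D \<and> Tau I \<noteq> Orig a" by auto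
  qed
  then obtain r where r: "r \<in> recurrent D (Tau I) \<omega>" by blast
  then have rD: "r \<in> D" by (simp add: recurrent_def)
  obtain e where e: "e \<in> ec_states ?E'" using E(4) by (auto simp: end_component_def)
  have "\<exists>u\<in>recurrent D (Tau I) \<omega>. u \<in> ec_states ?E'"
  proof (rule recurrent_reaches[OF cl m r _ e])
    show "(r, e) \<in> (ec_edges M ?E)\<^sup>*"
      using end_component_path[OF ec, unfolded E(2), OF rD subsetD[OF sub e]] .
    fix v assume "v \<in> recurrent D (Tau I) \<omega> - ec_states ?E'"
    then have "v \<in> D" "v \<notin> ec_states ?E'" by (auto simp: recurrent_def)
    with acts_Tau[OF I this(1)]
    show "acts v (Some (Tau I)) = {a. (v, a) \<in> ?E} \<and> (\<forall>a. (v, a) \<in> ?E \<longrightarrow> Tau I \<noteq> Orig a)" by simp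
  qed
  then obtain u where u: "u \<in> recurrent D (Tau I) \<omega>" "u \<in> ec_states ?E'" by blast
  have acts': "acts v (Some (Tau I)) = {a. (v, a) \<in> ?E'}" if "v \<in> ec_states ?E'" for v
    using acts_Tau[OF I subsetD[OF sub that]] that by simp
  have rec: "f \<in> recurrent D (Tau I) \<omega>" if f: "f \<in> ec_states ?E'" for f
  proof -
    have "(u, f) \<in> (ec_edges M ?E')\<^sup>*" by (rule end_component_path[OF E(4) u(2) f])
    then show ?thesis
    proof (induction rule: rtrancl_induct)
      case base
      show ?case by (rule u(1))
    next
      case (step v v')
      from step(2) obtain a where a: "(v, a) \<in> ?E'" "v' \<in> set_spmf (succ_spmf M v a)"
        by (auto simp: ec_edges_def)
      have "v \<in> ec_states ?E'" using a(1) by force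
      then have acts: "a \<in> acts v (Some (Tau I))" using acts' a(1) by simp
      have "v \<in> D" "\<exists>\<^sub>\<infinity>t. \<omega> t = Some (v, a, Some (Tau I))"
        using step.IH acts by (auto simp: recurrent_def)
      from frequently_succ_recurrent[OF cl m this(1) acts _ this(2) a(2)] show ?case by simp
    qed
  qed
  from E(5)[OF i] obtain F A where FA: "(F, A) \<in> P i" "ec_states ?E' \<inter> F \<noteq> {}" "ec_states ?E' \<subseteq> A"
    unfolding ec_rabin_def by blast
  then obtain f where f: "f \<in> ec_states ?E'" "f \<in> F" by blast
  from recurrent_frequently[OF rec[OF f(1)] m] obtain a where
    inf: "\<exists>\<^sub>\<infinity>t. \<omega> t = Some (f, a, Some (Tau I))" by blast
  then obtain t1 where t1: "t1 \<ge> t0" "\<omega> t1 = Some (f, a, Some (Tau I))" by (auto simp: INFM_nat_le)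
  \<comment> \<open>Inside the target \<open>acts\<close> consists of target pairs only, whose
    successors stay in the target.\<close>
  have stay: "\<exists>s a. \<omega> t = Some (s, a, Some (Tau I)) \<and> s \<in> ec_states ?E'" if "t1 \<le> t" for t
    using that
  proof (induction t rule: dec_induct)
    case base
    then show ?case using t1 f by blast
  next
    case (step t)
    then obtain s a where t: "\<omega> t = Some (s, a, Some (Tau I))" "s \<in> ec_states ?E'" by blast
    have "(s, a) \<in> ?E'" using valid_acts(1)[OF v t(1)] acts'[OF t(2)] by simp
    moreover obtain s' a' where "\<omega> (Suc t) = Some (s', a', Some (Tau I))" "s' \<in> set_spmf (succ_spmf M s a)"
      using valid_stay[OF v m t(1) subsetD[OF sub t(2)]] by auto
    ultimately show ?case using end_component_succ[OF E(4)] by blast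
  qed
  have "\<exists>\<^sub>\<infinity>n. fst (the (\<omega> n)) \<in> F"
    using inf by (rule INFM_mono) (simp add: f)
  moreover have "\<forall>\<^sub>\<infinity>n. fst (the (\<omega> n)) \<in> A"
    unfolding MOST_nat_le
  proof (intro exI[of _ t1] allI impI)
    fix n assume "t1 \<le> n"
    from stay[OF this] FA(3) show "fst (the (\<omega> n)) \<in> A" by auto
  qed
  ultimately show "(\<lambda>n. fst (the (\<omega> n))) \<in> rabin (P i)" using FA(1) by (auto simp: rabin_def)
qed

text \<open>Here the decision is in memory but need not have been carried out. This is all that
  \<open>Tau I\<close> requires; for \<open>Orig a\<close> the execution follows almost surely from
  \<open>leaving_action_taken\<close>.\<close>

definition enters :: "nat \<Rightarrow> 's set \<Rightarrow> 'a qaction \<Rightarrow> (nat \<Rightarrow> ('s \<times> 'a \<times> 'a qaction option) option) \<Rightarrow> bool" where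
  "enters n D c \<omega> \<longleftrightarrow> (\<exists>t. \<omega> t \<in> {Some (s, a, Some c) | s a. s \<in> D} \<and> visits t \<omega> = n)"

lemma pred_enters: "Measurable.pred R.PM (enters n D c)"
  unfolding enters_def[abs_def]
  by (intro pred_intros_countable pred_intros_logic R.pred_mem R.pred_count)

text \<open>Between drawing a decision and carrying it out no probability is lost. The walk hence
  reproduces the steps of the quotient at the random times when a decision has just been carried
  out, and the induction is the one for the quotient itself.\<close>

lemma flow_le_enters: "x n D c \<le> R.prob {\<omega> \<in> space R.PM. enters n D c \<omega>}"
proof (cases "x n D c = 0")
  case False
  then show ?thesis
  proof (induction n arbitrary: D c)
    case 0
    let ?C = "{Some (s, a) | s a. s \<in> {initial M} \<and> a \<in> {(b, Some c) | b. True}} ::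
      ('s \<times> 'a \<times> 'a qaction option) option set"
    have m: "mode D c" by (rule flow_mode[OF 0])
    have D: "D = blk (initial M)" by (rule flow_init(1)[OF x 0])
    have iD: "initial M \<in> D"
      unfolding D using block_of_in(2)[of "initial M" M] subM by (simp add: substochastic_mdp_def)
    have "R.prob {\<omega> \<in> space R.PM. True} * pmf (q 0 D) c \<le> R.prob {\<omega> \<in> space R.PM. True \<and> \<omega> 0 \<in> ?C}"
    proof (rule R.prob_step_ge)
      fix \<omega> :: "nat \<Rightarrow> ('s \<times> 'a \<times> 'a qaction option) option"
      have "measure (measure_spmf (next_state (memory_mdp N C) 0 \<omega>)) {initial M} * pmf (q 0 D) c
          \<le> measure_pmf.prob (R.K 0 \<omega>) ?C"
      proof (rule step_prob_ge)
        fix s assume s: "s \<in> {initial M}"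
        have "measure_pmf.prob (walk [] s) {(b, Some c) | b. True} = pmf (q 0 D) c"
          using s z_nonzero[OF 0] walk_new[of "[]" s c] by (simp add: D)
        moreover have "enabled (memory_mdp N C) s \<noteq> {}"
          using mode_enabled[OF m iD] s initial_S finite_C by (auto simp: enabled_memory enabled_N)
        ultimately show "enabled (memory_mdp N C) s \<noteq> {} \<and>
            pmf (q 0 D) c \<le> measure_pmf.prob (walk (map (the \<circ> \<omega>) [0..<0]) s) {(b, Some c) | b. True}"
          using s by (simp add: D)
      qed simp
      then show "pmf (q 0 D) c \<le> measure_pmf.prob (R.K 0 \<omega>) ?C"
        by (simp add: next_state_0 spmf_conv_measure_spmf[symmetric])
    qed (auto simp: prefix_det_def)
    moreover have "R.prob {\<omega> \<in> space R.PM. True \<and> \<omega> 0 \<in> ?C} \<le> R.prob {\<omega> \<in> space R.PM. enters 0 D c \<omega>}"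
      using pred_enters iD by (intro R.finite_measure_mono) (auto simp: pred_def enters_def intro!: exI[of _ 0])
    moreover have "x 0 D c \<le> 1 * pmf (q 0 D) c"
      unfolding q(1)[of 0 D c] using flow_init(2)[OF x 0] by (intro mult_right_mono) (auto simp: z_def)
    ultimately show ?case by (simp add: R.prob_space)
  next
    case (Suc n)
    note nz = Suc.prems
    have m': "mode D c" by (rule flow_mode[OF nz])
    have DD: "D \<in> \<D>" "Block D \<in> Y" using m' by (simp_all add: mode_def)
    let ?w = "\<lambda>D' a. spmf (succ_spmf Q (Block D') (Orig a)) (Block D)"
    let ?C = "{Some (s, a) | s a. s \<in> D \<and> a \<in> {(b, Some c) | b. True}} ::
      ('s \<times> 'a \<times> 'a qaction option) option set"
    \<comment> \<open>Again \<open>t\<close> lies one step after the execution of decision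
      \<open>n\<close>, where the next decision is drawn.\<close>
    define G where "G D' a t \<omega> \<longleftrightarrow> 0 < t \<and> \<omega> (t - 1) \<in> {Some (s, a, Some (Orig a)) | s. s \<in> D'} \<and> visits (t - 1) \<omega> = n"
      for D' a t and \<omega> :: "nat \<Rightarrow> ('s \<times> 'a \<times> 'a qaction option) option"
    have pdG: "prefix_det t (G D' a t)" for D' a t
    proof (cases t)
      case (Suc u)
      have 1: "prefix_det t (\<lambda>\<omega>. visits u \<omega> = n)"
        by (rule prefix_det_mono[OF prefix_det_comp[OF prefix_det_count_before]]) (simp add: Suc)
      have 2: "prefix_det t (\<lambda>\<omega>. \<omega> u \<in> {Some (s, a, Some (Orig a)) | s. s \<in> D'})"
        by (rule prefix_det_component) (simp add: Suc)
      have eq: "G D' a t = (\<lambda>\<omega>. \<omega> u \<in> {Some (s, a, Some (Orig a)) | s. s \<in> D'} \<and> visits u \<omega> = n)"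
        by (simp add: G_def Suc fun_eq_iff)
      show ?thesis unfolding eq by (rule prefix_det_conj[OF 2 1])
    qed (simp add: G_def prefix_det_def)
    have G_unique: "t = t' \<and> the (\<omega> (t - 1)) = the (\<omega> (t' - 1))" if g: "G D1 a1 t \<omega>" "G D2 a2 t' \<omega>" for D1 a1 t D2 a2 t' \<omega>
    proof -
      have "takes (the (\<omega> (t - 1)))" "takes (the (\<omega> (t' - 1)))" "visits (t - 1) \<omega> = visits (t' - 1) \<omega>"
        using g by (auto simp: G_def)
      from count_before_inj[of takes, OF this] g show ?thesis by (auto simp: G_def)
    qed
    let ?B = "\<lambda>(D', a) \<omega>. \<exists>t. G D' a t \<omega> \<and> \<omega> t \<in> ?C"
    have predB: "Measurable.pred R.PM (?B p)" for p
      unfolding case_prod_unfold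
      by (intro pred_intros_countable pred_intros_logic R.pred_prefix_det[OF pdG] R.pred_mem)
    have "x (Suc n) D c = z (Suc n) D * pmf (q (Suc n) D) c" by (rule q)
    also have "\<dots> \<le> (\<Sum>(D', a)\<in>\<D> \<times> actions M. x n D' (Orig a) * ?w D' a) * pmf (q (Suc n) D) c"
      using flow_step[OF x DD(2)] by (intro mult_right_mono) (auto simp: z_def)
    also have "\<dots> = (\<Sum>(D', a)\<in>\<D> \<times> actions M. x n D' (Orig a) * (?w D' a * pmf (q (Suc n) D) c))"
      by (simp add: sum_distrib_right case_prod_unfold mult.assoc)
    also have "\<dots> \<le> (\<Sum>p\<in>\<D> \<times> actions M. R.prob {\<omega> \<in> space R.PM. ?B p \<omega>})"
    proof (rule sum_mono, clarify)
      fix D' a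
      show "x n D' (Orig a) * (?w D' a * pmf (q (Suc n) D) c)
        \<le> R.prob {\<omega> \<in> space R.PM. \<exists>t. G D' a t \<omega> \<and> \<omega> t \<in> ?C}"
      proof (cases "x n D' (Orig a) = 0")
        case False
        have m: "mode D' (Orig a)" by (rule flow_mode[OF False])
        obtain u where u: "leaves M D' u a" using mode_Orig[OF m] by blast
        have D': "D' \<in> \<D>" using m by (simp add: mode_def)
        have "R.prob {\<omega> \<in> space R.PM. enters n D' (Orig a) \<omega>} \<le> R.prob {\<omega> \<in> space R.PM. \<exists>t. G D' a t \<omega>}"
        proof (rule R.finite_measure_mono_AE)
          show "{\<omega> \<in> space R.PM. \<exists>t. G D' a t \<omega>} \<in> R.events"
            using R.pred_ex_prefix_det[OF pdG] by (simp add: pred_def)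
          show "AE \<omega> in R.PM. \<omega> \<in> {\<omega> \<in> space R.PM. enters n D' (Orig a) \<omega>} \<longrightarrow> \<omega> \<in> {\<omega> \<in> space R.PM. \<exists>t. G D' a t \<omega>}"
            using AE_valid AE_closed_run
          proof eventually_elim
            case (elim \<omega>)
            have "\<exists>t. G D' a t \<omega>" if e: "enters n D' (Orig a) \<omega>"
            proof -
              from e obtain t s b where t: "\<omega> t = Some (s, b, Some (Orig a))" "s \<in> D'" "visits t \<omega> = n"
                by (auto simp: enters_def)
              from leaving_action_taken[OF elim(2,1) m t(1,2)] t(3) obtain t' v where
                "\<omega> t' = Some (v, a, Some (Orig a))" "v \<in> D'" "visits t' \<omega> = n" by blast
              then have "G D' a (Suc t') \<omega>" by (simp add: G_def)
              then show ?thesis by blast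
            qed
            then show ?case by blast
          qed
        qed
        with Suc.IH[OF False] have "x n D' (Orig a) \<le> R.prob {\<omega> \<in> space R.PM. \<exists>t. G D' a t \<omega>}" by linarith
        then have "x n D' (Orig a) * (?w D' a * pmf (q (Suc n) D) c) \<le>
            R.prob {\<omega> \<in> space R.PM. \<exists>t. G D' a t \<omega>} * (?w D' a * pmf (q (Suc n) D) c)"
          by (rule mult_right_mono) simp
        also have "\<dots> \<le> R.prob {\<omega> \<in> space R.PM. \<exists>t. G D' a t \<omega> \<and> \<omega> t \<in> ?C}"
        proof (rule R.prob_stopped_ge[OF pdG])
          show "t = t'" if "G D' a t \<omega>" "G D' a t' \<omega>" for \<omega> t t'
            using G_unique[OF that] by simp
          fix \<omega> t assume out: "\<forall>i<t. \<omega> i \<in> R.outcomes" and G: "G D' a t \<omega>"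
          then obtain r s where t: "t = Suc r" "\<omega> r = Some (s, a, Some (Orig a))" "s \<in> D'" "visits r \<omega> = n"
            by (cases t) (auto simp: G_def)
          let ?h = "map (the \<circ> \<omega>) [0..<t]"
          from out t have "Some (s, a, Some (Orig a)) \<in> R.outcomes" by (metis lessI)
          then have e: "(s, a) \<in> enabled_pairs M" "s \<in> S"
            by (auto simp: enabled_pairs_memory enabled_pairs_subsystem)
          \<comment> \<open>The action fixes its owner, so \<open>M\<close> moves here with the very
            distribution from which the quotient transition of \<open>D'\<close> was built.\<close>
          have "s = u" using u enabled_unique[OF e(1)] by (simp add: leaves_def)
          have w_eq: "measure (measure_spmf (next_state (memory_mdp N C) t \<omega>)) D = ?w D' a"
          proof -
            have "next_state (memory_mdp N C) t \<omega> = succ_spmf N s a"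
              using t mode_C[OF m] by (simp add: next_state_Suc succ_memory)
            then have "measure (measure_spmf (next_state (memory_mdp N C) t \<omega>)) D = measure (measure_spmf (succ_spmf M s a)) D"
              using e(2) mode_S[OF m'] by (simp add: succ_subsystem Int_absorb2)
            then show ?thesis using spmf_succ_Q[OF D' u DD(1)] \<open>s = u\<close> by simp
          qed
          have "measure (measure_spmf (next_state (memory_mdp N C) t \<omega>)) D * pmf (q (Suc n) D) c
              \<le> measure_pmf.prob (R.K t \<omega>) ?C"
          proof (rule step_prob_ge)
            fix s' assume s': "s' \<in> D"
            have len: "length (filter takes ?h) = Suc n"
              unfolding count_before_def[symmetric] using t by (simp add: count_before_Suc)
            have "takes (last ?h)" using t by simp
            moreover have "blk s' = D" by (rule block_of_eq[OF DD(1) s'])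
            ultimately have "measure_pmf.prob (walk ?h s') {(b, Some c) | b. True} = pmf (q (Suc n) D) c"
              using walk_new[of ?h s' c] z_nonzero[OF nz] by (simp only: len simp_thms)
            moreover have "enabled (memory_mdp N C) s' \<noteq> {}"
              using mode_enabled[OF m' s'] subsetD[OF mode_S[OF m'] s'] finite_C by (auto simp: enabled_memory enabled_N)
            ultimately show "enabled (memory_mdp N C) s' \<noteq> {} \<and>
                pmf (q (Suc n) D) c \<le> measure_pmf.prob (walk ?h s') {(b, Some c) | b. True}" by simp
          qed simp
          then show "?w D' a * pmf (q (Suc n) D) c \<le> measure_pmf.prob (R.K t \<omega>) ?C" unfolding w_eq .
        qed simp
        finally show ?thesis .
      qed simp
    qed
    also have "\<dots> \<le> R.prob {\<omega> \<in> space R.PM. enters (Suc n) D c \<omega>}"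
    proof (rule R.sum_prob_le[OF _ pred_enters predB])
      show "finite (\<D> \<times> actions M)" using finite_\<D> finite_actions by simp
      show "p = p'" if p: "p \<in> \<D> \<times> actions M" "p' \<in> \<D> \<times> actions M" "?B p \<omega>" "?B p' \<omega>" for p p' \<omega>
      proof -
        obtain D1 a1 D2 a2 where pp: "p = (D1, a1)" "p' = (D2, a2)" by (cases p; cases p') auto
        from p pp obtain t t' where g: "G D1 a1 t \<omega>" "G D2 a2 t' \<omega>" by auto
        from G_unique[OF g] g obtain s where "s \<in> D1" "s \<in> D2" "a1 = a2" by (auto simp: G_def)
        with p pp mec_partition_unique[of D1 M D2 s] show ?thesis by simp
      qed
      have "enters (Suc n) D c \<omega>" if B: "G D' a t \<omega>" "\<omega> t \<in> ?C" for D' a t \<omega>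
      proof -
        from B(1) obtain r s where "t = Suc r" "\<omega> r = Some (s, a, Some (Orig a))" "visits r \<omega> = n"
          by (cases t) (auto simp: G_def)
        then have "visits t \<omega> = Suc n" by (simp add: count_before_Suc)
        then show ?thesis using B(2) by (auto simp: enters_def)
      qed
      then show "AE \<omega> in R.PM. \<forall>p\<in>\<D> \<times> actions M. ?B p \<omega> \<longrightarrow> enters (Suc n) D c \<omega>" by auto
    qed
    finally show ?case .
  qed
qed simp

text \<open>A pending \<open>Tau I\<close> is never replaced, so a run enters at most one such
  decision and the events can be summed; each of them almost surely entails the Rabin
  property.\<close>

lemma value_le_path_prob:
  assumes i: "i \<in> {1..k}" and fin: "finite (P i)"
  shows "value_of i x \<le> ennreal (path_prob (memory_mdp N C) walk (rabin (P i)))"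
proof -
  let ?R = "\<lambda>\<omega> :: nat \<Rightarrow> ('s \<times> 'a \<times> 'a qaction option) option.
     (\<forall>n. \<omega> n \<noteq> None) \<and> (\<lambda>n. fst (the (\<omega> n))) \<in> rabin (P i)"
  let ?F = "\<D> \<times> {I. I \<subseteq> {1..k} \<and> i \<in> I}"
  \<comment> \<open>With \<open>mode\<close> in the event, the pairs that the flow cannot use
    contribute nothing, while the path lemmas apply to all the others.\<close>
  let ?B = "\<lambda>n p \<omega>. mode (fst p) (Tau (snd p)) \<and> enters n (fst p) (Tau (snd p)) \<omega>"
  have le: "ennreal (x n D (Tau I)) \<le> emeasure R.PM {\<omega> \<in> space R.PM. mode D (Tau I) \<and> enters n D (Tau I) \<omega>}" for n D I
  proof (cases "x n D (Tau I) = 0")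
    case False
    then show ?thesis
      using flow_le_enters[of n D "Tau I"] flow_mode[OF False] by (simp add: R.emeasure_eq_measure ennreal_leI)
  qed simp
  have "value_of i x \<le> (\<Sum>n. \<Sum>p\<in>?F. emeasure R.PM {\<omega> \<in> space R.PM. ?B n p \<omega>})"
    unfolding value_of_def using le by (intro suminf_le sum_mono) auto
  also have "\<dots> \<le> emeasure R.PM {\<omega> \<in> space R.PM. ?R \<omega>}"
  proof (rule R.suminf_sum_le_emeasure[OF finite_index])
    show "Measurable.pred R.PM ?R"
      by (intro pred_intros_logic R.pred_alive R.pred_rabin fin)
    fix n p show "Measurable.pred R.PM (?B n p)"
      by (intro pred_intros_conj1' pred_enters)
  next
    show "AE \<omega> in R.PM. \<forall>n n'. \<forall>p\<in>?F. \<forall>p'\<in>?F. ?B n p \<omega> \<longrightarrow> ?B n' p' \<omega> \<longrightarrow> n = n' \<and> p = p'"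
      using AE_valid
    proof eventually_elim
      case (elim \<omega>)
      have uniq: "n = n' \<and> D = D' \<and> I = I'"
        if m: "mode D (Tau I)" and m': "mode D' (Tau I')" and t: "\<omega> t = Some (s, a, Some (Tau I))" "s \<in> D" "visits t \<omega> = n"
          and t': "\<omega> t' = Some (s', a', Some (Tau I'))" "s' \<in> D'" "visits t' \<omega> = n'" and le: "t \<le> t'"
        for n n' D D' I I' t t' s s' a a'
      proof -
        from tau_forever[OF elim m t(1,2) le] t t' have "I = I'" "s' \<in> D" "n = n'" by auto
        with m m' t' mec_partition_unique[of D M D' s'] show ?thesis by (simp add: mode_def)
      qed
      show ?case
      proof (intro allI ballI impI)
        fix n n' p p' assume B: "?B n p \<omega>" "?B n' p' \<omega>"
        from B(1) obtain t s a where t: "\<omega> t = Some (s, a, Some (Tau (snd p)))" "s \<in> fst p" "visits t \<omega> = n"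
          by (auto simp: enters_def)
        from B(2) obtain t' s' a' where t': "\<omega> t' = Some (s', a', Some (Tau (snd p')))" "s' \<in> fst p'" "visits t' \<omega> = n'"
          by (auto simp: enters_def)
        show "n = n' \<and> p = p'"
          using uniq[OF _ _ t t'] uniq[OF _ _ t' t] B by (cases "t \<le> t'") (auto simp: prod_eq_iff)
      qed
    qed
    show "AE \<omega> in R.PM. \<forall>n. \<forall>p\<in>?F. ?B n p \<omega> \<longrightarrow> ?R \<omega>"
      using AE_valid AE_closed_run
    proof eventually_elim
      case (elim \<omega>)
      show ?case
      proof (intro allI ballI impI)
        fix n p assume p: "p \<in> ?F" and B: "?B n p \<omega>"
        then have ip: "i \<in> snd p" by auto
        from B obtain t s a where t: "\<omega> t = Some (s, a, Some (Tau (snd p)))" "s \<in> fst p"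
          by (auto simp: enters_def)
        show "?R \<omega>"
          using tau_rabin[OF elim(2,1) conjunct1[OF B] t ip] by blast
      qed
    qed
  qed
  also have "\<dots> = ennreal (path_prob (memory_mdp N C) walk (rabin (P i)))"
    by (simp add: path_prob_def R.emeasure_eq_measure)
  finally show ?thesis .
qed

lemma flow_to_scheduler_rabin:
  assumes fin: "\<And>i. i \<in> {1..k} \<Longrightarrow> finite (P i)"
  shows "\<exists>\<sigma>. scheduler N \<sigma> \<and> (\<forall>i\<in>{1..k}. value_of i x \<le> ennreal (path_prob N \<sigma> (rabin (P i))))"
proof (intro exI conjI ballI)
  show "scheduler N induced" by (rule scheduler_induced)
  fix i assume i: "i \<in> {1..k}"
  have "path_prob N induced (rabin (P i)) = path_prob (memory_mdp N C) walk (rabin (P i))"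
    by (rule path_prob_induced[OF S.pred_rabin[OF fin[OF i]]])
  then show "value_of i x \<le> ennreal (path_prob N induced (rabin (P i)))"
    using value_le_path_prob[OF i fin[OF i]] by simp
qed

end

section \<open>Transfer of witnesses and of label sets\<close>

lemma path_prob_le_via_value:
  assumes "ennreal (path_prob N \<sigma> \<psi>) \<le> v" "v \<le> ennreal (path_prob N' \<sigma>' \<psi>')"
  shows "path_prob N \<sigma> \<psi> \<le> path_prob N' \<sigma>' \<psi>'"
  using order_trans[OF assms] by (simp add: path_prob_def ennreal_le_iff)

lemma satisfies_mono:
  assumes "satisfies N k cmp lam \<psi>" "cmp \<in> {(\<ge>), (>)}"
    and "\<And>\<sigma>. scheduler N \<sigma> \<Longrightarrow> \<exists>\<sigma>'. scheduler N' \<sigma>' \<and> (\<forall>i\<in>{1..k}. path_prob N \<sigma> (\<psi> i) \<le> path_prob N' \<sigma>' (\<psi>' i))"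
  shows "satisfies N' k cmp lam \<psi>'"
proof -
  from assms(1) obtain \<sigma> where \<sigma>: "scheduler N \<sigma>" "\<forall>i\<in>{1..k}. cmp (path_prob N \<sigma> (\<psi> i)) (lam i)"
    unfolding satisfies_def by blast
  from assms(3)[OF \<sigma>(1)] obtain \<sigma>' where \<sigma>': "scheduler N' \<sigma>'"
    "\<forall>i\<in>{1..k}. path_prob N \<sigma> (\<psi> i) \<le> path_prob N' \<sigma>' (\<psi>' i)" by blast
  have "cmp (path_prob N' \<sigma>' (\<psi>' i)) (lam i)" if "i \<in> {1..k}" for i
    using \<sigma>(2) \<sigma>'(2) that assms(2) by force
  with \<sigma>'(1) show ?thesis unfolding satisfies_def by blast
qed

context rabin_mdp
begin

lemma witnessing_lift:
  assumes "witnessing Q k cmp lam (\<lambda>i. reach (goal k i)) Y" "cmp \<in> {(\<ge>), (>)}"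
    and fin: "\<And>i. i \<in> {1..k} \<Longrightarrow> finite (P i)"
  shows "witnessing M k cmp lam (\<lambda>i. rabin (P i)) (\<Union>{D \<in> \<D>. Block D \<in> Y})"
proof -
  let ?S = "\<Union>{D \<in> \<D>. Block D \<in> Y}"
  from assms(1) have Y: "Y \<subseteq> states Q" "initial Q \<in> Y"
    and sat: "satisfies (subsystem Q Y) k cmp lam (\<lambda>i. reach (goal k i))"
    unfolding witnessing_def by blast+
  have "initial M \<in> states M" using subM by (simp add: substochastic_mdp_def)
  from block_of_in[OF this] have "initial M \<in> ?S" using Y(2) by (auto simp: Q_simps)
  moreover have "?S \<subseteq> states M" using mec_partition_subset[OF subM] by blast
  moreover have "satisfies (subsystem M ?S) k cmp lam (\<lambda>i. rabin (P i))"
  proof (rule satisfies_mono[OF sat assms(2)])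
    fix \<tau> assume "scheduler (subsystem Q Y) \<tau>"
    from scheduler_to_flow[OF Y this] obtain x where x: "flow Y x"
      "\<And>i. ennreal (path_prob (subsystem Q Y) \<tau> (reach (goal k i))) \<le> value_of i x" by blast
    note le = x(2)
    interpret rabin_flow M k P Y x using Y x(1) by unfold_locales
    from flow_to_scheduler_rabin[OF fin] obtain \<sigma> where "scheduler N \<sigma>"
      "\<forall>i\<in>{1..k}. value_of i x \<le> ennreal (path_prob N \<sigma> (rabin (P i)))" by blast
    with le show "\<exists>\<sigma>. scheduler (subsystem M ?S) \<sigma> \<and> (\<forall>i\<in>{1..k}.
        path_prob (subsystem Q Y) \<tau> (reach (goal k i)) \<le> path_prob (subsystem M ?S) \<sigma> (rabin (P i)))"
      unfolding S_def using path_prob_le_via_value by blast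
  qed
  ultimately show ?thesis unfolding witnessing_def by blast
qed

text \<open>Including every \<open>Bot I\<close> keeps all decisions \<open>Tau I\<close> intact and
  adds no labels, because lifted labels of \<open>Bot I\<close> are empty.\<close>

lemma witnessing_quotient:
  assumes "witnessing M k cmp lam (\<lambda>i. rabin (P i)) T" "cmp \<in> {(\<ge>), (>)}"
    and fin: "\<And>i. i \<in> {1..k} \<Longrightarrow> finite (P i)"
  shows "witnessing Q k cmp lam (\<lambda>i. reach (goal k i)) (Block ` {D \<in> \<D>. D \<inter> T \<noteq> {}} \<union> Bot ` Pow {1..k})"
    (is "witnessing Q k cmp lam _ ?Y")
proof -
  from assms(1) have T: "T \<subseteq> states M" "initial M \<in> T"
    and sat: "satisfies (subsystem M T) k cmp lam (\<lambda>i. rabin (P i))"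
    unfolding witnessing_def by blast+
  have Y: "?Y \<subseteq> states Q" "Bot ` Pow {1..k} \<subseteq> ?Y" by (auto simp: Q_simps)
  have iY: "initial Q \<in> ?Y"
    using block_of_in[of "initial M" M] T by (auto simp: Q_simps)
  have "satisfies (subsystem Q ?Y) k cmp lam (\<lambda>i. reach (goal k i))"
  proof (rule satisfies_mono[OF sat assms(2)])
    fix \<sigma> assume "scheduler (subsystem M T) \<sigma>"
    from scheduler_to_flow_rabin[OF T this fin refl] obtain x where x: "flow ?Y x"
      "\<forall>i\<in>{1..k}. ennreal (path_prob (subsystem M T) \<sigma> (rabin (P i))) \<le> value_of i x" by blast
    from flow_to_scheduler[OF Y(1) iY Y(2) x(1)] obtain \<tau> where "scheduler (subsystem Q ?Y) \<tau>"
      "\<forall>i. value_of i x \<le> ennreal (path_prob (subsystem Q ?Y) \<tau> (reach (goal k i)))" by blast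
    with x(2) show "\<exists>\<tau>. scheduler (subsystem Q ?Y) \<tau> \<and> (\<forall>i\<in>{1..k}.
        path_prob (subsystem M T) \<sigma> (rabin (P i)) \<le> path_prob (subsystem Q ?Y) \<tau> (reach (goal k i)))"
      using path_prob_le_via_value by blast
  qed
  with Y(1) iY show ?thesis unfolding witnessing_def by blast
qed

text \<open>A block that meets \<open>T\<close> enters the quotient as a whole. MEC-equivalence
  ensures that its states outside \<open>T\<close> bring no new labels.\<close>

lemma labels_quotient:
  assumes T: "T \<subseteq> states M" and eqv: "mec_equivalent M \<Lambda>"
  shows "labels (lift_labels \<Lambda>) (Block ` {D \<in> \<D>. D \<inter> T \<noteq> {}} \<union> Bot ` Pow {1..k}) = labels \<Lambda> T"
proof -
  have const: "\<Lambda> s = \<Lambda> t" if "D \<in> \<D>" "s \<in> D" "t \<in> D" for D s t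
  proof (cases "s = t")
    case False
    note E = mec_of_other_state[OF that False]
    with eqv that show ?thesis unfolding mec_equivalent_def by metis
  qed simp
  have "labels (lift_labels \<Lambda>) (Block ` {D \<in> \<D>. D \<inter> T \<noteq> {}} \<union> Bot ` Pow {1..k}) =
    (\<Union>D\<in>{D \<in> \<D>. D \<inter> T \<noteq> {}}. labels \<Lambda> D)"
    by (auto simp: labels_def)
  also have "\<dots> = labels \<Lambda> T"
  proof (intro equalityI subsetI)
    fix l assume "l \<in> (\<Union>D\<in>{D \<in> \<D>. D \<inter> T \<noteq> {}}. labels \<Lambda> D)"
    then obtain D s t where "D \<in> \<D>" "s \<in> D" "t \<in> D" "t \<in> T" "l \<in> \<Lambda> s" by (auto simp: labels_def)
    then show "l \<in> labels \<Lambda> T" using const[of D s t] by (auto simp: labels_def)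
  next
    fix l assume "l \<in> labels \<Lambda> T"
    then obtain s where s: "s \<in> T" "l \<in> \<Lambda> s" by (auto simp: labels_def)
    then have "s \<in> states M" using T by blast
    from block_of_in[OF this] s show "l \<in> (\<Union>D\<in>{D \<in> \<D>. D \<inter> T \<noteq> {}}. labels \<Lambda> D)"
      by (intro UN_I[of "blk s"]) (auto simp: labels_def)
  qed
  finally show ?thesis .
qed

lemma labels_lift:
  assumes "Y \<subseteq> states Q"
  shows "labels (lift_labels \<Lambda>) Y = labels \<Lambda> (\<Union>{D \<in> \<D>. Block D \<in> Y})"
proof -
  have "labels (lift_labels \<Lambda>) Y = (\<Union>D\<in>{D \<in> \<D>. Block D \<in> Y}. labels \<Lambda> D)"
  proof (intro equalityI subsetI)
    fix l assume "l \<in> labels (lift_labels \<Lambda>) Y"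
    then obtain y where y: "y \<in> Y" "l \<in> lift_labels \<Lambda> y" by (auto simp: labels_def)
    with assms show "l \<in> (\<Union>D\<in>{D \<in> \<D>. Block D \<in> Y}. labels \<Lambda> D)" by (cases y) (auto simp: Q_simps)
  next
    fix l assume "l \<in> (\<Union>D\<in>{D \<in> \<D>. Block D \<in> Y}. labels \<Lambda> D)"
    then obtain D where "Block D \<in> Y" "l \<in> lift_labels \<Lambda> (Block D)" by auto
    then show "l \<in> labels (lift_labels \<Lambda>) Y" unfolding labels_def by blast
  qed
  then show ?thesis by (simp add: labels_def)
qed

end

theorem theorem4:
  fixes M :: "('s, 'a) smdp"
    and k :: nat
    and P :: "nat \<Rightarrow> ('s set \<times> 's set) set"
    and lam :: "nat \<Rightarrow> real"
    and cmp :: "real \<Rightarrow> real \<Rightarrow> bool"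
    and \<Lambda> :: "'s \<Rightarrow> 'l set"
    and Y :: "'s qstate set"
  assumes "mdp M" and "disjoint_actions M"
    and "\<And>i. i \<in> {1..k} \<Longrightarrow> P i \<subseteq> Pow (states M) \<times> Pow (states M)"
    and "\<And>i. i \<in> {1..k} \<Longrightarrow> 0 \<le> lam i \<and> lam i \<le> 1"
    and "cmp \<in> {(\<ge>), (>)}"
    and "mec_equivalent M \<Lambda>"
    and "minimal_witnessing (mdp_quotient M k (mec_partition M) (rabin_choices M k P))
           k cmp lam (\<lambda>i. reach (goal k i)) (lift_labels \<Lambda>) Y"
  shows "minimal_witnessing M k cmp lam (\<lambda>i. rabin (P i)) \<Lambda>
           (\<Union>{D \<in> mec_partition M. Block D \<in> Y})"
proof -
  interpret rabin_mdp M k P using assms(1,2) by unfold_locales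
  have "finite (states M)" using subM by (simp add: substochastic_mdp_def)
  \<comment> \<open>Finiteness of the pair sets makes the Rabin events measurable.\<close>
  then have fin: "finite (P i)" if "i \<in> {1..k}" for i
    using finite_subset[OF assms(3)[OF that]] by simp
  have Y: "witnessing Q k cmp lam (\<lambda>i. reach (goal k i)) Y"
    and min: "\<And>Y'. witnessing Q k cmp lam (\<lambda>i. reach (goal k i)) Y' \<Longrightarrow>
      \<not> labels (lift_labels \<Lambda>) Y' \<prec> labels (lift_labels \<Lambda>) Y"
    using assms(7) unfolding minimal_witnessing_def Q_def[symmetric] by blast+
  \<comment> \<open>A witness \<open>T\<close> with a smaller label set would give a witness in the
    quotient with that same label set, against the minimality of \<open>Y\<close>.\<close>
  have "\<not> labels \<Lambda> T \<prec> labels \<Lambda> (\<Union>{D \<in> \<D>. Block D \<in> Y})"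
    if T: "witnessing M k cmp lam (\<lambda>i. rabin (P i)) T" for T
  proof -
    have "T \<subseteq> states M" "Y \<subseteq> states Q" using T Y by (simp_all add: witnessing_def)
    from min[OF witnessing_quotient[OF T assms(5) fin]] show ?thesis
      by (simp only: labels_quotient[OF \<open>T \<subseteq> states M\<close> assms(6)] labels_lift[OF \<open>Y \<subseteq> states Q\<close>] not_False_eq_True)
  qed
  with witnessing_lift[OF Y assms(5) fin] show ?thesis
    unfolding minimal_witnessing_def by blast
qed

end
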